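(* Let $2n\ge 4$ and let $\omega$ be a $T^{2n}$-invariant symplectic form on the torus $T^{2n}$. Let $\nabla^t=\nabla^0+\sum_{k\ge1}t^kA^{(k)}$ be a formal curve of symplectic connections on $(T^{2n},\omega)$ such that $\nabla^0$ is the standard flat connection on $T^{2n}$ and such that $W^t=0$. Then the formal curvature $R^t$ of $\nabla^t$ vanishes, and there exists a formal curve of symplectomorphisms $\psi_t$ of $(T^{2n},\omega)$ such that $\widetilde\nabla^t:=\psi_t\cdot\nabla^t$ is a formal curve of flat $T^{2n}$-invariant symplectic connections.
   Context: $T^{2n}=\mathbb{R}^{2n}/\mathbb{Z}^{2n}$ with angle coordinates $x^a$ and invariant vector fields $\partial_a$; the standard flat connection $\nabla^0$ is defined by $\nabla^0_{\partial_a}\partial_b=0$. A $T^{2n}$-invariant object has constant components in these coordinates. A symplectic connection on a symplectic manifold $(M,\omega)$ is a torsion-free linear connection $\nabla$ with $\nabla\omega=0$. Formal curve of symplectic connections: a formal power series $\nabla^t=\nabla+\sum_{k\ge1}t^kA^{(k)}$, where $\nabla$ is a symplectic connection and the $A^{(k)}$ are smooth $(2,1)$-tensors such that $\underline{A}^{(k)}(X,Y,Z):=\omega(A^{(k)}(X)Y,Z)$ is totally symmetric. It is $T^{2n}$-invariant if $\nabla$ and all $A^{(k)}$ are. Its formal curvature is $R^t(X,Y)=\nabla^t_X\nabla^t_Y-\nabla^t_Y\nabla^t_X-\nabla^t_{[X,Y]}$ (a formal power series in $t$); put $R^t(X,Y;Z,T)=\omega(R^t(X,Y)Z,T)$ and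 $r^t(X,Y)=\operatorname{Trace}[Z\mapsto R^t(X,Z)Y]$. Flat means $R^t=0$. Define $$E^t(X,Y;Z,T)=\tfrac{-1}{2(n+1)}\big[2\omega(X,Y)r^t(Z,T)+\omega(X,Z)r^t(Y,T)+\omega(X,T)r^t(Y,Z)-\omega(Y,Z)r^t(X,T)-\omega(Y,T)r^t(X,Z)\big]$$ and $W^t=R^t-E^t$. The curve is of Ricci type if $W^t=0$. Formal curve of symplectomorphisms of $(M,\omega)$: a homomorphism of Poisson algebras $\psi_t=\psi^{(0)}+\sum_{k\ge1}t^k\psi^{(k)}:C^\infty(M)\to C^\infty(M)[[t]]$ with $\psi^{(0)}:C^\infty(M)\to C^\infty(M)$ an isomorphism; it is extended $\mathbb{R}[[t]]$-linearly to $C^\infty(M)[[t]]$. It acts on formal curves of vector fields (viewed as $\mathbb{R}[[t]]$-linear derivations of $C^\infty(M)[[t]]$) by $(\psi_t\cdot X_t)f=\psi_t(X_t(\psi_t^{-1}f))$ and on formal curves of symplectic connections by $(\psi_t\cdot\nabla^t)_XY=\psi_t\cdot\big(\nabla^t_{\psi_t^{-1}\cdot X}\,\psi_t^{-1}\cdot Y\big)$. *)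

theory Defs
  imports "HOL-Analysis.Analysis" "HOL-Computational_Algebra.Formal_Power_Series"
begin

section \<open>Smooth functions on the torus\<close>

primrec C_k :: "nat \<Rightarrow> ('a::euclidean_space \<Rightarrow> real) \<Rightarrow> bool" where
  "C_k 0 f \<longleftrightarrow> continuous_on UNIV f"
| "C_k (Suc k) f \<longleftrightarrow>
     (\<forall>x. f differentiable (at x)) \<and> (\<forall>v. C_k k (\<lambda>x. frechet_derivative f (at x) v))"

definition smooth :: "('a::euclidean_space \<Rightarrow> real) \<Rightarrow> bool" where
  "smooth f \<longleftrightarrow> (\<forall>k. C_k k f)"

lemma smooth_differentiable: "smooth f \<Longrightarrow> f differentiable (at x)"
  unfolding smooth_def by (metis C_k.simps(2))

lemma smooth_frechet_derivative: "smooth f \<Longrightarrow> smooth (\<lambda>x. frechet_derivative f (at x) v)"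
  unfolding smooth_def by (metis C_k.simps(2))

lemma smooth_imp_continuous: "smooth f \<Longrightarrow> continuous_on UNIV f"
  unfolding smooth_def by (metis C_k.simps(1))

lemma smooth_const: "smooth (\<lambda>x. c)"
proof -
  have "C_k k (\<lambda>x::'a. c)" for k c
    by (induction k arbitrary: c) auto
  then show ?thesis by (simp add: smooth_def)
qed

lemma C_k_add: "C_k k f \<Longrightarrow> C_k k g \<Longrightarrow> C_k k (\<lambda>x. f x + g x)"
proof (induction k arbitrary: f g)
  case (Suc k)
  then have f: "\<And>x. f differentiable (at x)" and g: "\<And>x. g differentiable (at x)"
    by auto
  have "frechet_derivative (\<lambda>x. f x + g x) (at x) v
      = frechet_derivative f (at x) v + frechet_derivative g (at x) v" for x v
    using has_derivative_add[of f _ "at x" g] f[of x] g[of x]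
    by (metis frechet_derivative_at frechet_derivative_works)
  then show ?case using Suc f g by auto
qed (auto intro: continuous_on_add)

lemma smooth_add: "smooth f \<Longrightarrow> smooth g \<Longrightarrow> smooth (\<lambda>x. f x + g x)"
  by (simp add: smooth_def C_k_add)

lemma smooth_mult:
  assumes "smooth f" "smooth g"
  shows "smooth (\<lambda>x. f x * g x)"
proof -
  have "C_k k (\<lambda>x. f x * g x)" if "smooth f" "smooth g" for k and f g :: "'a \<Rightarrow> real"
    using that
  proof (induction k arbitrary: f g)
    case 0
    then show ?case by (auto intro: continuous_on_mult smooth_imp_continuous)
  next
    case (Suc k)
    have f: "\<And>x. f differentiable (at x)" and g: "\<And>x. g differentiable (at x)"
      using Suc.prems smooth_differentiable by auto
    have "frechet_derivative (\<lambda>x. f x * g x) (at x)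
        = (\<lambda>v. f x * frechet_derivative g (at x) v + frechet_derivative f (at x) v * g x)" for x
      by (rule sym, rule frechet_derivative_at, rule has_derivative_mult)
         (use f g in \<open>simp_all flip: frechet_derivative_works\<close>)
    then show ?case
      using Suc f g by (auto intro!: C_k_add smooth_frechet_derivative)
  qed
  then show ?thesis using assms by (simp add: smooth_def)
qed

quotient_type (overloaded) 'm torus = "real ^ 'm::finite" /
  "\<lambda>x y. \<forall>i. x $ i - y $ i \<in> \<int>"
proof (rule equivpI)
  show "reflp (\<lambda>x y::real ^ 'm. \<forall>i. x $ i - y $ i \<in> \<int>)"
    by (auto intro: reflpI)
  show "symp (\<lambda>x y::real ^ 'm. \<forall>i. x $ i - y $ i \<in> \<int>)"
  proof (rule sympI, rule allI)
    fix x y :: "real ^ 'm" and i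
    assume "\<forall>i. x $ i - y $ i \<in> \<int>"
    then have "- (x $ i - y $ i) \<in> \<int>" by (intro Ints_minus) blast
    then show "y $ i - x $ i \<in> \<int>" by simp
  qed
  show "transp (\<lambda>x y::real ^ 'm. \<forall>i. x $ i - y $ i \<in> \<int>)"
  proof (rule transpI)
    fix x y z :: "real ^ 'm"
    assume *: "\<forall>i. x $ i - y $ i \<in> \<int>" "\<forall>i. y $ i - z $ i \<in> \<int>"
    have "x $ i - z $ i = (x $ i - y $ i) + (y $ i - z $ i)" for i by simp
    then show "\<forall>i. x $ i - z $ i \<in> \<int>" using * by (metis Ints_add)
  qed
qed

typedef (overloaded) ('m::finite) cinf =
  "{f :: 'm torus \<Rightarrow> real. smooth (\<lambda>x. f (abs_torus x))}"
  morphisms cinf_apply Abs_cinf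
  by (rule exI[of _ "\<lambda>_. 0"]) (simp add: smooth_const)

setup_lifting type_definition_cinf

instantiation cinf :: (finite) "{comm_ring_1, real_algebra_1}"
begin

lift_definition zero_cinf :: "'a cinf" is "\<lambda>_. 0" by (rule smooth_const)
lift_definition one_cinf :: "'a cinf" is "\<lambda>_. 1" by (rule smooth_const)
lift_definition plus_cinf :: "'a cinf \<Rightarrow> 'a cinf \<Rightarrow> 'a cinf" is "\<lambda>f g p. f p + g p"
  by (rule smooth_add)
lift_definition times_cinf :: "'a cinf \<Rightarrow> 'a cinf \<Rightarrow> 'a cinf" is "\<lambda>f g p. f p * g p"
  by (rule smooth_mult)
lift_definition scaleR_cinf :: "real \<Rightarrow> 'a cinf \<Rightarrow> 'a cinf" is "\<lambda>c f p. c * f p"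
  by (rule smooth_mult[OF smooth_const])
lift_definition uminus_cinf :: "'a cinf \<Rightarrow> 'a cinf" is "\<lambda>f p. - f p"
  subgoal for f using smooth_mult[OF smooth_const, of "\<lambda>x. f (abs_torus x)" "-1"] by simp
  done
lift_definition minus_cinf :: "'a cinf \<Rightarrow> 'a cinf \<Rightarrow> 'a cinf" is "\<lambda>f g p. f p - g p"
  subgoal for f g
    using smooth_add[of "\<lambda>x. f (abs_torus x)" "\<lambda>x. (-1) * g (abs_torus x)"]
    by (simp add: smooth_mult[OF smooth_const, of _ "-1", simplified])
  done

instance
proof
  show "(0::'a cinf) \<noteq> 1" by transfer (metis zero_neq_one)
qed (transfer; simp add: algebra_simps)+

end

lemma Reals_cinf_iff:
  fixes f :: "'m::finite cinf"
  shows "f \<in> \<real> \<longleftrightarrow> (\<exists>c. \<forall>p. cinf_apply f p = c)"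
proof -
  have "cinf_apply (of_real c :: 'm cinf) p = c" for c p
    by (simp add: of_real_def scaleR_cinf.rep_eq one_cinf.rep_eq)
  then have "f = of_real c \<longleftrightarrow> (\<forall>p. cinf_apply f p = c)" for c
    by (simp add: cinf_apply_inject[symmetric] fun_eq_iff)
  then show ?thesis by (auto simp: Reals_def)
qed

text \<open>The derivative is taken at an arbitrary representative of the point; by periodicity
  it does not depend on the choice.\<close>

lemma frechet_derivative_torus:
  fixes f :: "'m::finite torus \<Rightarrow> real"
  assumes f: "smooth (\<lambda>x. f (abs_torus x))"
  shows "frechet_derivative (\<lambda>x. f (abs_torus x)) (at (rep_torus (abs_torus y)))
       = frechet_derivative (\<lambda>x. f (abs_torus x)) (at y)"
proof -
  define g where "g = (\<lambda>x. f (abs_torus x))"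
  define z where "z = rep_torus (abs_torus y) - y"
  have "abs_torus (rep_torus (abs_torus y)) = abs_torus y"
    by (rule Quotient3_abs_rep[OF Quotient3_torus])
  then have z: "z $ i \<in> \<int>" for i
    by (simp add: z_def torus.abs_eq_iff)
  have g: "g (x + z) = g x" for x
  proof -
    have "abs_torus (x + z) = abs_torus x" using z by (simp add: torus.abs_eq_iff)
    then show ?thesis by (simp add: g_def)
  qed
  let ?D = "frechet_derivative g (at (y + z))"
  have "(g has_derivative ?D) (at (y + z))"
    using smooth_differentiable[OF f] unfolding g_def frechet_derivative_works by blast
  moreover have "((\<lambda>x. x + z) has_derivative (\<lambda>h. h)) (at y)"
    by (auto intro!: derivative_eq_intros)
  ultimately have "((\<lambda>x. g (x + z)) has_derivative ?D) (at y)"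
    using diff_chain_at[of "\<lambda>x. x + z" "\<lambda>h. h" y g ?D] by (simp add: o_def)
  then have "?D = frechet_derivative g (at y)"
    unfolding g by (rule frechet_derivative_at)
  then show ?thesis by (simp add: g_def z_def)
qed

lift_definition pdiff :: "'m::finite \<Rightarrow> 'm cinf \<Rightarrow> 'm cinf" is
  "\<lambda>a f p. frechet_derivative (\<lambda>x. f (abs_torus x)) (at (rep_torus p)) (axis a 1)"
  by (simp add: frechet_derivative_torus smooth_frechet_derivative)


section \<open>Vector fields, symplectic forms and connections\<close>

text \<open>The fields \<open>\<partial>\<^sub>a\<close> are a global frame, so a vector field is given by its components:
  \<open>X\<close> stands for \<open>\<Sum>a. X $ a \<partial>\<^sub>a\<close>. In particular \<open>\<partial>\<^sub>a\<close> itself is \<open>axis a 1\<close>. Tensor fields are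
  \<open>C\<^sup>\<infinity>\<close>-multilinear maps on vector fields.\<close>

type_synonym 'm vfield = "('m cinf, 'm) vec"

definition lie_deriv :: "'m::finite vfield \<Rightarrow> 'm cinf \<Rightarrow> 'm cinf" where
  "lie_deriv X f = (\<Sum>a\<in>UNIV. X $ a * pdiff a f)"

definition lie_bracket :: "'m::finite vfield \<Rightarrow> 'm vfield \<Rightarrow> 'm vfield" where
  "lie_bracket X Y = (\<chi> a. lie_deriv X (Y $ a) - lie_deriv Y (X $ a))"

definition two_form :: "('m::finite vfield \<Rightarrow> 'm vfield \<Rightarrow> 'm cinf) \<Rightarrow> bool" where
  "two_form \<omega> \<longleftrightarrow>
     (\<forall>Y. module_hom (*s) (*) (\<lambda>X. \<omega> X Y)) \<and> (\<forall>X Y. \<omega> X Y = - \<omega> Y X)"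

definition closed_form :: "('m::finite vfield \<Rightarrow> 'm vfield \<Rightarrow> 'm cinf) \<Rightarrow> bool" where
  "closed_form \<omega> \<longleftrightarrow> (\<forall>X Y Z.
     lie_deriv X (\<omega> Y Z) + lie_deriv Y (\<omega> Z X) + lie_deriv Z (\<omega> X Y)
     - \<omega> (lie_bracket X Y) Z - \<omega> (lie_bracket Y Z) X - \<omega> (lie_bracket Z X) Y = 0)"

definition nondegenerate_form :: "('m::finite vfield \<Rightarrow> 'm vfield \<Rightarrow> 'm cinf) \<Rightarrow> bool" where
  "nondegenerate_form \<omega> \<longleftrightarrow> (\<forall>p X.
     (\<forall>Y. cinf_apply (\<omega> X Y) p = 0) \<longrightarrow> (\<forall>a. cinf_apply (X $ a) p = 0))"

definition symplectic_form :: "('m::finite vfield \<Rightarrow> 'm vfield \<Rightarrow> 'm cinf) \<Rightarrow> bool" where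
  "symplectic_form \<omega> \<longleftrightarrow> two_form \<omega> \<and> closed_form \<omega> \<and> nondegenerate_form \<omega>"

text \<open>In \<open>cinf\<close>, \<open>\<real>\<close> is the set of constant functions.\<close>

definition invariant_form :: "('m::finite vfield \<Rightarrow> 'm vfield \<Rightarrow> 'm cinf) \<Rightarrow> bool" where
  "invariant_form \<omega> \<longleftrightarrow> (\<forall>a b. \<omega> (axis a 1) (axis b 1) \<in> \<real>)"

definition linear_connection :: "('m::finite vfield \<Rightarrow> 'm vfield \<Rightarrow> 'm vfield) \<Rightarrow> bool" where
  "linear_connection D \<longleftrightarrow>
     (\<forall>Y. module_hom (*s) (*s) (\<lambda>X. D X Y)) \<and>
     (\<forall>X Y Z. D X (Y + Z) = D X Y + D X Z) \<and>
     (\<forall>X f Y. D X (f *s Y) = lie_deriv X f *s Y + f *s D X Y)"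

definition symplectic_connection ::
    "('m::finite vfield \<Rightarrow> 'm vfield \<Rightarrow> 'm cinf) \<Rightarrow> ('m vfield \<Rightarrow> 'm vfield \<Rightarrow> 'm vfield) \<Rightarrow> bool" where
  "symplectic_connection \<omega> D \<longleftrightarrow>
     linear_connection D \<and>
     (\<forall>X Y. D X Y - D Y X = lie_bracket X Y) \<and>
     (\<forall>X Y Z. lie_deriv X (\<omega> Y Z) = \<omega> (D X Y) Z + \<omega> Y (D X Z))"

definition standard_flat_connection :: "('m::finite vfield \<Rightarrow> 'm vfield \<Rightarrow> 'm vfield) \<Rightarrow> bool" where
  "standard_flat_connection D \<longleftrightarrow>
     linear_connection D \<and> (\<forall>a b. D (axis a 1) (axis b 1) = 0)"

definition tensor21 :: "('m::finite vfield \<Rightarrow> 'm vfield \<Rightarrow> 'm vfield) \<Rightarrow> bool" where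
  "tensor21 A \<longleftrightarrow>
     (\<forall>Y. module_hom (*s) (*s) (\<lambda>X. A X Y)) \<and> (\<forall>X. module_hom (*s) (*s) (\<lambda>Y. A X Y))"

definition totally_symmetric ::
    "('m::finite vfield \<Rightarrow> 'm vfield \<Rightarrow> 'm vfield \<Rightarrow> 'm cinf) \<Rightarrow> bool" where
  "totally_symmetric S \<longleftrightarrow> (\<forall>X Y Z. S X Y Z = S Y X Z \<and> S X Y Z = S X Z Y)"


section \<open>Formal curves\<close>

type_synonym 'm formal_vfield = "('m cinf fps, 'm) vec"

definition vcoeff :: "'m::finite formal_vfield \<Rightarrow> nat \<Rightarrow> 'm vfield" where
  "vcoeff X k = (\<chi> a. fps_nth (X $ a) k)"

definition formal_lie_deriv :: "'m::finite formal_vfield \<Rightarrow> 'm cinf fps \<Rightarrow> 'm cinf fps" where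
  "formal_lie_deriv X F = (\<Sum>a\<in>UNIV. X $ a * Abs_fps (\<lambda>k. pdiff a (fps_nth F k)))"

definition formal_lie_bracket ::
    "'m::finite formal_vfield \<Rightarrow> 'm formal_vfield \<Rightarrow> 'm formal_vfield" where
  "formal_lie_bracket X Y = (\<chi> a. formal_lie_deriv X (Y $ a) - formal_lie_deriv Y (X $ a))"

definition formal_form ::
    "('m::finite vfield \<Rightarrow> 'm vfield \<Rightarrow> 'm cinf) \<Rightarrow>
     'm formal_vfield \<Rightarrow> 'm formal_vfield \<Rightarrow> 'm cinf fps" where
  "formal_form \<omega> X Y = Abs_fps (\<lambda>m. \<Sum>i\<le>m. \<omega> (vcoeff X i) (vcoeff Y (m - i)))"

text \<open>A formal curve of connections \<open>\<nabla> + \<Sum>k\<ge>1. t\<^sup>k A\<^sup>(\<^sup>k\<^sup>)\<close> is represented by its sequence of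
  coefficients \<open>D\<close>, with \<open>D 0 = \<nabla>\<close> and \<open>D k = A\<^sup>(\<^sup>k\<^sup>)\<close> for \<open>k \<ge> 1\<close>; \<open>formal_op D\<close> is the
  \<open>\<real>[[t]]\<close>-bilinear operator on formal vector fields that it defines.\<close>

definition formal_op ::
    "(nat \<Rightarrow> 'm::finite vfield \<Rightarrow> 'm vfield \<Rightarrow> 'm vfield) \<Rightarrow>
     'm formal_vfield \<Rightarrow> 'm formal_vfield \<Rightarrow> 'm formal_vfield" where
  "formal_op D X Y = (\<chi> c. Abs_fps (\<lambda>m.
     (\<Sum>k\<le>m. \<Sum>i\<le>m - k. D k (vcoeff X i) (vcoeff Y (m - k - i))) $ c))"

definition formal_symplectic_curve ::
    "('m::finite vfield \<Rightarrow> 'm vfield \<Rightarrow> 'm cinf) \<Rightarrow>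
     (nat \<Rightarrow> 'm vfield \<Rightarrow> 'm vfield \<Rightarrow> 'm vfield) \<Rightarrow> bool" where
  "formal_symplectic_curve \<omega> D \<longleftrightarrow>
     symplectic_connection \<omega> (D 0) \<and>
     (\<forall>k\<ge>1. tensor21 (D k) \<and> totally_symmetric (\<lambda>X Y Z. \<omega> (D k X Y) Z))"

definition invariant_curve ::
    "(nat \<Rightarrow> 'm::finite vfield \<Rightarrow> 'm vfield \<Rightarrow> 'm vfield) \<Rightarrow> bool" where
  "invariant_curve D \<longleftrightarrow> (\<forall>k a b c. D k (axis a 1) (axis b 1) $ c \<in> \<real>)"

definition curvature ::
    "(nat \<Rightarrow> 'm::finite vfield \<Rightarrow> 'm vfield \<Rightarrow> 'm vfield) \<Rightarrow>
     'm formal_vfield \<Rightarrow> 'm formal_vfield \<Rightarrow> 'm formal_vfield \<Rightarrow> 'm formal_vfield" where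
  "curvature D X Y Z =
     formal_op D X (formal_op D Y Z) - formal_op D Y (formal_op D X Z)
     - formal_op D (formal_lie_bracket X Y) Z"

definition flat :: "(nat \<Rightarrow> 'm::finite vfield \<Rightarrow> 'm vfield \<Rightarrow> 'm vfield) \<Rightarrow> bool" where
  "flat D \<longleftrightarrow> (\<forall>X Y Z. curvature D X Y Z = 0)"

definition ricci ::
    "(nat \<Rightarrow> 'm::finite vfield \<Rightarrow> 'm vfield \<Rightarrow> 'm vfield) \<Rightarrow>
     'm formal_vfield \<Rightarrow> 'm formal_vfield \<Rightarrow> 'm cinf fps" where
  "ricci D X Y = trace (matrix (\<lambda>Z. curvature D X Z Y))"

text \<open>With \<open>2 n\<close> the dimension, \<open>CARD('m) + 2 = 2 (n + 1)\<close>.\<close>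

definition ricci_part ::
    "('m::finite vfield \<Rightarrow> 'm vfield \<Rightarrow> 'm cinf) \<Rightarrow>
     (nat \<Rightarrow> 'm vfield \<Rightarrow> 'm vfield \<Rightarrow> 'm vfield) \<Rightarrow>
     'm formal_vfield \<Rightarrow> 'm formal_vfield \<Rightarrow> 'm formal_vfield \<Rightarrow> 'm formal_vfield \<Rightarrow> 'm cinf fps" where
  "ricci_part \<omega> D X Y Z T =
     fps_const (of_real (- 1 / (real CARD('m) + 2))) *
     (2 * formal_form \<omega> X Y * ricci D Z T
      + formal_form \<omega> X Z * ricci D Y T + formal_form \<omega> X T * ricci D Y Z
      - formal_form \<omega> Y Z * ricci D X T - formal_form \<omega> Y T * ricci D X Z)"

definition weyl_part ::
    "('m::finite vfield \<Rightarrow> 'm vfield \<Rightarrow> 'm cinf) \<Rightarrow>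
     (nat \<Rightarrow> 'm vfield \<Rightarrow> 'm vfield \<Rightarrow> 'm vfield) \<Rightarrow>
     'm formal_vfield \<Rightarrow> 'm formal_vfield \<Rightarrow> 'm formal_vfield \<Rightarrow> 'm formal_vfield \<Rightarrow> 'm cinf fps" where
  "weyl_part \<omega> D X Y Z T =
     formal_form \<omega> (curvature D X Y Z) T - ricci_part \<omega> D X Y Z T"

definition ricci_type ::
    "('m::finite vfield \<Rightarrow> 'm vfield \<Rightarrow> 'm cinf) \<Rightarrow>
     (nat \<Rightarrow> 'm vfield \<Rightarrow> 'm vfield \<Rightarrow> 'm vfield) \<Rightarrow> bool" where
  "ricci_type \<omega> D \<longleftrightarrow> (\<forall>X Y Z T. weyl_part \<omega> D X Y Z T = 0)"


section \<open>Formal curves of symplectomorphisms\<close>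

text \<open>Sign convention: \<open>\<omega> (X\<^sub>f, \<cdot>) = df\<close> and \<open>{f, g} = X\<^sub>f g\<close>. The opposite convention
  has the same Poisson homomorphisms.\<close>

definition hamiltonian_field ::
    "('m::finite vfield \<Rightarrow> 'm vfield \<Rightarrow> 'm cinf) \<Rightarrow> 'm cinf \<Rightarrow> 'm vfield" where
  "hamiltonian_field \<omega> f = (THE X. \<forall>Y. \<omega> X Y = lie_deriv Y f)"

definition poisson ::
    "('m::finite vfield \<Rightarrow> 'm vfield \<Rightarrow> 'm cinf) \<Rightarrow> 'm cinf \<Rightarrow> 'm cinf \<Rightarrow> 'm cinf" where
  "poisson \<omega> f g = lie_deriv (hamiltonian_field \<omega> f) g"

definition formal_poisson ::
    "('m::finite vfield \<Rightarrow> 'm vfield \<Rightarrow> 'm cinf) \<Rightarrow> 'm cinf fps \<Rightarrow> 'm cinf fps \<Rightarrow> 'm cinf fps" where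
  "formal_poisson \<omega> F G =
     Abs_fps (\<lambda>m. \<Sum>i\<le>m. poisson \<omega> (fps_nth F i) (fps_nth G (m - i)))"

text \<open>The last condition says that \<open>\<psi>\<^sup>(\<^sup>0\<^sup>)\<close> is an isomorphism: it is a homomorphism of Poisson
  algebras because \<open>\<psi>\<close> is one.\<close>

definition formal_symplectomorphism ::
    "('m::finite vfield \<Rightarrow> 'm vfield \<Rightarrow> 'm cinf) \<Rightarrow> ('m cinf \<Rightarrow> 'm cinf fps) \<Rightarrow> bool" where
  "formal_symplectomorphism \<omega> \<psi> \<longleftrightarrow>
     (\<forall>f g. \<psi> (f + g) = \<psi> f + \<psi> g) \<and>
     (\<forall>c f. \<psi> (c *\<^sub>R f) = fps_const (of_real c) * \<psi> f) \<and>
     (\<forall>f g. \<psi> (f * g) = \<psi> f * \<psi> g) \<and>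
     (\<forall>f g. \<psi> (poisson \<omega> f g) = formal_poisson \<omega> (\<psi> f) (\<psi> g)) \<and>
     bij (\<lambda>f. fps_nth (\<psi> f) 0)"

definition formal_ext :: "('m::finite cinf \<Rightarrow> 'm cinf fps) \<Rightarrow> 'm cinf fps \<Rightarrow> 'm cinf fps" where
  "formal_ext \<psi> F = Abs_fps (\<lambda>m. \<Sum>i\<le>m. fps_nth (\<psi> (fps_nth F (m - i))) i)"

definition push_vfield ::
    "('m::finite cinf fps \<Rightarrow> 'm cinf fps) \<Rightarrow> 'm formal_vfield \<Rightarrow> 'm formal_vfield" where
  "push_vfield \<Psi> X = (THE Y. \<forall>F. formal_lie_deriv Y F = \<Psi> (formal_lie_deriv X (inv \<Psi> F)))"

definition push_connection ::
    "('m::finite cinf fps \<Rightarrow> 'm cinf fps) \<Rightarrow>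
     ('m formal_vfield \<Rightarrow> 'm formal_vfield \<Rightarrow> 'm formal_vfield) \<Rightarrow>
     'm formal_vfield \<Rightarrow> 'm formal_vfield \<Rightarrow> 'm formal_vfield" where
  "push_connection \<Psi> N X Y =
     push_vfield \<Psi> (N (push_vfield (inv \<Psi>) X) (push_vfield (inv \<Psi>) Y))"

end

theory Submission
  imports Defs
begin

text \<open>A formal symplectomorphism is obtained as the flow of a Hamiltonian \<open>H(t)\<close>, whose coefficients
  are chosen one after the other. If the Christoffel symbols of the transformed connection are constant
  below order \<open>t\<^sup>k\<close> and \<open>A\<close> is the coefficient of \<open>t\<^sup>k\<close>, lowered with \<open>\<omega>\<close>, then \<open>W\<^sup>t = 0\<close> gives
  \<open>\<partial>\<^sub>a A\<^sub>b\<^sub>c\<^sub>d - \<partial>\<^sub>b A\<^sub>a\<^sub>c\<^sub>d + const = E(r)\<^sub>a\<^sub>b\<^sub>c\<^sub>d\<close>. Differentiating, summing cyclically and contracting with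
  \<open>\<omega>\<close> shows, because periodic functions with constant derivatives are constant, that \<open>r\<close> is constant.
  Hence \<open>A = const + \<partial>\<^sup>3 h\<close> on the torus, and the coefficient of \<open>t\<^sup>k\<^sup>-\<^sup>1\<close> in \<open>H\<close> can be chosen
  to cancel \<open>\<partial>\<^sup>3 h\<close>. Flatness is not needed for this; it follows at the end from pure algebra over
  the reduced ring of formal functions: the constant symbols form a commutative product \<open>X Y\<close> with
  \<open>\<omega>(X Y, Z)\<close> totally symmetric, the Ricci type condition forces \<open>r(X Y, Z) = 0\<close>, and then
  \<open>r(Y, Y)\<^sup>2 = 0\<close>.\<close>

section \<open>Calculus on the torus\<close>

text \<open>A single Hamiltonian is corrected, instead of composing infinitely many
  symplectomorphisms: replacing \<open>H\<close> by \<open>H + t^m G\<close> leaves the transformed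
  symbols unchanged up to order \<open>t^m\<close> and changes the lowered symbols at order
  \<open>t^(m+1)\<close> by the third derivatives of \<open>G_0 / (m+1)\<close>. Orders already
  settled are never disturbed and the corrections converge t-adically. The symbols vanish at
  \<open>t = 0\<close>, so at order \<open>t^(m+1)\<close> the quadratic part of the curvature only
  involves orders 1 to \<open>m\<close>; this is the constant in the equation for \<open>A\<close>.
  The constants left in \<open>A\<close> are periods: a constant third derivative of a periodic
  function is zero, so no such correction removes them, and the normal form is an invariant
  connection rather than \<nabla>^0. The dimension enters through a contraction with \<omega> that
  leaves a factor \<open>2n - 2\<close>. Smooth functions have zero divisors, so in the algebraic
  part factors are never cancelled: arguments are chosen such that a factor becomes 1, an integer or
  part of a square.\<close>

definition lift :: "'m::finite cinf \<Rightarrow> real ^ 'm \<Rightarrow> real" where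
  "lift f x = cinf_apply f (abs_torus x)"

lemma smooth_lift: "smooth (lift f)"
  using cinf_apply[of f] by (simp add: lift_def[abs_def])

lemma abs_torus_surj: "\<exists>x. p = abs_torus x"
  using Quotient3_abs_rep[OF Quotient3_torus, of p] by metis

lemma lift_periodic:
  assumes "\<And>i. z $ i \<in> \<int>"
  shows "lift f (x + z) = lift f x"
proof -
  have "abs_torus (x + z) = abs_torus x" using assms by (simp add: torus.abs_eq_iff)
  then show ?thesis by (simp add: lift_def)
qed

lemma lift_eqI:
  assumes "\<And>x. lift f x = lift g x"
  shows "f = g"
proof -
  have "cinf_apply f p = cinf_apply g p" for p
    using assms abs_torus_surj[of p] by (auto simp: lift_def)
  then show ?thesis by (simp add: cinf_apply_inject[symmetric] fun_eq_iff)
qed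

lemma lift_exists:
  assumes g: "smooth g" and per: "\<And>x z. (\<And>i. z $ i \<in> \<int>) \<Longrightarrow> g (x + z) = g x"
  shows "\<exists>f. lift f = g"
proof -
  have eq: "g (rep_torus (abs_torus x)) = g x" for x
  proof -
    have "abs_torus (rep_torus (abs_torus x)) = abs_torus x"
      by (rule Quotient3_abs_rep[OF Quotient3_torus])
    then have "\<And>i. (rep_torus (abs_torus x) - x) $ i \<in> \<int>" by (simp add: torus.abs_eq_iff)
    from per[OF this, of x] show ?thesis by simp
  qed
  then have "cinf_apply (Abs_cinf (\<lambda>p. g (rep_torus p))) = (\<lambda>p. g (rep_torus p))"
    using g by (intro Abs_cinf_inverse) simp
  then have "lift (Abs_cinf (\<lambda>p. g (rep_torus p))) = g"
    by (simp add: lift_def fun_eq_iff eq)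
  then show ?thesis by blast
qed

lemma lift_simps [simp]:
  "lift 0 x = 0" "lift 1 x = 1" "lift (f + g) x = lift f x + lift g x"
  "lift (f * g) x = lift f x * lift g x" "lift (f - g) x = lift f x - lift g x"
  "lift (- f) x = - lift f x" "lift (c *\<^sub>R f) x = c * lift f x" "lift (of_real c) x = c"
  by (simp_all add: lift_def zero_cinf.rep_eq one_cinf.rep_eq plus_cinf.rep_eq times_cinf.rep_eq
      minus_cinf.rep_eq uminus_cinf.rep_eq scaleR_cinf.rep_eq of_real_def)

lemma lift_sum [simp]: "lift (sum f A) x = (\<Sum>i\<in>A. lift (f i) x)"
  by (induction A rule: infinite_finite_induct) auto

lemma Reals_iff_lift: "f \<in> \<real> \<longleftrightarrow> (\<exists>c. \<forall>x. lift f x = c)"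
  unfolding Reals_cinf_iff lift_def using abs_torus_surj by metis

lemma lift_pdiff: "lift (pdiff a f) x = frechet_derivative (lift f) (at x) (axis a 1)"
  using frechet_derivative_torus[of "cinf_apply f" x] cinf_apply[of f]
  by (simp add: lift_def[abs_def] pdiff.rep_eq)

lemma lift_has_derivative:
  "(lift f has_derivative (\<lambda>h. \<Sum>a\<in>UNIV. h $ a * lift (pdiff a f) x)) (at x)"
proof -
  let ?D = "frechet_derivative (lift f) (at x)"
  have D: "(lift f has_derivative ?D) (at x)"
    using smooth_differentiable[OF smooth_lift] frechet_derivative_works by blast
  then have "linear ?D" by (rule has_derivative_linear)
  then have "?D h = (\<Sum>a\<in>UNIV. h $ a * lift (pdiff a f) x)" for h
  proof -
    have "?D h = ?D (\<Sum>a\<in>UNIV. h $ a *s axis a 1)" by (simp add: basis_expansion)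
    also have "\<dots> = (\<Sum>a\<in>UNIV. h $ a * ?D (axis a 1))"
      using \<open>linear ?D\<close> by (simp add: linear_sum linear_cmul scalar_mult_eq_scaleR)
    finally show ?thesis by (simp add: lift_pdiff)
  qed
  with D show ?thesis by (metis (no_types, lifting) ext)
qed

lemma sum_axis_mult [simp]:
  fixes f :: "'m::finite \<Rightarrow> 'a::semiring_0"
  shows "(\<Sum>a\<in>UNIV. axis b c $ a * f a) = c * f b"
proof -
  have "(\<Sum>a\<in>UNIV. axis b c $ a * f a) = (\<Sum>a\<in>UNIV. if a = b then c * f a else 0)"
    by (rule sum.cong) (auto simp: axis_def)
  then show ?thesis by simp
qed

lemma lift_pdiff_unique:
  assumes "(lift f has_derivative F) (at x)"
  shows "lift (pdiff a f) x = F (axis a 1)"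
  unfolding lift_pdiff using frechet_derivative_at[OF assms] by simp

lemma pdiff_add [simp]: "pdiff a (f + g) = pdiff a f + pdiff a g"
proof (rule lift_eqI)
  fix x
  have "(lift (f + g) has_derivative (\<lambda>h. (\<Sum>a\<in>UNIV. h $ a * lift (pdiff a f) x) + (\<Sum>a\<in>UNIV. h $ a * lift (pdiff a g) x))) (at x)"
    using has_derivative_add[OF lift_has_derivative lift_has_derivative] by (simp add: lift_simps[abs_def])
  from lift_pdiff_unique[OF this] show "lift (pdiff a (f + g)) x = lift (pdiff a f + pdiff a g) x"
    by simp
qed

lemma pdiff_mult [simp]: "pdiff a (f * g) = pdiff a f * g + f * pdiff a g"
proof (rule lift_eqI)
  fix x
  have "(lift (f * g) has_derivative (\<lambda>h. lift f x * (\<Sum>a\<in>UNIV. h $ a * lift (pdiff a g) x) + (\<Sum>a\<in>UNIV. h $ a * lift (pdiff a f) x) * lift g x)) (at x)"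
    using has_derivative_mult[OF lift_has_derivative lift_has_derivative] by (simp add: lift_simps[abs_def])
  from lift_pdiff_unique[OF this] show "lift (pdiff a (f * g)) x = lift (pdiff a f * g + f * pdiff a g) x"
    by simp
qed

lemma pdiff_of_real [simp]:
  fixes a :: "'m::finite"
  shows "pdiff a (of_real c) = 0"
proof (rule lift_eqI)
  fix x :: "real ^ 'm"
  have "(lift (of_real c) has_derivative (\<lambda>h. 0)) (at x)"
    by (simp add: lift_simps[abs_def])
  from lift_pdiff_unique[OF this] show "lift (pdiff a (of_real c)) x = lift 0 x" by simp
qed

lemma pdiff_zero [simp]: "pdiff a 0 = 0" and pdiff_one [simp]: "pdiff a 1 = 0"
  using pdiff_of_real[of a 0] pdiff_of_real[of a 1] by auto

lemma pdiff_of_nat [simp]: "pdiff a (of_nat k) = 0"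
  using pdiff_of_real[of a "real k"] by simp

lemma pdiff_numeral [simp]: "pdiff a (numeral k) = 0"
  using pdiff_of_nat[of a "numeral k"] by simp

lemma pdiff_scaleR [simp]: "pdiff a (c *\<^sub>R f) = c *\<^sub>R pdiff a f"
  using pdiff_mult[of a "of_real c" f] by (simp add: scaleR_conv_of_real)

lemma pdiff_minus [simp]: "pdiff a (- f) = - pdiff a f"
  using pdiff_scaleR[of a "-1" f] by simp

lemma pdiff_diff [simp]: "pdiff a (f - g) = pdiff a f - pdiff a g"
  using pdiff_add[of a f "- g"] by simp

lemma pdiff_sum [simp]: "pdiff a (sum f A) = (\<Sum>i\<in>A. pdiff a (f i))"
  by (induction A rule: infinite_finite_induct) auto

section \<open>Mean values along coordinate lines and mixed derivatives\<close>

lemma lift_has_derivative_line: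
  "((\<lambda>t. lift f (x + t *\<^sub>R axis a 1)) has_real_derivative lift (pdiff a f) (x + t *\<^sub>R axis a 1)) (at t)"
proof -
  have 1: "((\<lambda>t. x + t *\<^sub>R axis a 1) has_derivative (\<lambda>h. h *\<^sub>R axis a 1)) (at t)"
    by (auto intro!: derivative_eq_intros)
  have "((\<lambda>t. lift f (x + t *\<^sub>R axis a 1)) has_derivative
      (\<lambda>h. \<Sum>b\<in>UNIV. (h *\<^sub>R axis a 1) $ b * lift (pdiff b f) (x + t *\<^sub>R axis a 1))) (at t)"
    using diff_chain_at[OF 1 lift_has_derivative] by (simp add: o_def)
  moreover have "(\<Sum>b\<in>UNIV. (h *\<^sub>R axis a 1) $ b * lift (pdiff b f) y) = lift (pdiff a f) y * h" for h y
    by (simp add: mult.assoc flip: sum_distrib_left)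
  ultimately show ?thesis by (simp add: has_field_derivative_def)
qed

lemma lift_mvt:
  assumes "h > 0"
  shows "\<exists>s. 0 < s \<and> s < h \<and>
    lift f (x + h *\<^sub>R axis a 1) - lift f x = h * lift (pdiff a f) (x + s *\<^sub>R axis a 1)"
  using MVT2[OF assms lift_has_derivative_line[of f x a]] by force

text \<open>By the mean value theorem over one period, the derivative along a circle vanishes
  somewhere.\<close>

lemma pdiff_in_Reals_zero:
  assumes "pdiff a f \<in> \<real>"
  shows "pdiff a f = 0"
proof -
  obtain c where c: "\<And>x. lift (pdiff a f) x = c" using assms Reals_iff_lift by blast
  obtain s where "lift f (0 + 1 *\<^sub>R axis a 1) - lift f 0 = 1 * lift (pdiff a f) (0 + s *\<^sub>R axis a 1)"
    using lift_mvt[of 1 f 0 a] by auto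
  moreover have "lift f (0 + 1 *\<^sub>R axis a 1) = lift f 0"
    unfolding scaleR_one by (rule lift_periodic) (simp add: axis_def)
  ultimately have "c = 0" using c by simp
  then show ?thesis using c by (intro lift_eqI) simp
qed

lemma pdiff_all_zero_Reals:
  assumes "\<And>a. pdiff a f = 0"
  shows "f \<in> \<real>"
proof -
  have "(lift f has_derivative (\<lambda>h. 0)) (at x)" for x
    using lift_has_derivative[of f x] assms by simp
  then have "\<exists>c. \<forall>x\<in>UNIV. lift f x = c"
    using has_derivative_zero_constant[of UNIV "lift f"] by auto
  then show ?thesis unfolding Reals_iff_lift by auto
qed

lemma isCont_lift: "isCont (lift f) x"
  using lift_has_derivative by (rule has_derivative_continuous)

text \<open>The mean value theorem is applied to a difference of \<open>f\<close> and then to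
  \<open>pdiff a f\<close>. The second difference is symmetric in \<open>a\<close> and
  \<open>b\<close>, so small \<open>h\<close> will give the symmetry of second derivatives.\<close>

lemma lift_second_difference:
  assumes "h > 0"
  shows "\<exists>y. norm (y - x) \<le> 2 * h \<and>
    lift f (x + h *\<^sub>R axis a 1 + h *\<^sub>R axis b 1) - lift f (x + h *\<^sub>R axis a 1) - lift f (x + h *\<^sub>R axis b 1) + lift f x
    = h\<^sup>2 * lift (pdiff b (pdiff a f)) y"
proof -
  define u v :: "real ^ 'a" where "u = axis a 1" and "v = axis b 1"
  have "((\<lambda>t. lift f (x + h *\<^sub>R v + t *\<^sub>R u) - lift f (x + t *\<^sub>R u)) has_real_derivative
      lift (pdiff a f) (x + h *\<^sub>R v + t *\<^sub>R u) - lift (pdiff a f) (x + t *\<^sub>R u)) (at t)" for t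
    unfolding u_def by (intro DERIV_diff lift_has_derivative_line)
  from MVT2[OF assms this] obtain s where s: "0 < s" "s < h" and
    1: "lift f (x + h *\<^sub>R v + h *\<^sub>R u) - lift f (x + h *\<^sub>R u) - (lift f (x + h *\<^sub>R v) - lift f x) =
      h * (lift (pdiff a f) (x + h *\<^sub>R v + s *\<^sub>R u) - lift (pdiff a f) (x + s *\<^sub>R u))"
    by force
  obtain r where r: "0 < r" "r < h" and
    2: "lift (pdiff a f) (x + s *\<^sub>R u + h *\<^sub>R v) - lift (pdiff a f) (x + s *\<^sub>R u)
      = h * lift (pdiff b (pdiff a f)) (x + s *\<^sub>R u + r *\<^sub>R v)"
    using lift_mvt[OF assms, of "pdiff a f" "x + s *\<^sub>R u" b] unfolding v_def by blast
  have "norm (s *\<^sub>R u + r *\<^sub>R v) \<le> norm (s *\<^sub>R u) + norm (r *\<^sub>R v)" by (rule norm_triangle_ineq)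
  also have "\<dots> \<le> 2 * h" using s r by (simp add: u_def v_def)
  finally have "norm (x + s *\<^sub>R u + r *\<^sub>R v - x) \<le> 2 * h" by (simp add: algebra_simps)
  moreover have "lift f (x + h *\<^sub>R u + h *\<^sub>R v) - lift f (x + h *\<^sub>R u) - lift f (x + h *\<^sub>R v) + lift f x
    = h\<^sup>2 * lift (pdiff b (pdiff a f)) (x + s *\<^sub>R u + r *\<^sub>R v)"
    using 1 2 by (simp add: add_ac power2_eq_square algebra_simps)
  ultimately show ?thesis unfolding u_def v_def by blast
qed

lemma pdiff_commute: "pdiff a (pdiff b f) = pdiff b (pdiff a f)"
proof (rule lift_eqI, rule ccontr)
  fix x
  define P Q where "P = lift (pdiff a (pdiff b f))" and "Q = lift (pdiff b (pdiff a f))"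
  assume "lift (pdiff a (pdiff b f)) x \<noteq> lift (pdiff b (pdiff a f)) x"
  then have e: "\<bar>P x - Q x\<bar> / 2 > 0" (is "?e > 0") by (simp add: P_def Q_def)
  have "isCont P x" "isCont Q x" unfolding P_def Q_def by (rule isCont_lift)+
  then obtain d1 d2 where d: "d1 > 0" "d2 > 0"
    and d1: "\<And>y. norm (y - x) < d1 \<Longrightarrow> \<bar>P y - P x\<bar> < ?e"
    and d2: "\<And>y. norm (y - x) < d2 \<Longrightarrow> \<bar>Q y - Q x\<bar> < ?e"
    using e unfolding continuous_at_eps_delta dist_norm real_norm_def by metis
  \<comment> \<open>Dividing by 4 keeps \<open>2 * h\<close> strictly below \<open>d1\<close> and
    \<open>d2\<close>.\<close>
  define h where "h = min d1 d2 / 4"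
  have h: "h > 0" using d by (simp add: h_def)
  obtain y where y: "norm (y - x) \<le> 2 * h" and
    1: "lift f (x + h *\<^sub>R axis a 1 + h *\<^sub>R axis b 1) - lift f (x + h *\<^sub>R axis a 1) - lift f (x + h *\<^sub>R axis b 1) + lift f x = h\<^sup>2 * Q y"
    using lift_second_difference[OF h, of x f a b] unfolding Q_def by blast
  obtain z where z: "norm (z - x) \<le> 2 * h" and
    2: "lift f (x + h *\<^sub>R axis b 1 + h *\<^sub>R axis a 1) - lift f (x + h *\<^sub>R axis b 1) - lift f (x + h *\<^sub>R axis a 1) + lift f x = h\<^sup>2 * P z"
    using lift_second_difference[OF h, of x f b a] unfolding P_def by blast
  have "h\<^sup>2 * Q y = h\<^sup>2 * P z" unfolding 1[symmetric] 2[symmetric] by (simp add: add_ac)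
  then have "Q y = P z" using h by simp
  moreover have "\<bar>Q y - Q x\<bar> < ?e" using y d by (intro d2) (auto simp: h_def)
  moreover have "\<bar>P z - P x\<bar> < ?e" using z d by (intro d1) (auto simp: h_def)
  ultimately show False by (simp add: abs_if field_simps split: if_splits)
qed

section \<open>Primitives of closed one-forms\<close>

lemma smooth_sum: "(\<And>i. i \<in> A \<Longrightarrow> smooth (f i)) \<Longrightarrow> smooth (\<lambda>x. \<Sum>i\<in>A. f i x)"
  by (induction A rule: infinite_finite_induct) (auto intro: smooth_const smooth_add)

text \<open>Primitives are only known through their derivative. As \<open>C_k\<close> recurses on
  directional derivatives, smoothness of these is enough.\<close>

lemma smooth_if_smooth_derivative:
  assumes D: "\<And>x. (g has_derivative G x) (at x)" and G: "\<And>v. smooth (\<lambda>x. G x v)"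
  shows "smooth g"
proof -
  have fd: "frechet_derivative g (at x) = G x" for x
    using frechet_derivative_at[OF D] by simp
  have "C_k k g" for k
  proof (cases k)
    case 0
    then show ?thesis
      using D by (auto intro!: continuous_at_imp_continuous_on has_derivative_continuous)
  next
    case (Suc j)
    then show ?thesis using D G by (auto simp: fd smooth_def differentiable_def)
  qed
  then show ?thesis by (simp add: smooth_def)
qed

text \<open>Radial integration: \<open>g x = \<integral>\<^sub>0\<^sup>1 \<Sum>a. x\<^sub>a \<alpha>\<^sub>a (t x) dt\<close>.\<close>

lemma poincare_lemma:
  fixes \<alpha> :: "'m::finite \<Rightarrow> real ^ 'm \<Rightarrow> real" and d\<alpha> :: "'m \<Rightarrow> 'm \<Rightarrow> real ^ 'm \<Rightarrow> real"
  assumes D: "\<And>a x. (\<alpha> a has_derivative (\<lambda>h. \<Sum>b\<in>UNIV. h $ b * d\<alpha> b a x)) (at x)"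
    and cont: "\<And>a b. continuous_on UNIV (d\<alpha> b a)"
    and closed: "\<And>a b x. d\<alpha> b a x = d\<alpha> a b x"
  shows "\<exists>g. \<forall>x. (g has_derivative (\<lambda>h. \<Sum>a\<in>UNIV. h $ a * \<alpha> a x)) (at x)"
proof -
  define f where "f x t = (\<Sum>a\<in>UNIV. x $ a * \<alpha> a (t *\<^sub>R x))" for x :: "real ^ 'm" and t :: real
  \<comment> \<open>The gradient of \<open>f x t\<close> in \<open>x\<close>, after
    \<open>closed\<close> has exchanged the two indices of \<open>d\<alpha>\<close>.\<close>
  define v :: "real ^ 'm \<Rightarrow> real \<Rightarrow> real ^ 'm" where
    "v x t = (\<chi> b. \<alpha> b (t *\<^sub>R x) + t * (\<Sum>a\<in>UNIV. x $ a * d\<alpha> a b (t *\<^sub>R x)))" for x t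
  define g where "g x = integral (cbox 0 1) (f x)" for x
  have conta: "continuous_on UNIV (\<alpha> a)" for a
    using D by (auto intro!: continuous_at_imp_continuous_on has_derivative_continuous)
  have D2: "((\<lambda>x. \<alpha> a (t *\<^sub>R x)) has_derivative (\<lambda>h. \<Sum>b\<in>UNIV. (t *\<^sub>R h) $ b * d\<alpha> b a (t *\<^sub>R x))) (at x)" for a t x
  proof -
    have "((\<lambda>x. t *\<^sub>R x) has_derivative (\<lambda>h. t *\<^sub>R h)) (at x)"
      by (auto intro!: derivative_eq_intros)
    from diff_chain_at[OF this D[of a "t *\<^sub>R x"]] show ?thesis by (simp add: o_def)
  qed
  have df: "((\<lambda>x. f x t) has_derivative blinfun_apply (blinfun_inner_left (v x t))) (at x within UNIV)" for x t
  proof -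
    have "((\<lambda>x. f x t) has_derivative (\<lambda>h. \<Sum>a\<in>UNIV.
        x $ a * (\<Sum>b\<in>UNIV. (t *\<^sub>R h) $ b * d\<alpha> b a (t *\<^sub>R x)) + h $ a * \<alpha> a (t *\<^sub>R x))) (at x)"
      unfolding f_def
      by (intro has_derivative_sum has_derivative_mult D2 bounded_linear_imp_has_derivative bounded_linear_vec_nth)
    moreover have "(\<Sum>a\<in>UNIV. x $ a * (\<Sum>b\<in>UNIV. (t *\<^sub>R h) $ b * d\<alpha> b a (t *\<^sub>R x)) + h $ a * \<alpha> a (t *\<^sub>R x))
        = blinfun_apply (blinfun_inner_left (v x t)) h" for h
    proof -
      have "(\<Sum>a\<in>UNIV. x $ a * (\<Sum>b\<in>UNIV. (t *\<^sub>R h) $ b * d\<alpha> b a (t *\<^sub>R x)))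
          = (\<Sum>a\<in>UNIV. \<Sum>b\<in>UNIV. h $ b * (t * (x $ a * d\<alpha> a b (t *\<^sub>R x))))"
        by (simp add: sum_distrib_left closed mult_ac)
      also have "\<dots> = (\<Sum>b\<in>UNIV. h $ b * (t * (\<Sum>a\<in>UNIV. x $ a * d\<alpha> a b (t *\<^sub>R x))))"
        by (subst sum.swap) (simp add: sum_distrib_left)
      finally show ?thesis
        by (simp add: sum.distrib v_def inner_vec_def algebra_simps)
    qed
    ultimately show ?thesis by (metis (no_types, lifting) ext)
  qed
  have fi: "f x integrable_on cbox 0 1" for x
    unfolding f_def
    by (intro integrable_continuous continuous_intros continuous_on_compose2[OF conta]) auto
  have cv: "continuous_on (UNIV \<times> cbox 0 1) (\<lambda>(x, t). blinfun_inner_left (v x t))"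
    unfolding v_def split_beta
    by (intro bounded_linear.continuous_on[OF bounded_linear_blinfun_inner_left]
        continuous_intros continuous_on_compose2[OF conta] continuous_on_compose2[OF cont]) auto
  have "(g has_derivative integral (cbox 0 1) (\<lambda>t. blinfun_inner_left (v x t))) (at x)" for x
    unfolding g_def by (rule leibniz_rule[OF df fi cv]) auto
  moreover have "blinfun_apply (integral (cbox 0 1) (\<lambda>t. blinfun_inner_left (v x t))) h
      = (\<Sum>a\<in>UNIV. h $ a * \<alpha> a x)" for x h
  proof -
    have "continuous_on (cbox 0 1) (\<lambda>t. blinfun_inner_left (v x t))"
      using continuous_on_compose2[OF cv, of "cbox 0 1" "Pair x"]
      by (simp add: continuous_on_Pair image_subset_iff)
    then have i: "(\<lambda>t. blinfun_inner_left (v x t)) integrable_on cbox 0 1"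
      by (rule integrable_continuous)
    have "blinfun_apply (integral (cbox 0 1) (\<lambda>t. blinfun_inner_left (v x t))) h
        = integral (cbox 0 1) (\<lambda>t. blinfun_apply (blinfun_inner_left (v x t)) h)"
      using integral_linear[OF i, of "\<lambda>L. blinfun_apply L h"]
      by (simp add: o_def blinfun.bounded_linear_left)
    \<comment> \<open>Paired with \<open>h\<close>, the gradient is the \<open>t\<close>-derivative
      of \<open>\<Sum>a. h $ a * (t * \<alpha> a (t *\<^sub>R x))\<close>; the integral is the
      boundary value at \<open>t = 1\<close>.\<close>
    also have "((\<lambda>t. blinfun_apply (blinfun_inner_left (v x t)) h) has_integral
        (\<Sum>a\<in>UNIV. h $ a * (1 * \<alpha> a (1 *\<^sub>R x))) - (\<Sum>a\<in>UNIV. h $ a * (0 * \<alpha> a (0 *\<^sub>R x)))) {0..1}"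
    proof (rule fundamental_theorem_of_calculus)
      fix t :: real
      have Dt: "((\<lambda>t. \<alpha> a (t *\<^sub>R x)) has_derivative (\<lambda>h. \<Sum>b\<in>UNIV. (h *\<^sub>R x) $ b * d\<alpha> b a (t *\<^sub>R x))) (at t)" for a
      proof -
        have "((\<lambda>t. t *\<^sub>R x) has_derivative (\<lambda>h. h *\<^sub>R x)) (at t)"
          by (auto intro!: derivative_eq_intros)
        from diff_chain_at[OF this D[of a "t *\<^sub>R x"]] show ?thesis by (simp add: o_def)
      qed
      have "((\<lambda>t. \<Sum>a\<in>UNIV. h $ a * (t * \<alpha> a (t *\<^sub>R x))) has_derivative (\<lambda>k. \<Sum>a\<in>UNIV. h $ a *
         (t * (\<Sum>b\<in>UNIV. (k *\<^sub>R x) $ b * d\<alpha> b a (t *\<^sub>R x)) + k * \<alpha> a (t *\<^sub>R x)))) (at t)"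
        by (intro has_derivative_sum has_derivative_mult_right has_derivative_mult Dt has_derivative_ident)
      moreover have "(\<Sum>a\<in>UNIV. h $ a * (t * (\<Sum>b\<in>UNIV. (k *\<^sub>R x) $ b * d\<alpha> b a (t *\<^sub>R x)) + k * \<alpha> a (t *\<^sub>R x)))
         = k *\<^sub>R blinfun_apply (blinfun_inner_left (v x t)) h" for k
        by (simp add: v_def inner_vec_def sum_distrib_left algebra_simps sum.distrib)
      ultimately show "((\<lambda>t. \<Sum>a\<in>UNIV. h $ a * (t * \<alpha> a (t *\<^sub>R x))) has_vector_derivative
          blinfun_apply (blinfun_inner_left (v x t)) h) (at t within {0..1})"
        by (simp add: has_vector_derivative_def has_derivative_at_withinI)
    qed simp
    then have "integral (cbox 0 1) (\<lambda>t. blinfun_apply (blinfun_inner_left (v x t)) h) = (\<Sum>a\<in>UNIV. h $ a * \<alpha> a x)"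
      by (simp add: cbox_interval integral_unique)
    finally show ?thesis .
  qed
  ultimately have "(g has_derivative (\<lambda>h. \<Sum>a\<in>UNIV. h $ a * \<alpha> a x)) (at x)" for x
    by (metis (no_types, lifting) ext)
  then show ?thesis by blast
qed

text \<open>After subtracting a linear form that absorbs the constant exterior derivative \<open>\<kappa>\<close>, the
  one-form has a primitive \<open>g\<close> on \<open>\<real>\<^sup>m\<close>. The differences of \<open>g\<close> along the lattice directions
  are affine; as second differences are symmetric and \<open>\<kappa>\<close> is not, \<open>\<kappa> = 0\<close>, and then they
  are the constants \<open>c\<close>.\<close>

lemma torus_closed_one_form:
  fixes \<alpha> :: "'m::finite \<Rightarrow> 'm cinf"
  assumes "\<And>a b. pdiff a (\<alpha> b) - pdiff b (\<alpha> a) \<in> \<real>"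
  shows "\<exists>c f. \<forall>a. \<alpha> a = of_real (c a) + pdiff a f"
proof -
  have "\<forall>a b. \<exists>c. \<forall>x. lift (pdiff a (\<alpha> b) - pdiff b (\<alpha> a)) x = c"
    using assms Reals_iff_lift by blast
  then obtain \<kappa> where \<kappa>: "\<And>a b x. lift (pdiff a (\<alpha> b)) x - lift (pdiff b (\<alpha> a)) x = \<kappa> a b"
    by (metis lift_simps(5))
  have anti: "\<kappa> b a = - \<kappa> a b" for a b using \<kappa>[of a b 0] \<kappa>[of b a 0] by simp
  \<comment> \<open>Half of \<kappa>: by antisymmetry the linear one-form with coefficients
    \<kappa>/2 has exterior derivative \<kappa>.\<close>
  define \<beta> where "\<beta> b x = lift (\<alpha> b) x - (\<Sum>a\<in>UNIV. x $ a * \<kappa> a b) / 2" for b x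
  define d\<beta> where "d\<beta> a b x = lift (pdiff a (\<alpha> b)) x - \<kappa> a b / 2" for a b x
  have D: "(\<beta> b has_derivative (\<lambda>h. \<Sum>a\<in>UNIV. h $ a * d\<beta> a b x)) (at x)" for b x
  proof -
    have "(\<beta> b has_derivative (\<lambda>h. (\<Sum>a\<in>UNIV. h $ a * lift (pdiff a (\<alpha> b)) x)
        - (\<Sum>a\<in>UNIV. h $ a * \<kappa> a b) / 2)) (at x)"
      unfolding \<beta>_def divide_inverse
      by (intro has_derivative_diff has_derivative_mult_left has_derivative_sum lift_has_derivative
          bounded_linear_imp_has_derivative bounded_linear_vec_nth)
    then show ?thesis
      by (simp add: d\<beta>_def right_diff_distrib sum_subtractf sum_divide_distrib)
  qed
  have "continuous_on UNIV (d\<beta> b a)" for a b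
    unfolding d\<beta>_def[abs_def]
    by (auto intro!: continuous_intros continuous_at_imp_continuous_on isCont_lift)
  moreover have "d\<beta> b a x = d\<beta> a b x" for a b x
    using \<kappa>[of a b x] anti[of a b] by (simp add: d\<beta>_def)
  ultimately obtain g where g: "\<And>x. (g has_derivative (\<lambda>h. \<Sum>a\<in>UNIV. h $ a * \<beta> a x)) (at x)"
    using poincare_lemma[of \<beta> d\<beta>, OF D] by blast
  have shift: "\<exists>k. \<forall>x. g (x + axis c 1) - g x = k - (\<Sum>b\<in>UNIV. x $ b * \<kappa> c b) / 2" for c
  proof -
    define G where "G x = g (x + axis c 1) - g x + (\<Sum>b\<in>UNIV. x $ b * \<kappa> c b) / 2" for x
    have "(G has_derivative (\<lambda>h. 0)) (at x)" for x
    proof -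
      have "((\<lambda>x. x + axis c 1) has_derivative (\<lambda>h. h)) (at x)"
        by (auto intro!: derivative_eq_intros)
      from diff_chain_at[OF this g]
      have "((\<lambda>x. g (x + axis c 1)) has_derivative (\<lambda>h. \<Sum>a\<in>UNIV. h $ a * \<beta> a (x + axis c 1))) (at x)"
        by (simp add: o_def)
      then have "(G has_derivative (\<lambda>h. (\<Sum>a\<in>UNIV. h $ a * \<beta> a (x + axis c 1)) - (\<Sum>a\<in>UNIV. h $ a * \<beta> a x)
          + (\<Sum>b\<in>UNIV. h $ b * \<kappa> c b) / 2)) (at x)"
        unfolding G_def divide_inverse
        by (intro has_derivative_add has_derivative_diff has_derivative_mult_left has_derivative_sum g
          bounded_linear_imp_has_derivative bounded_linear_vec_nth)
      moreover have "\<beta> b (x + axis c 1) = \<beta> b x - \<kappa> c b / 2" for b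
      proof -
        have "lift (\<alpha> b) (x + axis c 1) = lift (\<alpha> b) x" by (rule lift_periodic) (simp add: axis_def)
        then show ?thesis by (simp add: \<beta>_def ring_distribs sum.distrib add_divide_distrib)
      qed
      ultimately show ?thesis
        by (simp add: right_diff_distrib sum_subtractf sum_divide_distrib)
    qed
    then obtain k where "\<And>x. G x = k"
      using has_derivative_zero_constant[of UNIV G] by auto
    then have "g (x + axis c 1) - g x = k - (\<Sum>b\<in>UNIV. x $ b * \<kappa> c b) / 2" for x
      by (simp add: G_def eq_diff_eq)
    then show ?thesis by blast
  qed
  then obtain k where k: "\<And>c x. g (x + axis c 1) - g x = k c - (\<Sum>b\<in>UNIV. x $ b * \<kappa> c b) / 2"
    by metis
  have "\<kappa> c d = 0" for c d
  proof -
    \<comment> \<open>The two ways round the unit square spanned by directions \<open>c\<close> and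
      \<open>d\<close> must give the same increment of \<open>g\<close>.\<close>
    have "g (axis d 1 + axis c 1) - g (axis d 1) = k c - \<kappa> c d / 2"
      "g (axis c 1 + axis d 1) - g (axis c 1) = k d - \<kappa> d c / 2"
      "g (0 + axis c 1) - g 0 = k c" "g (0 + axis d 1) - g 0 = k d"
      unfolding k by simp_all
    then show ?thesis using anti[of c d] by (simp add: add.commute)
  qed
  then have k: "g (x + axis c 1) - g x = k c" and \<beta>: "\<beta> b = lift (\<alpha> b)" for c x b
    using k by (auto simp: \<beta>_def)
  \<comment> \<open>The increments \<open>k a\<close> are the periods of the one-form. Removing the
    linear function with these increments makes the primitive periodic, and they return as the
    constant part of \<alpha>.\<close>
  define F where "F x = g x - (\<Sum>a\<in>UNIV. x $ a * k a)" for x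
  have F: "(F has_derivative (\<lambda>h. \<Sum>a\<in>UNIV. h $ a * lift (\<alpha> a - of_real (k a)) x)) (at x)" for x
  proof -
    have "(F has_derivative (\<lambda>h. (\<Sum>a\<in>UNIV. h $ a * lift (\<alpha> a) x) - (\<Sum>a\<in>UNIV. h $ a * k a))) (at x)"
      unfolding F_def
      by (intro has_derivative_diff has_derivative_mult_left has_derivative_sum g[unfolded \<beta>]
          bounded_linear_imp_has_derivative bounded_linear_vec_nth)
    then show ?thesis by (simp add: right_diff_distrib sum_subtractf)
  qed
  have unit_shift: "F (x + axis a 1) = F x" for x a
    using k[of x a] by (simp add: F_def ring_distribs sum.distrib)
  have nat_shift: "F (x + real n *\<^sub>R axis a 1) = F x" for x a n
  proof (induction n)
    case (Suc n)
    then show ?case using unit_shift[of "x + real n *\<^sub>R axis a 1" a] by (simp add: algebra_simps)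
  qed simp
  have int_shift: "F (x + z *\<^sub>R axis a 1) = F x" if z: "z \<in> \<int>" for x a z
  proof -
    obtain i where i: "z = of_int i" using z by (rule Ints_cases)
    show ?thesis
    proof (cases "i \<ge> 0")
      case True
      then show ?thesis using nat_shift[of x "nat i" a] i by simp
    next
      case False
      then show ?thesis using nat_shift[of "x + z *\<^sub>R axis a 1" "nat (- i)" a] i by simp
    qed
  qed
  have "F (x + z) = F x" if z: "\<And>i. z $ i \<in> \<int>" for x z
  proof -
    have "F (x + (\<Sum>a\<in>A. z $ a *\<^sub>R axis a 1)) = F x" if "finite A" for A
      using that
    proof induction
      case (insert a A)
      have "x + (\<Sum>b\<in>insert a A. z $ b *\<^sub>R axis b 1) = (x + (\<Sum>b\<in>A. z $ b *\<^sub>R axis b 1)) + z $ a *\<^sub>R axis a 1"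
        using insert by (simp add: add_ac)
      then show ?case using insert(3) int_shift[OF z, of _ a] by (simp only:)
    qed simp
    from this[of UNIV] show ?thesis
      by (simp add: basis_expansion flip: scalar_mult_eq_scaleR)
  qed
  moreover have "smooth F"
    by (rule smooth_if_smooth_derivative[OF F])
       (intro smooth_sum smooth_mult smooth_const smooth_lift)
  ultimately obtain f where f: "lift f = F" using lift_exists by blast
  have "\<alpha> a = of_real (k a) + pdiff a f" for a
  proof (rule lift_eqI)
    fix x
    have "lift (pdiff a f) x = lift (\<alpha> a - of_real (k a)) x"
      using lift_pdiff_unique[of f _ x a] F[of x] unfolding f by fastforce
    then show "lift (\<alpha> a) x = lift (of_real (k a) + pdiff a f) x" by simp
  qed
  then show ?thesis by blast
qed

text \<open>The angles are not functions on the torus, but their sines and cosines are; having no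
  common zero, the pair detects the \<open>a\<close>-th component of a vector field
  everywhere.\<close>

lemma angular_functions:
  fixes a :: "'m::finite"
  shows "\<exists>s c :: 'm cinf. s * s + c * c = 1 \<and>
    (\<forall>b. pdiff b s = (if b = a then (2 * pi) *\<^sub>R c else 0)) \<and>
    (\<forall>b. pdiff b c = (if b = a then - ((2 * pi) *\<^sub>R s) else 0))"
proof -
  define S C :: "real ^ 'm \<Rightarrow> real" where "S x = sin (2 * pi * x $ a)" and "C x = cos (2 * pi * x $ a)" for x
  have dS: "(S has_derivative (\<lambda>h. 2 * pi * h $ a * C x)) (at x)"
   and dC: "(C has_derivative (\<lambda>h. - (2 * pi * h $ a * S x))) (at x)" for x
    unfolding S_def C_def
    by (auto intro!: derivative_eq_intros bounded_linear_imp_has_derivative bounded_linear_vec_nth)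
  \<comment> \<open>A joint induction, since each derivative is a multiple of the other
    function.\<close>
  have "C_k k S \<and> C_k k C" for k
  proof (induction k)
    case 0
    show ?case unfolding S_def C_def by (auto intro!: continuous_intros)
  next
    case (Suc k)
    have mult: "C_k k (\<lambda>x. c * f x)" if "C_k k f" for f :: "real ^ 'm \<Rightarrow> real" and c
      using that
    proof (induction k arbitrary: f)
      case (Suc k)
      have f: "f differentiable at x" for x using Suc.prems by auto
      have "frechet_derivative (\<lambda>x. c * f x) (at x) = (\<lambda>v. c * frechet_derivative f (at x) v)" for x
        using frechet_derivative_at[OF has_derivative_mult_right[OF f[unfolded frechet_derivative_works]]]
        by (rule sym)
      then show ?case using Suc f by auto
    qed (auto intro: continuous_intros)
    have "frechet_derivative S (at x) = (\<lambda>h. 2 * pi * h $ a * C x)"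
      "frechet_derivative C (at x) = (\<lambda>h. (- (2 * pi * h $ a)) * S x)" for x
      using frechet_derivative_at[OF dS] frechet_derivative_at[OF dC] by auto
    moreover have "S differentiable at x" "C differentiable at x" for x
      unfolding differentiable_def using dS dC by blast+
    moreover have "C_k k (\<lambda>x. (- (2 * pi * v $ a)) * S x)" for v
      using Suc by (intro mult) simp
    ultimately show ?case using mult Suc by simp
  qed
  then have "smooth S" "smooth C" by (auto simp: smooth_def)
  moreover have "S (x + z) = S x" "C (x + z) = C x" if z: "\<And>i. z $ i \<in> \<int>" for x z
  proof -
    obtain i where i: "z $ a = of_int i" using z[of a] by (rule Ints_cases)
    have "2 * pi * (x + z) $ a = 2 * pi * x $ a + 2 * pi * of_int i" by (simp add: i algebra_simps)
    then show "S (x + z) = S x" "C (x + z) = C x"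
      by (simp_all add: S_def C_def sin_add cos_add)
  qed
  ultimately obtain s c where sc: "lift s = S" "lift c = C" using lift_exists by metis
  have "s * s + c * c = 1"
    by (rule lift_eqI) (simp add: sc S_def C_def add.commute sin_cos_squared_add3)
  moreover have "pdiff b s = (if b = a then (2 * pi) *\<^sub>R c else 0)" for b
    using lift_pdiff_unique[of s, unfolded sc, OF dS, of b] by (intro lift_eqI) (auto simp: sc axis_def)
  moreover have "pdiff b c = (if b = a then - ((2 * pi) *\<^sub>R s) else 0)" for b
    using lift_pdiff_unique[of c, unfolded sc, OF dC, of b] by (intro lift_eqI) (auto simp: sc axis_def)
  ultimately show ?thesis by blast
qed

text \<open>Functions with disjoint supports are zero divisors; being reduced is the substitute for
  cancellation in the algebraic part.\<close>

lemma cinf_square_zero: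
  fixes f :: "'m::finite cinf"
  assumes "f * f = 0"
  shows "f = 0"
proof (rule lift_eqI)
  fix x
  have "lift f x * lift f x = lift (f * f) x" by simp
  then show "lift f x = lift 0 x" using assms by simp
qed

text \<open>One index is integrated at a time with \<open>torus_closed_one_form\<close>; the
  symmetry of \<open>A\<close> makes each successive primitive closed again, up to
  constants.\<close>

lemma torus_symmetric_potential:
  fixes A :: "'m::finite \<Rightarrow> 'm \<Rightarrow> 'm \<Rightarrow> 'm cinf"
  assumes sym: "\<And>a b c. A a b c = A b a c" "\<And>a b c. A a b c = A a c b"
    and closed: "\<And>a b c d. pdiff a (A b c d) - pdiff b (A a c d) \<in> \<real>"
  shows "\<exists>k h. \<forall>a b c. A a b c = of_real (k a b c) + pdiff a (pdiff b (pdiff c h))"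
proof -
  have "\<forall>c d. \<exists>k F. \<forall>b. A b c d = of_real (k b) + pdiff b F"
    by (intro allI torus_closed_one_form closed)
  then obtain k F where F: "\<And>b c d. A b c d = of_real (k c d b) + pdiff b (F c d)"
    unfolding choice_iff by blast
  have "pdiff b (F c d) - pdiff c (F b d) \<in> \<real>" for b c d
  proof -
    have "pdiff b (F c d) - pdiff c (F b d) = of_real (k b d c - k c d b)"
      using F[of b c d] F[of c b d] sym(1)[of b c d] by (simp add: algebra_simps)
    then show ?thesis by simp
  qed
  then have "\<forall>d. \<exists>l G. \<forall>c. F c d = of_real (l c) + pdiff c G"
    by (intro allI torus_closed_one_form)
  then obtain l G where G: "\<And>c d. F c d = of_real (l d c) + pdiff c (G d)"
    unfolding choice_iff by blast
  \<comment> \<open>Its derivatives are differences of the constants \<open>k\<close>, hence zero by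
    periodicity.\<close>
  have "pdiff c (G d) - pdiff d (G c) \<in> \<real>" for c d
  proof (rule pdiff_all_zero_Reals)
    fix b
    have "pdiff b (pdiff c (G d) - pdiff d (G c)) = of_real (k d c b - k c d b)"
      using F[of b c d] F[of b d c] sym(2)[of b c d] by (simp add: G algebra_simps)
    then show "pdiff b (pdiff c (G d) - pdiff d (G c)) = 0"
      by (intro pdiff_in_Reals_zero) (simp only: Reals_of_real)
  qed
  then obtain m h where h: "\<And>d. G d = of_real (m d) + pdiff d h"
    using torus_closed_one_form by metis
  show ?thesis
    by (rule exI[of _ "\<lambda>a b c. k b c a"], rule exI[of _ h]) (simp add: F G h)
qed

section \<open>Formal functions and vector fields\<close>

lemma cinf_of_nat_mult_eq_0:
  fixes f :: "'m::finite cinf"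
  assumes "k > 0" "of_nat k * f = 0"
  shows "f = 0"
proof (rule lift_eqI)
  fix x
  have "real k * lift f x = lift (of_nat k * f) x" using lift_simps(8)[of "real k" x] by simp
  then show "lift f x = lift 0 x" using assms by simp
qed

lemma fps_of_nat_mult_eq_0:
  fixes F :: "'m::finite cinf fps"
  assumes "k > 0" "of_nat k * F = 0"
  shows "F = 0"
proof (rule fps_ext)
  fix n
  have "of_nat k * fps_nth F n = fps_nth (of_nat k * F) n" by (simp add: fps_of_nat[symmetric])
  then show "fps_nth F n = fps_nth 0 n" using assms cinf_of_nat_mult_eq_0 by auto
qed

text \<open>The lowest coefficient of a square is the square of the lowest coefficient.\<close>

lemma fps_square_zero:
  fixes F :: "'m::finite cinf fps"
  assumes "F * F = 0"
  shows "F = 0"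
proof (rule ccontr)
  assume "F \<noteq> 0"
  define n where "n = subdegree F"
  have "fps_nth (F * F) (n + n) = fps_nth F n * fps_nth F n"
    unfolding n_def by (rule nth_subdegree_mult)
  then have "fps_nth F n = 0" using assms cinf_square_zero by auto
  then show False using \<open>F \<noteq> 0\<close> by (simp add: n_def)
qed

definition fdiff :: "'m::finite \<Rightarrow> 'm cinf fps \<Rightarrow> 'm cinf fps" where
  "fdiff a F = Abs_fps (\<lambda>k. pdiff a (fps_nth F k))"

lemma fdiff_nth [simp]: "fps_nth (fdiff a F) k = pdiff a (fps_nth F k)"
  by (simp add: fdiff_def)

lemma fdiff_add [simp]: "fdiff a (F + G) = fdiff a F + fdiff a G"
  and fdiff_diff [simp]: "fdiff a (F - G) = fdiff a F - fdiff a G"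
  and fdiff_minus [simp]: "fdiff a (- F) = - fdiff a F"
  and fdiff_zero [simp]: "fdiff a 0 = 0"
  and fdiff_commute: "fdiff a (fdiff b F) = fdiff b (fdiff a F)"
  and fdiff_const [simp]: "fdiff a (fps_const f) = fps_const (pdiff a f)"
  by (auto simp: fps_eq_iff pdiff_commute)

lemma fdiff_one [simp]: "fdiff a 1 = 0"
  by (auto simp: fps_eq_iff fps_one_nth)

lemma fdiff_mult [simp]: "fdiff a (F * G) = fdiff a F * G + F * fdiff a G"
  by (auto simp: fps_eq_iff fps_mult_nth sum.distrib)

lemma fdiff_X [simp]: "fdiff a fps_X = 0"
  by (auto simp: fps_eq_iff fps_X_def)

lemma fdiff_sum [simp]: "fdiff a (sum F A) = (\<Sum>i\<in>A. fdiff a (F i))"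
  by (induction A rule: infinite_finite_induct) auto

lemma fps_deriv_fdiff: "fps_deriv (fdiff a F) = fdiff a (fps_deriv F)"
  by (auto simp: fps_eq_iff)

abbreviation der :: "'m::finite formal_vfield \<Rightarrow> 'm cinf fps \<Rightarrow> 'm cinf fps" where
  "der \<equiv> formal_lie_deriv"

abbreviation br :: "'m::finite formal_vfield \<Rightarrow> 'm formal_vfield \<Rightarrow> 'm formal_vfield" where
  "br \<equiv> formal_lie_bracket"

abbreviation frame :: "'m::finite \<Rightarrow> 'm formal_vfield" where
  "frame a \<equiv> axis a 1"

lemma der_def: "der X F = (\<Sum>a\<in>UNIV. X $ a * fdiff a F)"
  by (simp add: formal_lie_deriv_def fdiff_def)

lemma der_simps [simp]:
  "der X (F + G) = der X F + der X G" "der X (F - G) = der X F - der X G"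
  "der X (- F) = - der X F" "der X 0 = 0" "der X 1 = 0" "der X (fps_const (of_real c)) = 0"
  "der X (F * G) = der X F * G + F * der X G" "der X fps_X = 0"
  "der (X + Y) F = der X F + der Y F" "der (X - Y) F = der X F - der Y F"
  "der (- X) F = - der X F" "der 0 F = 0" "der (G *s X) F = G * der X F"
  "der (frame a) F = fdiff a F"
  by (simp_all add: der_def algebra_simps sum.distrib sum_subtractf sum_negf
      sum_distrib_left sum_distrib_right) (simp add: mult.commute[of "fdiff _ _"])

lemma der_sum [simp]: "der X (sum F A) = (\<Sum>i\<in>A. der X (F i))"
  by (induction A rule: infinite_finite_induct) auto

lemma der_X_power [simp]: "der X (fps_X ^ n) = 0"
  by (induction n) auto

lemma der_nth: "fps_nth (der X F) n = (\<Sum>a\<in>UNIV. \<Sum>i\<le>n. fps_nth (X $ a) i * pdiff a (fps_nth F (n - i)))"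
  by (simp add: der_def fps_sum_nth fps_mult_nth atLeast0AtMost)

definition flat_conn :: "'m::finite formal_vfield \<Rightarrow> 'm formal_vfield \<Rightarrow> 'm formal_vfield" where
  "flat_conn X Y = (\<chi> c. der X (Y $ c))"

lemma flat_conn_simps [simp]:
  "flat_conn (X + X') Y = flat_conn X Y + flat_conn X' Y"
  "flat_conn (F *s X) Y = F *s flat_conn X Y"
  "flat_conn X (Y + Y') = flat_conn X Y + flat_conn X Y'"
  "flat_conn X (F *s Y) = der X F *s Y + F *s flat_conn X Y"
  "flat_conn X (frame a) = 0"
  by (auto simp: flat_conn_def vec_eq_iff axis_def)

lemma br_flat_conn: "br X Y = flat_conn X Y - flat_conn Y X"
  by (simp add: formal_lie_bracket_def flat_conn_def vec_eq_iff)

text \<open>The second-order parts of the two compositions agree because the \<open>fdiff\<close>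
  commute.\<close>

lemma der_br: "der (br X Y) F = der X (der Y F) - der Y (der X F)"
proof -
  have 1: "der X (der Y F) = der (flat_conn X Y) F + (\<Sum>a\<in>UNIV. \<Sum>b\<in>UNIV. X $ b * Y $ a * fdiff b (fdiff a F))" for X Y
  proof -
    have "der X (der Y F) = (\<Sum>a\<in>UNIV. der X (Y $ a) * fdiff a F + Y $ a * der X (fdiff a F))"
      by (simp add: der_def[of Y])
    moreover have "der (flat_conn X Y) F = (\<Sum>a\<in>UNIV. der X (Y $ a) * fdiff a F)"
      by (simp add: der_def[of "flat_conn X Y"]) (simp add: flat_conn_def)
    ultimately show ?thesis
      by (simp add: sum.distrib der_def[of X "fdiff a F" for a] sum_distrib_left mult_ac)
  qed
  have 2: "(\<Sum>a\<in>UNIV. \<Sum>b\<in>UNIV. Y $ b * X $ a * fdiff b (fdiff a F))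
      = (\<Sum>a\<in>UNIV. \<Sum>b\<in>UNIV. X $ b * Y $ a * fdiff b (fdiff a F))"
    by (subst sum.swap) (simp add: fdiff_commute mult_ac)
  show ?thesis unfolding 1 br_flat_conn using 2 by simp
qed

text \<open>If a field \<open>Z\<close> kills the sine and the cosine of the \<open>a\<close>-th
  angle, then \<open>Z $ a\<close> times either of them is zero, and
  \<open>s * s + c * c = 1\<close> gives \<open>Z $ a = 0\<close>. This makes the definite
  description in \<open>push_vfield\<close> unique.\<close>

lemma vfield_eqI:
  assumes "\<And>F. der X F = der Y F"
  shows "X = Y"
proof -
  have "X $ a = Y $ a" for a
  proof -
    obtain s c where sc: "s * s + c * c = 1"
      and s: "\<And>b. pdiff b s = (if b = a then (2 * pi) *\<^sub>R c else 0)"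
      and c: "\<And>b. pdiff b c = (if b = a then - ((2 * pi) *\<^sub>R s) else 0)"
      using angular_functions[of a] by blast
    define Z where "Z = X - Y"
    define k k' where "k = fps_const (of_real (2 * pi) :: 'a cinf)"
      and "k' = fps_const (of_real (1 / (2 * pi)) :: 'a cinf)"
    define S C where "S = fps_const s" and "C = fps_const c"
    have kk: "k * k' = 1" by (simp add: k_def k'_def flip: of_real_mult)
    have SC: "S * S + C * C = 1" by (simp add: S_def C_def sc)
    have Z: "der Z F = 0" for F using assms by (simp add: Z_def)
    have "fdiff b S = (if b = a then k * C else 0)" for b
      by (simp add: S_def C_def k_def s scaleR_conv_of_real)
    then have "Z $ a * (k * C) = 0"
      using Z[of S] by (simp add: der_def if_distrib[of "(*) _"] cong: if_cong)
    moreover have "fdiff b C = (if b = a then - (k * S) else 0)" for b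
      by (simp add: S_def C_def k_def c scaleR_conv_of_real)
    then have "Z $ a * (k * S) = 0"
      using Z[of C] by (simp add: der_def if_distrib[of "(*) _"] cong: if_cong)
    moreover have "Z $ a = Z $ a * (k * k') * (S * S + C * C)" by (simp add: kk SC)
    then have "Z $ a = Z $ a * (k * S) * (k' * S) + Z $ a * (k * C) * (k' * C)"
      by (simp add: algebra_simps)
    ultimately have "Z $ a = 0" by simp
    then show ?thesis by (simp add: Z_def)
  qed
  then show ?thesis by (simp add: vec_eq_iff)
qed

lemma br_simps [simp]:
  "br X (Y + Z) = br X Y + br X Z" "br (X + Y) Z = br X Z + br Y Z"
  "br X (F *s Y) = der X F *s Y + F *s br X Y"
  "br (F *s X) Y = F *s br X Y - der Y F *s X"
  "br (frame a) (frame b) = 0" "br X 0 = 0" "br 0 X = 0" "br (- X) Y = - br X Y"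
  by (simp_all add: br_flat_conn vec_eq_iff flat_conn_def axis_def)

lemma br_skew: "br X Y = - br Y X"
  by (simp add: br_flat_conn)

definition vderiv :: "'m::finite formal_vfield \<Rightarrow> 'm formal_vfield" where
  "vderiv V = (\<chi> a. fps_deriv (V $ a))"

lemma fps_deriv_der: "fps_deriv (der V F) = der (vderiv V) F + der V (fps_deriv F)"
  by (simp add: der_def vderiv_def fps_deriv_sum fps_deriv_fdiff sum.distrib[symmetric] algebra_simps)

lemma vderiv_simps [simp]:
  "vderiv (V + W) = vderiv V + vderiv W" "vderiv (V - W) = vderiv V - vderiv W"
  "vderiv (F *s V) = fps_deriv F *s V + F *s vderiv V"
  by (simp_all add: vderiv_def vec_eq_iff algebra_simps)

lemma vcoeff_simps [simp]:
  "vcoeff (X + Y) k = vcoeff X k + vcoeff Y k" "vcoeff (X - Y) k = vcoeff X k - vcoeff Y k"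
  "vcoeff 0 k = 0" "vcoeff (frame a) k = (if k = 0 then axis a 1 else 0)"
  by (auto simp: vcoeff_def vec_eq_iff axis_def)

lemma vcoeff_nth [simp]: "vcoeff X k $ a = fps_nth (X $ a) k"
  by (simp add: vcoeff_def)

text \<open>The \<open>t\<close>-independent formal fields; statements about ordinary fields are
  obtained by evaluating formal ones on them.\<close>

definition const_vfield :: "'m::finite vfield \<Rightarrow> 'm formal_vfield" where
  "const_vfield X = (\<chi> a. fps_const (X $ a))"

lemma const_vfield_simps [simp]:
  "const_vfield (X + Y) = const_vfield X + const_vfield Y"
  "const_vfield (f *s X) = fps_const f *s const_vfield X"
  "const_vfield (axis a 1) = frame a"
  "vcoeff (const_vfield X) k = (if k = 0 then X else 0)"
  by (auto simp: const_vfield_def vec_eq_iff axis_def)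

lemma der_const: "der (const_vfield X) (fps_const f) = fps_const (lie_deriv X f)"
  by (simp add: der_def const_vfield_def lie_deriv_def) (simp add: fps_eq_iff fps_sum_nth)

lemma br_const: "br (const_vfield X) (const_vfield Y) = const_vfield (lie_bracket X Y)"
proof -
  have "br (const_vfield X) (const_vfield Y) $ a = const_vfield (lie_bracket X Y) $ a" for a
    by (simp add: formal_lie_bracket_def const_vfield_def[of Y] const_vfield_def[of X] der_const[unfolded const_vfield_def])
       (simp add: const_vfield_def lie_bracket_def)
  then show ?thesis by (simp add: vec_eq_iff)
qed

section \<open>Invariant symplectic forms\<close>

locale invariant_symplectic =
  fixes \<omega> :: "'m::finite vfield \<Rightarrow> 'm vfield \<Rightarrow> 'm cinf"
  assumes symplectic: "symplectic_form \<omega>" and invariant: "invariant_form \<omega>"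
begin

definition w :: "'m \<Rightarrow> 'm \<Rightarrow> real" where
  "w a b = (SOME c. \<omega> (axis a 1) (axis b 1) = of_real c)"

lemma omega_frame: "\<omega> (axis a 1) (axis b 1) = of_real (w a b)"
  unfolding w_def by (rule someI_ex) (use invariant in \<open>auto simp: invariant_form_def Reals_def\<close>)

lemma omega_skew: "\<omega> X Y = - \<omega> Y X"
  using symplectic unfolding symplectic_form_def two_form_def by blast

lemma omega_expand: "\<omega> X Y = (\<Sum>a\<in>UNIV. \<Sum>b\<in>UNIV. X $ a * Y $ b * of_real (w a b))"
proof -
  have hom: "module_hom (*s) (*) (\<lambda>X. \<omega> X Y)" for Y
    using symplectic unfolding symplectic_form_def two_form_def by blast
  have 1: "\<omega> X Y = (\<Sum>a\<in>UNIV. X $ a * \<omega> (axis a 1) Y)" for X Y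
  proof -
    have "\<omega> X Y = \<omega> (\<Sum>a\<in>UNIV. X $ a *s axis a 1) Y" by (simp only: basis_expansion)
    then show ?thesis by (simp only: module_hom.sum[OF hom] module_hom.scale[OF hom])
  qed
  have "\<omega> (axis a 1) Y = (\<Sum>b\<in>UNIV. Y $ b * of_real (w a b))" for a
  proof -
    have "\<omega> (axis a 1) Y = - (\<Sum>b\<in>UNIV. Y $ b * \<omega> (axis b 1) (axis a 1))"
      by (subst omega_skew, subst 1) (rule refl)
    also have "\<dots> = (\<Sum>b\<in>UNIV. Y $ b * \<omega> (axis a 1) (axis b 1))"
      by (subst omega_skew) (simp add: sum_negf)
    finally show ?thesis by (simp add: omega_frame)
  qed
  then show ?thesis by (simp add: 1[of X Y] sum_distrib_left mult.assoc)
qed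

lemma w_skew: "w a b = - w b a"
proof -
  have "lift (\<omega> (axis a 1) (axis b 1)) 0 = lift (- \<omega> (axis b 1) (axis a 1)) 0"
    using omega_skew by metis
  then show ?thesis by (simp add: omega_frame)
qed

definition v :: "'m \<Rightarrow> 'm \<Rightarrow> real" where
  "v a b = matrix_inv (\<chi> a b. w a b) $ a $ b"

lemma w_v: "(\<Sum>b\<in>UNIV. w a b * v b c) = (if a = c then 1 else 0)"
  and v_w: "(\<Sum>b\<in>UNIV. v a b * w b c) = (if a = c then 1 else 0)"
proof -
  let ?W = "\<chi> a b. w a b"
  \<comment> \<open>A kernel vector of the matrix is a constant field in the kernel of \<omega>,
    which nondegeneracy at one point excludes.\<close>
  have "\<forall>x. ?W *v x = 0 \<longrightarrow> x = 0"
  proof (intro allI impI)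
    fix x :: "real ^ 'm"
    assume *: "?W *v x = 0"
    let ?X = "(\<chi> a. of_real (x $ a)) :: 'm vfield"
    have "\<omega> ?X Y = 0" for Y
    proof -
      have "\<omega> ?X Y = - (\<Sum>b\<in>UNIV. Y $ b * of_real (\<Sum>a\<in>UNIV. w b a * x $ a))"
        by (subst omega_skew, subst omega_expand) (simp add: sum_distrib_left mult_ac)
      also have "\<dots> = 0" using * by (simp add: vec_eq_iff matrix_vector_mult_def)
      finally show ?thesis .
    qed
    then have "\<forall>a. cinf_apply (?X $ a) p = 0" for p
      using symplectic unfolding symplectic_form_def nondegenerate_form_def
      by (metis zero_cinf.rep_eq)
    then have "lift (?X $ a) 0 = 0" for a unfolding lift_def by blast
    then show "x = 0" by (simp add: vec_eq_iff)
  qed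
  then obtain B where "B ** ?W = mat 1"
    using matrix_left_invertible_ker[of ?W] by blast
  then have "invertible ?W" using matrix_left_right_inverse invertible_def by blast
  then have "?W ** matrix_inv ?W = mat 1 \<and> matrix_inv ?W ** ?W = mat 1"
    unfolding invertible_def matrix_inv_def by (rule someI_ex)
  then show "(\<Sum>b\<in>UNIV. w a b * v b c) = (if a = c then 1 else 0)"
    "(\<Sum>b\<in>UNIV. v a b * w b c) = (if a = c then 1 else 0)"
    unfolding v_def by (simp_all add: matrix_matrix_mult_def vec_eq_iff mat_def)
qed

abbreviation om :: "'m formal_vfield \<Rightarrow> 'm formal_vfield \<Rightarrow> 'm cinf fps" where
  "om \<equiv> formal_form \<omega>"

lemma om_expand: "om X Y = (\<Sum>a\<in>UNIV. \<Sum>b\<in>UNIV. X $ a * Y $ b * fps_const (of_real (w a b)))"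
proof (rule fps_ext)
  fix n
  have "fps_nth (om X Y) n = (\<Sum>i\<le>n. \<Sum>a\<in>UNIV. \<Sum>b\<in>UNIV. fps_nth (X $ a) i * fps_nth (Y $ b) (n - i) * of_real (w a b))"
    by (simp add: formal_form_def omega_expand)
  also have "\<dots> = (\<Sum>a\<in>UNIV. \<Sum>i\<le>n. \<Sum>b\<in>UNIV. fps_nth (X $ a) i * fps_nth (Y $ b) (n - i) * of_real (w a b))"
    by (rule sum.swap)
  also have "\<dots> = (\<Sum>a\<in>UNIV. \<Sum>b\<in>UNIV. \<Sum>i\<le>n. fps_nth (X $ a) i * fps_nth (Y $ b) (n - i) * of_real (w a b))"
    by (intro sum.cong refl sum.swap)
  finally show "fps_nth (om X Y) n = fps_nth (\<Sum>a\<in>UNIV. \<Sum>b\<in>UNIV. X $ a * Y $ b * fps_const (of_real (w a b))) n"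
    by (simp add: fps_sum_nth) (simp add: fps_mult_nth atLeast0AtMost sum_distrib_right)
qed

lemma om_simps [simp]:
  "om (X + X') Y = om X Y + om X' Y" "om (X - X') Y = om X Y - om X' Y"
  "om (F *s X) Y = F * om X Y" "om (- X) Y = - om X Y" "om 0 Y = 0"
  "om X (Y + Y') = om X Y + om X Y'" "om X (Y - Y') = om X Y - om X Y'"
  "om X (F *s Y) = F * om X Y" "om X (- Y) = - om X Y" "om X 0 = 0"
  by (simp_all add: om_expand algebra_simps sum.distrib sum_subtractf sum_negf sum_distrib_left)

lemma om_sum [simp]: "om X (sum f A) = (\<Sum>i\<in>A. om X (f i))"
  by (induction A rule: infinite_finite_induct) auto

lemma om_skew: "om X Y = - om Y X"
proof -
  have "om X Y = (\<Sum>b\<in>UNIV. \<Sum>a\<in>UNIV. X $ a * Y $ b * fps_const (of_real (w a b)))"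
    unfolding om_expand by (rule sum.swap)
  also have "\<dots> = (\<Sum>b\<in>UNIV. \<Sum>a\<in>UNIV. - (Y $ b * X $ a * fps_const (of_real (w b a))))"
  proof (intro sum.cong refl)
    fix a b
    have "fps_const (of_real (w a b) :: 'm cinf) = - fps_const (of_real (w b a))"
      by (subst w_skew) simp
    then show "X $ a * Y $ b * fps_const (of_real (w a b)) = - (Y $ b * X $ a * fps_const (of_real (w b a)))"
      by (simp only: mult.commute[of "Y $ b"] mult_minus_right)
  qed
  finally show ?thesis by (simp add: om_expand[of Y] sum_negf)
qed

lemma om_self [simp]: "om X X = 0"
proof (rule fps_of_nat_mult_eq_0)
  show "of_nat 2 * om X X = 0" using om_skew[of X X] by simp
qed simp

lemma om_frame: "om (frame a) (frame b) = fps_const (of_real (w a b))"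
  by (simp add: om_expand mult.assoc flip: sum_distrib_left)

lemma om_const: "om (const_vfield X) (const_vfield Y) = fps_const (\<omega> X Y)"
  by (simp add: om_expand omega_expand const_vfield_def) (simp add: fps_eq_iff fps_sum_nth)

text \<open>Raises an index with the inverse matrix \<open>v\<close>; \<open>om_sharp\<close> is the
  characteristic property.\<close>

definition sharp :: "('m \<Rightarrow> 'm cinf fps) \<Rightarrow> 'm formal_vfield" where
  "sharp s = (\<chi> a. \<Sum>b\<in>UNIV. s b * fps_const (of_real (v b a)))"

lemma om_sharp: "om (sharp s) Y = (\<Sum>b\<in>UNIV. s b * Y $ b)"
proof -
  have "om (sharp s) Y = (\<Sum>a\<in>UNIV. \<Sum>b\<in>UNIV. \<Sum>c\<in>UNIV. s c * Y $ b * (fps_const (of_real (v c a)) * fps_const (of_real (w a b))))"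
    by (simp add: om_expand sharp_def sum_distrib_left sum_distrib_right mult_ac)
  also have "\<dots> = (\<Sum>b\<in>UNIV. \<Sum>a\<in>UNIV. \<Sum>c\<in>UNIV. s c * Y $ b * (fps_const (of_real (v c a)) * fps_const (of_real (w a b))))"
    by (rule sum.swap)
  also have "\<dots> = (\<Sum>b\<in>UNIV. \<Sum>c\<in>UNIV. \<Sum>a\<in>UNIV. s c * Y $ b * (fps_const (of_real (v c a)) * fps_const (of_real (w a b))))"
    by (intro sum.cong refl sum.swap)
  also have "\<dots> = (\<Sum>b\<in>UNIV. \<Sum>c\<in>UNIV. s c * Y $ b * (\<Sum>a\<in>UNIV. fps_const (of_real (v c a)) * fps_const (of_real (w a b))))"
    by (simp add: sum_distrib_left)
  also have "\<dots> = (\<Sum>b\<in>UNIV. \<Sum>c\<in>UNIV. s c * Y $ b * (if c = b then 1 else 0))"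
  proof (intro sum.cong refl)
    fix b c
    have "(\<Sum>a\<in>UNIV. fps_const (of_real (v c a)) * fps_const (of_real (w a b)) :: 'm cinf fps)
        = fps_const (of_real (\<Sum>a\<in>UNIV. v c a * w a b))"
      by (simp add: fps_eq_iff fps_sum_nth)
    then show "s c * Y $ b * (\<Sum>a\<in>UNIV. fps_const (of_real (v c a)) * fps_const (of_real (w a b))) = s c * Y $ b * (if c = b then 1 else 0)"
      by (simp add: v_w)
  qed
  finally show ?thesis by (simp add: if_distrib[of "(*) _"] cong: if_cong)
qed

lemma om_nondegenerate:
  assumes "\<And>Y. om X Y = 0"
  shows "X = 0"
proof -
  have "om (sharp (\<lambda>b. if b = a then 1 else 0)) X = X $ a" for a
    by (simp add: om_sharp if_distrib[of "\<lambda>x. x * _"] cong: if_cong)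
  moreover have "om Y X = 0" for Y using assms om_skew[of Y X] by simp
  ultimately show ?thesis by (simp add: vec_eq_iff)
qed

lemma om_eqI: "(\<And>Y. om X Y = om X' Y) \<Longrightarrow> X = X'"
  using om_nondegenerate[of "X - X'"] by simp

lemma der_om: "der Z (om X Y) = om (flat_conn Z X) Y + om X (flat_conn Z Y)"
  by (simp add: om_expand flat_conn_def sum.distrib[symmetric] algebra_simps)

lemma fps_deriv_om: "fps_deriv (om X Y) = om (vderiv X) Y + om X (vderiv Y)"
  by (simp add: om_expand vderiv_def fps_deriv_sum sum.distrib[symmetric] algebra_simps)

section \<open>Hamiltonian fields and Poisson brackets\<close>

definition hamf :: "'m cinf fps \<Rightarrow> 'm formal_vfield" where
  "hamf H = sharp (\<lambda>b. fdiff b H)"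

lemma om_hamf: "om (hamf H) Y = der Y H"
  by (simp add: hamf_def om_sharp der_def mult.commute)

lemma om_closed:
  "der X (om Y Z) + der Y (om Z X) + der Z (om X Y) - om (br X Y) Z - om (br Y Z) X - om (br Z X) Y = 0"
  using om_skew[of "flat_conn Y X" Z] om_skew[of "flat_conn Z Y" X] om_skew[of "flat_conn X Z" Y]
  by (simp add: der_om br_flat_conn)

text \<open>Cartan's formula: \<omega> is closed and its contraction with \<open>hamf H\<close> is
  the exact form d\<open>H\<close>, so the Lie derivative of \<omega> along \<open>hamf H\<close> is
  zero.\<close>

lemma hamf_preserves_om:
  "der (hamf H) (om Y Z) = om (br (hamf H) Y) Z + om Y (br (hamf H) Z)"
  using om_closed[of "hamf H" Y Z] om_skew[of Z "hamf H"] om_skew[of "br Y Z" "hamf H"]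
    om_skew[of "br (hamf H) Z" Y] br_skew[of Z "hamf H"]
  by (simp add: om_hamf der_br diff_eq_eq add.commute)

lemma hamf_simps [simp]: "hamf (F + G) = hamf F + hamf G" "hamf (fps_X ^ n * F) = fps_X ^ n *s hamf F"
proof -
  show "hamf (fps_X ^ n * F) = fps_X ^ n *s hamf F"
    by (intro om_eqI) (simp add: om_hamf)
  show "hamf (F + G) = hamf F + hamf G" by (intro om_eqI) (simp add: om_hamf)
qed

lemma hamiltonian_field_nth: "hamiltonian_field \<omega> f $ a = fps_nth (hamf (fps_const f) $ a) 0"
proof -
  define X where "X = vcoeff (hamf (fps_const f)) 0"
  have const: "hamf (fps_const f) = const_vfield X"
    by (simp add: X_def hamf_def sharp_def const_vfield_def vec_eq_iff) (simp add: fps_eq_iff fps_sum_nth)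
  have X: "\<omega> X Y = lie_deriv Y f" for Y
  proof -
    have "fps_const (\<omega> X Y) = fps_const (lie_deriv Y f)"
      using om_hamf[of "fps_const f" "const_vfield Y"] by (simp add: const om_const der_const)
    then show ?thesis by simp
  qed
  have "hamiltonian_field \<omega> f = X"
    unfolding hamiltonian_field_def
  proof (rule the_equality)
    fix Z assume Z: "\<forall>Y. \<omega> Z Y = lie_deriv Y f"
    have "const_vfield Z = const_vfield X"
    proof (rule om_eqI)
      fix Y
      have *: "om (const_vfield Z) (const_vfield Y) = om (const_vfield X) (const_vfield Y)" for Y
        using Z X by (simp add: om_const)
      have "om A Y = (\<Sum>a\<in>UNIV. Y $ a * om A (const_vfield (axis a 1)))" for A
      proof -
        have "om A Y = om A (\<Sum>a\<in>UNIV. Y $ a *s axis a 1)" by (simp only: basis_expansion)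
        then show ?thesis by simp
      qed
      then show "om (const_vfield Z) Y = om (const_vfield X) Y" by (simp only: *)
    qed
    then have "vcoeff (const_vfield Z) 0 = vcoeff (const_vfield X) 0" by simp
    then show "Z = X" by simp
  qed (use X in blast)
  then show ?thesis by (simp add: X_def)
qed

lemma formal_poisson_eq: "formal_poisson \<omega> F G = der (hamf F) G"
proof (rule fps_ext)
  fix n
  have "hamiltonian_field \<omega> (fps_nth F i) $ a = fps_nth (hamf F $ a) i" for i a
    by (simp add: hamiltonian_field_nth hamf_def sharp_def fps_sum_nth)
  then have "fps_nth (formal_poisson \<omega> F G) n = (\<Sum>i\<le>n. \<Sum>a\<in>UNIV. fps_nth (hamf F $ a) i * pdiff a (fps_nth G (n - i)))"
    by (simp add: formal_poisson_def poisson_def lie_deriv_def)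
  then show "fps_nth (formal_poisson \<omega> F G) n = fps_nth (der (hamf F) G) n"
    unfolding der_nth by (subst sum.swap) simp
qed

end

section \<open>Formal flows\<close>

text \<open>Uniqueness for differential equations in \<open>t\<close>, stated for a whole family
  because differentiating a member leads to other members. Identities for the flow are proved by
  applying it to their defect, indexed by the arguments of the identity.\<close>

lemma fps_family_zero:
  fixes S :: "'i \<Rightarrow> 'm::finite cinf fps"
  assumes "\<And>i. fps_nth (S i) 0 = 0"
    and "\<And>i n. (\<And>j m. m \<le> n \<Longrightarrow> fps_nth (S j) m = 0) \<Longrightarrow> fps_nth (fps_deriv (S i)) n = 0"
  shows "S i = 0"
proof -
  have "\<forall>i. fps_nth (S i) n = 0" for n
  proof (induction n rule: less_induct)
    case (less n)
    show ?case
    proof (cases n)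
      case (Suc k)
      show ?thesis
      proof
        fix i
        have "of_nat (Suc k) * fps_nth (S i) (Suc k) = fps_nth (fps_deriv (S i)) k" by simp
        also have "\<dots> = 0" using less Suc by (intro assms) auto
        finally show "fps_nth (S i) n = 0" using cinf_of_nat_mult_eq_0 Suc by blast
      qed
    qed (use assms in simp)
  qed
  then show ?thesis by (simp add: fps_eq_iff)
qed

lemma fps_family_zero1:
  fixes S :: "'i \<Rightarrow> 'm::finite cinf fps"
  assumes "\<And>i. fps_nth (S i) 0 = 0" "\<And>i. fps_deriv (S i) = S (f i)"
  shows "S i = 0"
proof (rule fps_family_zero[of S])
  show "fps_nth (fps_deriv (S i)) n = 0" if "\<And>j m. m \<le> n \<Longrightarrow> fps_nth (S j) m = 0" for i n
    unfolding assms(2) using that by simp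
qed (rule assms)

lemma fps_family_zero2:
  fixes S :: "'i \<Rightarrow> 'j \<Rightarrow> 'm::finite cinf fps"
  assumes "\<And>i j. fps_nth (S i j) 0 = 0" "\<And>i j. fps_deriv (S i j) = S (f i) j + S i (g j)"
  shows "S i j = 0"
proof -
  have "(\<lambda>p. S (fst p) (snd p)) (i, j) = 0"
  proof (rule fps_family_zero[of "\<lambda>p. S (fst p) (snd p)"])
    fix p n
    assume *: "\<And>q m. m \<le> n \<Longrightarrow> fps_nth (S (fst q) (snd q)) m = 0"
    show "fps_nth (fps_deriv (S (fst p) (snd p))) n = 0"
      unfolding assms(2) using *[of n "(f (fst p), snd p)"] *[of n "(fst p, g (snd p))"] by simp
  qed (rule assms)
  then show ?thesis by simp
qed

lemma fps_const_if_deriv_zero: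
  fixes F :: "'m::finite cinf fps"
  assumes "fps_deriv F = fps_deriv G" "fps_nth F 0 = fps_nth G 0"
  shows "F = G"
  using fps_family_zero[of "\<lambda>_::unit. F - G"] assms by simp

context
  fixes X :: "'m::finite formal_vfield"
begin

definition total_deriv :: "'m cinf fps \<Rightarrow> 'm cinf fps" where
  "total_deriv F = fps_deriv F + der X F"

definition total_vderiv :: "'m formal_vfield \<Rightarrow> 'm formal_vfield" where
  "total_vderiv V = vderiv V + br X V"

text \<open>The formal flow \<open>\<Psi>\<close> of the time-dependent field \<open>X\<close> solves \<open>\<Psi>' = \<Psi> \<circ> X\<close>, \<open>\<Psi> = id\<close> at
  \<open>t = 0\<close>; its Taylor coefficients are the values at \<open>t = 0\<close> of the iterates of \<open>d/dt + X\<close>.\<close>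

definition flow :: "'m cinf fps \<Rightarrow> 'm cinf fps" where
  "flow F = Abs_fps (\<lambda>n. (1 / fact n) *\<^sub>R fps_nth ((total_deriv ^^ n) F) 0)"

text \<open>The action \<open>V \<mapsto> \<Psi> V \<Psi>^-1\<close> on derivations, generated by
  the commutator with \<open>d/dt + X\<close>. Giving it by Taylor coefficients makes it available
  before \<Psi> is known to be invertible.\<close>

definition vflow :: "'m formal_vfield \<Rightarrow> 'm formal_vfield" where
  "vflow V = (\<chi> a. Abs_fps (\<lambda>n. (1 / fact n) *\<^sub>R fps_nth ((total_vderiv ^^ n) V $ a) 0))"

lemma flow_nth_0 [simp]: "fps_nth (flow F) 0 = fps_nth F 0"
  by (simp add: flow_def)

lemma vflow_nth_0 [simp]: "fps_nth (vflow V $ a) 0 = fps_nth (V $ a) 0"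
  by (simp add: vflow_def)

lemma of_nat_scaleR_fact: "of_nat (Suc n) * ((1 / fact (Suc n)) *\<^sub>R f) = (1 / fact n) *\<^sub>R (f :: 'm cinf)"
proof -
  have "of_nat (Suc n) * ((1 / fact (Suc n)) *\<^sub>R f) = (real (Suc n) * (1 / fact (Suc n))) *\<^sub>R f"
    by (metis of_real_of_nat_eq scaleR_conv_of_real scaleR_scaleR)
  also have "real (Suc n) * (1 / fact (Suc n)) = 1 / fact n"
    by (simp del: of_nat_Suc)
  finally show ?thesis .
qed

lemma fps_deriv_flow: "fps_deriv (flow F) = flow (total_deriv F)"
proof (rule fps_ext)
  fix n
  show "fps_nth (fps_deriv (flow F)) n = fps_nth (flow (total_deriv F)) n"
    using of_nat_scaleR_fact[of n "fps_nth ((total_deriv ^^ Suc n) F) 0"]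
    by (simp add: flow_def funpow_Suc_right del: fact_Suc funpow.simps of_nat_Suc)
qed

lemma vderiv_vflow: "vderiv (vflow V) = vflow (total_vderiv V)"
proof -
  have "fps_nth (vderiv (vflow V) $ a) n = fps_nth (vflow (total_vderiv V) $ a) n" for a n
    using of_nat_scaleR_fact[of n "fps_nth ((total_vderiv ^^ Suc n) V $ a) 0"]
    by (simp add: vflow_def vderiv_def funpow_Suc_right del: fact_Suc funpow.simps of_nat_Suc)
  then show ?thesis by (simp add: vec_eq_iff fps_eq_iff)
qed

lemma total_deriv_add: "total_deriv (F + G) = total_deriv F + total_deriv G"
  and total_deriv_mult: "total_deriv (F * G) = total_deriv F * G + F * total_deriv G"
  and total_deriv_der: "total_deriv (der V F) = der (total_vderiv V) F + der V (total_deriv F)"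
  by (simp_all add: total_deriv_def total_vderiv_def algebra_simps fps_deriv_der der_br)

lemma flow_add: "flow (F + G) = flow F + flow G"
proof -
  define S where "S = (\<lambda>(F, G). flow (F + G) - flow F - flow G)"
  have "fps_deriv (S (F, G)) = S (total_deriv F, total_deriv G)" for F G
    by (simp add: S_def fps_deriv_flow total_deriv_add)
  then have "S (F, G) = 0"
    by (intro fps_family_zero1[of S "\<lambda>(F, G). (total_deriv F, total_deriv G)"])
       (auto simp: S_def split: prod.splits)
  then show ?thesis by (simp add: S_def algebra_simps)
qed

lemma flow_zero [simp]: "flow 0 = 0"
  using flow_add[of 0 0] by simp

lemma flow_minus: "flow (- F) = - flow F"
  using flow_add[of F "- F"] by (simp add: eq_neg_iff_add_eq_0 add.commute)

lemma flow_diff: "flow (F - G) = flow F - flow G"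
  using flow_add[of F "- G"] by (simp add: flow_minus)

lemma flow_mult: "flow (F * G) = flow F * flow G"
proof -
  define S where "S F G = flow (F * G) - flow F * flow G" for F G
  have "fps_deriv (S F G) = S (total_deriv F) G + S F (total_deriv G)" for F G
    by (simp add: S_def fps_deriv_flow total_deriv_mult flow_add algebra_simps)
  then have "S F G = 0"
    by (intro fps_family_zero2[of S]) (simp add: S_def)
  then show ?thesis by (simp add: S_def)
qed

lemma flow_const [simp]: "flow (fps_const (of_real c)) = fps_const (of_real c)"
  by (rule fps_const_if_deriv_zero) (simp_all add: fps_deriv_flow total_deriv_def)

lemma flow_one [simp]: "flow 1 = 1"
  using flow_const[of 1] by simp

lemma flow_X [simp]: "flow fps_X = fps_X"
  by (rule fps_const_if_deriv_zero) (simp_all add: fps_deriv_flow total_deriv_def)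

lemma flow_der: "flow (der V F) = der (vflow V) (flow F)"
proof -
  define S where "S V F = flow (der V F) - der (vflow V) (flow F)" for V F
  have "fps_deriv (S V F) = S (total_vderiv V) F + S V (total_deriv F)" for V F
    by (simp add: S_def fps_deriv_flow total_deriv_der flow_add fps_deriv_der vderiv_vflow)
  then have "S V F = 0"
    by (intro fps_family_zero2[of S]) (simp add: S_def der_nth)
  then show ?thesis by (simp add: S_def)
qed

text \<open>The recursion is read backwards: \<open>flow F = 0\<close> implies
  \<open>flow (total_deriv F) = 0\<close>, and one order of \<open>F\<close> follows from the
  preceding order of \<open>total_deriv F\<close>. This later turns a left inverse into a right
  inverse.\<close>

lemma flow_eq_0_iff: "flow F = 0 \<longleftrightarrow> F = 0"
proof
  assume "flow F = 0"
  moreover have "\<forall>F. flow F = 0 \<longrightarrow> fps_nth F n = 0" for n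
  proof (induction n rule: less_induct)
    case (less n)
    show ?case
    proof (intro allI impI)
      fix F
      assume F: "flow F = 0"
      show "fps_nth F n = 0"
      proof (cases n)
        case 0
        then show ?thesis using F flow_nth_0[of F] by simp
      next
        case (Suc k)
        have "flow (total_deriv F) = 0" using F fps_deriv_flow[of F] by simp
        then have "fps_nth (total_deriv F) k = 0" using less Suc by blast
        moreover have "fps_nth (der X F) k = 0"
          using less F Suc by (auto simp: der_nth intro!: sum.neutral)
        ultimately have "of_nat (Suc k) * fps_nth F (Suc k) = 0"
          by (simp add: total_deriv_def)
        then show ?thesis using cinf_of_nat_mult_eq_0 Suc by blast
      qed
    qed
  qed
  ultimately show "F = 0" by (simp add: fps_eq_iff)
qed simp

end

text \<open>\<open>\<Psi>\<^sup>-\<^sup>1\<close> is the flow of \<open>- \<Psi> X\<close>, since \<open>(\<Psi>\<^sup>-\<^sup>1)' = - X \<circ> \<Psi>\<^sup>-\<^sup>1\<close>.\<close>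

lemma flow_inverse_left: "flow (- vflow X X) (flow X F) = F"
proof -
  define S where "S F = flow (- vflow X X) (flow X F) - F" for F
  have "fps_deriv (S F) = S (fps_deriv F)" for F
  proof -
    \<comment> \<open>By \<open>flow_der\<close> the contribution of \<open>X\<close> to the
      derivative is the action of \<open>vflow X X\<close>, which the chosen field cancels.\<close>
    have "total_deriv (- vflow X X) (flow X F) = flow X (fps_deriv F)"
      by (simp add: total_deriv_def[of "- vflow X X"] fps_deriv_flow flow_der[symmetric])
         (simp add: total_deriv_def flow_add)
    then show ?thesis by (simp add: S_def fps_deriv_flow)
  qed
  then have "S F = 0" by (intro fps_family_zero1[of S]) (simp_all add: S_def)
  then show ?thesis by (simp add: S_def)
qed

lemma flow_inverse_right: "flow X (flow (- vflow X X) F) = F"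
proof -
  let ?Y = "- vflow X X"
  have "flow ?Y (flow X (flow ?Y F) - F) = 0" by (simp add: flow_diff flow_inverse_left)
  then show ?thesis by (simp add: flow_eq_0_iff)
qed

lemma vflow_inverse: "vflow X (vflow (- vflow X X) V) = V" "vflow (- vflow X X) (vflow X V) = V"
proof -
  let ?Y = "- vflow X X"
  show "vflow X (vflow ?Y V) = V"
  proof (rule vfield_eqI)
    fix F
    show "der (vflow X (vflow ?Y V)) F = der V F"
      using flow_der[of X "vflow ?Y V" "flow ?Y F"] flow_der[of ?Y V F]
      by (metis flow_inverse_right)
  qed
  show "vflow ?Y (vflow X V) = V"
  proof (rule vfield_eqI)
    fix F
    show "der (vflow ?Y (vflow X V)) F = der V F"
      using flow_der[of ?Y "vflow X V" "flow X F"] flow_der[of X V F]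
      by (metis flow_inverse_left)
  qed
qed

section \<open>Formal symplectomorphisms\<close>

text \<open>An algebra automorphism paired with its action on fields. Flows and their inverses are
  both instances, as \<open>push_connection\<close> requires.\<close>

locale formal_automorphism =
  fixes \<Psi> :: "'m::finite cinf fps \<Rightarrow> 'm cinf fps" and \<Psi>V :: "'m formal_vfield \<Rightarrow> 'm formal_vfield"
  assumes bij: "bij \<Psi>" and bijV: "bij \<Psi>V"
    and add: "\<Psi> (F + G) = \<Psi> F + \<Psi> G" and mult: "\<Psi> (F * G) = \<Psi> F * \<Psi> G"
    and const: "\<Psi> (fps_const (of_real c)) = fps_const (of_real c)"
    and der: "\<Psi> (der V F) = der (\<Psi>V V) (\<Psi> F)"
begin

lemma V_eqI:
  assumes "\<And>F. der V (\<Psi> F) = der W (\<Psi> F)"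
  shows "V = W"
proof (rule vfield_eqI)
  fix F
  obtain G where "F = \<Psi> G" using bij by (metis bij_pointE)
  then show "der V F = der W F" using assms by simp
qed

lemma zero: "\<Psi> 0 = 0"
  using add[of 0 0] by simp

lemma diff: "\<Psi> (F - G) = \<Psi> F - \<Psi> G"
  using add[of "F - G" G] by simp

lemma V_add: "\<Psi>V (V + W) = \<Psi>V V + \<Psi>V W"
  by (rule V_eqI) (simp add: add flip: der)

lemma V_diff: "\<Psi>V (V - W) = \<Psi>V V - \<Psi>V W"
  using V_add[of "V - W" W] by simp

lemma V_zero: "\<Psi>V 0 = 0"
  using V_add[of 0 0] by simp

lemma V_scale: "\<Psi>V (F *s V) = \<Psi> F *s \<Psi>V V"
  by (rule V_eqI) (simp add: mult flip: der)

lemma V_br: "\<Psi>V (br V W) = br (\<Psi>V V) (\<Psi>V W)"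
  by (rule V_eqI) (simp add: der_br diff flip: der)

lemma inverse: "formal_automorphism (inv \<Psi>) (inv \<Psi>V)"
proof
  show "bij (inv \<Psi>)" "bij (inv \<Psi>V)" using bij bijV by (simp_all add: bij_imp_bij_inv)
  have inv: "\<Psi> (inv \<Psi> F) = F" "inv \<Psi> (\<Psi> F) = F" "\<Psi>V (inv \<Psi>V V) = V" for F V
    using bij bijV by (simp_all add: bij_is_surj bij_is_inj surj_f_inv_f)
  note inv_eqI = inv_f_eq[OF bij_is_inj[OF bij]]
  show "inv \<Psi> (F + G) = inv \<Psi> F + inv \<Psi> G" "inv \<Psi> (F * G) = inv \<Psi> F * inv \<Psi> G"
    "inv \<Psi> (fps_const (of_real c)) = fps_const (of_real c)"
    "inv \<Psi> (formal_lie_deriv V F) = formal_lie_deriv (inv \<Psi>V V) (inv \<Psi> F)" for F G c V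
    by (auto intro!: inv_eqI simp: add mult const der inv)
qed

lemma push_vfield: "push_vfield \<Psi> = \<Psi>V"
proof
  fix V
  have inv: "\<Psi> (inv \<Psi> F) = F" for F using bij by (simp add: bij_is_surj surj_f_inv_f)
  show "push_vfield \<Psi> V = \<Psi>V V"
    unfolding push_vfield_def by (rule the_equality) (auto intro: vfield_eqI simp: der inv)
qed

lemma push_connection:
  "push_connection \<Psi> N X Y = \<Psi>V (N (inv \<Psi>V X) (inv \<Psi>V Y))"
  using push_vfield formal_automorphism.push_vfield[OF inverse] by (simp add: push_connection_def)

end

lemma formal_automorphism_flow: "formal_automorphism (flow X) (vflow X)"
proof
  show "bij (flow X)"
    by (rule o_bij[of "flow (- vflow X X)"]) (auto simp: fun_eq_iff flow_inverse_left flow_inverse_right)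
  show "bij (vflow X)"
    by (rule o_bij[of "vflow (- vflow X X)"]) (auto simp: fun_eq_iff vflow_inverse)
qed (simp_all add: flow_add flow_mult flow_der)

text \<open>The flow is multiplicative and fixes \<open>t\<close>, so splitting off the constant
  coefficient of \<open>F\<close> reduces order \<open>n + 1\<close> to order
  \<open>n\<close>.\<close>

lemma formal_ext_flow: "formal_ext (\<lambda>f. flow X (fps_const f)) = flow X"
proof
  fix F
  have "fps_nth (formal_ext (\<lambda>f. flow X (fps_const f)) F) n = fps_nth (flow X F) n" for n
  proof (induction n arbitrary: F)
    case (Suc n)
    let ?G = "fps_shift 1 F"
    have "F = fps_const (fps_nth F 0) + fps_X * ?G"
      by (auto simp: fps_eq_iff)
    then have "flow X F = flow X (fps_const (fps_nth F 0)) + fps_X * flow X ?G"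
      by (metis flow_add flow_mult flow_X)
    then have "fps_nth (flow X F) (Suc n) = fps_nth (flow X (fps_const (fps_nth F 0))) (Suc n) + fps_nth (flow X ?G) n"
      by simp
    also have "fps_nth (flow X ?G) n = (\<Sum>i\<le>n. fps_nth (flow X (fps_const (fps_nth ?G (n - i)))) i)"
      unfolding Suc[symmetric] by (simp add: formal_ext_def)
    finally show ?case by (simp add: formal_ext_def Suc_diff_le)
  qed (simp add: formal_ext_def)
  then show "formal_ext (\<lambda>f. flow X (fps_const f)) F = flow X F" by (simp add: fps_eq_iff)
qed

lemma vflow_X_power: "vflow X (fps_X ^ n *s V) = fps_X ^ n *s vflow X V"
proof -
  interpret formal_automorphism "flow X" "vflow X" by (rule formal_automorphism_flow)
  have "flow X (fps_X ^ n) = fps_X ^ n" by (induction n) (auto simp: mult)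
  then show ?thesis by (simp add: V_scale)
qed

text \<open>The difference \<open>S\<close> of the two flows satisfies a differential equation with
  source \<open>t^m\<close> times the flow of \<open>br Y W\<close>. Integration raises the order by
  one and divides by \<open>Suc m\<close>.\<close>

lemma vflow_perturb:
  fixes X Y :: "'m::finite formal_vfield"
  shows "k \<le> m \<Longrightarrow> vcoeff (vflow (X + fps_X ^ m *s Y) W) k = vcoeff (vflow X W) k"
    and "of_nat (Suc m) *s (vcoeff (vflow (X + fps_X ^ m *s Y) W) (Suc m) - vcoeff (vflow X W) (Suc m))
      = vcoeff (br Y W) 0"
proof -
  let ?X = "X + fps_X ^ m *s Y"
  define S where "S W = vflow ?X W - vflow X W" for W
  interpret A: formal_automorphism "flow ?X" "vflow ?X" by (rule formal_automorphism_flow)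
  interpret B: formal_automorphism "flow X" "vflow X" by (rule formal_automorphism_flow)
  have "total_vderiv ?X W = total_vderiv X W + fps_X ^ m *s br Y W" for W
    by (simp add: total_vderiv_def)
  then have dS: "vderiv (S W) = S (total_vderiv X W) + fps_X ^ m *s vflow ?X (br Y W)" for W
    by (simp add: S_def vderiv_vflow A.V_add vflow_X_power)
  have step: "of_nat (Suc k) * fps_nth (S W $ a) (Suc k) =
      fps_nth (S (total_vderiv X W) $ a) k + (if k < m then 0 else fps_nth (vflow ?X (br Y W) $ a) (k - m))" for k W a
  proof -
    have "of_nat (Suc k) * fps_nth (S W $ a) (Suc k) = fps_nth (vderiv (S W) $ a) k"
      by (simp add: vderiv_def)
    then show ?thesis by (simp add: dS fps_X_power_mult_nth)
  qed
  have zero: "k \<le> m \<Longrightarrow> fps_nth (S W $ a) k = 0" for k W a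
  proof (induction k arbitrary: W)
    case (Suc k)
    then have "of_nat (Suc k) * fps_nth (S W $ a) (Suc k) = 0" by (simp add: step del: of_nat_Suc)
    then show ?case using cinf_of_nat_mult_eq_0 by blast
  qed (simp add: S_def)
  show "k \<le> m \<Longrightarrow> vcoeff (vflow ?X W) k = vcoeff (vflow X W) k"
    using zero[of k W] by (simp add: S_def vec_eq_iff)
  show "of_nat (Suc m) *s (vcoeff (vflow ?X W) (Suc m) - vcoeff (vflow X W) (Suc m)) = vcoeff (br Y W) 0"
    using step[of m W] zero[of m] by (simp add: S_def vec_eq_iff algebra_simps)
qed

locale formal_symplecto = invariant_symplectic \<omega> + formal_automorphism \<Psi> \<Psi>V
  for \<omega> :: "'m::finite vfield \<Rightarrow> 'm vfield \<Rightarrow> 'm cinf" and \<Psi> \<Psi>V +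
  assumes om: "\<Psi> (om V W) = om (\<Psi>V V) (\<Psi>V W)"
begin

lemma V_hamf: "\<Psi>V (hamf F) = hamf (\<Psi> F)"
proof (rule om_eqI)
  fix Y
  obtain W where "Y = \<Psi>V W" using bijV by (metis bij_pointE)
  then show "om (\<Psi>V (hamf F)) Y = om (hamf (\<Psi> F)) Y" by (simp add: om_hamf der flip: om)
qed

lemma poisson: "\<Psi> (formal_poisson \<omega> F G) = formal_poisson \<omega> (\<Psi> F) (\<Psi> G)"
  by (simp add: formal_poisson_eq der V_hamf)

end

context invariant_symplectic
begin

lemma formal_symplecto_flow: "formal_symplecto \<omega> (flow (hamf H)) (vflow (hamf H))"
proof -
  interpret formal_automorphism "flow (hamf H)" "vflow (hamf H)" by (rule formal_automorphism_flow)
  show ?thesis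
  proof
    fix V W
    let ?X = "hamf H"
    define S where "S V W = flow ?X (om V W) - om (vflow ?X V) (vflow ?X W)" for V W
    have "total_deriv ?X (om V W) = om (total_vderiv ?X V) W + om V (total_vderiv ?X W)" for V W
      by (simp add: total_deriv_def total_vderiv_def fps_deriv_om hamf_preserves_om)
    then have "fps_deriv (S V W) = S (total_vderiv ?X V) W + S V (total_vderiv ?X W)" for V W
      by (simp add: S_def fps_deriv_flow flow_add fps_deriv_om vderiv_vflow)
    moreover have "fps_nth (S V W) 0 = 0" for V W
      by (simp add: S_def om_expand fps_sum_nth)
    ultimately have "S V W = 0" by (intro fps_family_zero2[of S])
    then show "flow ?X (om V W) = om (vflow ?X V) (vflow ?X W)" by (simp add: S_def)
  qed
qed

lemma formal_poisson_const: "formal_poisson \<omega> (fps_const f) (fps_const g) = fps_const (poisson \<omega> f g)"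
proof (rule fps_ext)
  fix n
  have zero: "poisson \<omega> 0 h = 0" "poisson \<omega> h 0 = 0" for h
    by (auto simp: poisson_def lie_deriv_def hamiltonian_field_nth hamf_def sharp_def fps_sum_nth)
  show "fps_nth (formal_poisson \<omega> (fps_const f) (fps_const g)) n = fps_nth (fps_const (poisson \<omega> f g)) n"
  proof (cases n)
    case (Suc k)
    then have "poisson \<omega> (fps_nth (fps_const f) i) (fps_nth (fps_const g) (n - i)) = 0" for i
      using zero by (cases "i = 0") auto
    moreover have "fps_nth (fps_const (poisson \<omega> f g)) n = 0" using Suc by simp
    ultimately show ?thesis by (simp only: formal_poisson_def fps_nth_Abs_fps sum.neutral_const)
  qed (simp add: formal_poisson_def)
qed

lemma formal_symplectomorphism_flow:
  "formal_symplectomorphism \<omega> (\<lambda>f. flow (hamf H) (fps_const f))"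
proof -
  interpret formal_symplecto \<omega> "flow (hamf H)" "vflow (hamf H)" by (rule formal_symplecto_flow)
  have "flow (hamf H) (fps_const (c *\<^sub>R f)) = fps_const (of_real c) * flow (hamf H) (fps_const f)" for c f
    using mult[of "fps_const (of_real c)" "fps_const f"] by (simp add: scaleR_conv_of_real)
  then show ?thesis
    unfolding formal_symplectomorphism_def
    by (auto simp: bij_def inj_on_def surj_def add[symmetric] poisson[symmetric]
        formal_poisson_const mult[symmetric])
qed

end

section \<open>Formal symplectic connections\<close>

lemma module_vec: "module ((*s) :: 'a::comm_ring_1 \<Rightarrow> ('a, 'm::finite) vec \<Rightarrow> _)"
  by standard (auto simp: vec_eq_iff algebra_simps)

lemma vcoeff_scale_const [simp]: "vcoeff (fps_const f *s V) k = f *s vcoeff V k"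
  by (simp add: vec_eq_iff)

lemma vcoeff_sum [simp]: "vcoeff (sum V A) k = (\<Sum>i\<in>A. vcoeff (V i) k)"
  by (induction A rule: infinite_finite_induct) auto

lemma fps_mult_nth_atMost: "fps_nth (F * G) m = (\<Sum>i\<le>m. fps_nth F i * fps_nth G (m - i))"
  by (simp add: fps_mult_nth atLeast0AtMost)

text \<open>The bridge from coefficient sequences to operators given by symbols \<open>G\<close>. It
  serves in both directions: for the given \<open>D\<close>, and for recognising
  \<open>coeffs\<close> as the sequence of \<open>N\<close>.\<close>

lemma formal_op_expand:
  fixes D :: "nat \<Rightarrow> 'm::finite vfield \<Rightarrow> 'm vfield \<Rightarrow> 'm vfield"
  assumes D: "\<And>k X Y. D k X Y = (if k = 0 then (\<chi> c. lie_deriv X (Y $ c)) else 0)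
      + (\<Sum>a\<in>UNIV. \<Sum>b\<in>UNIV. (X $ a * Y $ b) *s vcoeff (G a b) k)"
  shows "formal_op D X Y = flat_conn X Y + (\<Sum>a\<in>UNIV. \<Sum>b\<in>UNIV. (X $ a * Y $ b) *s G a b)"
proof -
  have "fps_nth (formal_op D X Y $ c) m
      = fps_nth ((flat_conn X Y + (\<Sum>a\<in>UNIV. \<Sum>b\<in>UNIV. (X $ a * Y $ b) *s G a b)) $ c) m" for c m
  proof -
    let ?A = "\<lambda>k i. if k = 0 then lie_deriv (vcoeff X i) (fps_nth (Y $ c) (m - k - i)) else 0"
    let ?B = "\<lambda>k i a b. fps_nth (X $ a) i * fps_nth (Y $ b) (m - k - i) * fps_nth (G a b $ c) k"
    have "fps_nth (formal_op D X Y $ c) m = (\<Sum>k\<le>m. \<Sum>i\<le>m - k. ?A k i) + (\<Sum>k\<le>m. \<Sum>i\<le>m - k. \<Sum>a\<in>UNIV. \<Sum>b\<in>UNIV. ?B k i a b)"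
      by (simp add: formal_op_def D sum.distrib if_distrib[of "\<lambda>x. x $ c"] cong: if_cong)
    also have "(\<Sum>k\<le>m. \<Sum>i\<le>m - k. ?A k i) = (\<Sum>k\<le>m. if k = 0 then \<Sum>i\<le>m. lie_deriv (vcoeff X i) (fps_nth (Y $ c) (m - i)) else 0)"
      by (intro sum.cong refl) simp
    also have "\<dots> = (\<Sum>i\<le>m. lie_deriv (vcoeff X i) (fps_nth (Y $ c) (m - i)))"
      by (simp add: sum.delta)
    also have "\<dots> = fps_nth (flat_conn X Y $ c) m"
      by (simp add: flat_conn_def der_nth lie_deriv_def) (rule sum.swap)
    also have "(\<Sum>k\<le>m. \<Sum>i\<le>m - k. \<Sum>a\<in>UNIV. \<Sum>b\<in>UNIV. ?B k i a b)
        = (\<Sum>k\<le>m. \<Sum>a\<in>UNIV. \<Sum>i\<le>m - k. \<Sum>b\<in>UNIV. ?B k i a b)"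
      by (intro sum.cong refl sum.swap)
    also have "\<dots> = (\<Sum>a\<in>UNIV. \<Sum>k\<le>m. \<Sum>i\<le>m - k. \<Sum>b\<in>UNIV. ?B k i a b)"
      by (rule sum.swap)
    also have "\<dots> = (\<Sum>a\<in>UNIV. \<Sum>k\<le>m. \<Sum>b\<in>UNIV. \<Sum>i\<le>m - k. ?B k i a b)"
      by (intro sum.cong refl sum.swap)
    also have "\<dots> = (\<Sum>a\<in>UNIV. \<Sum>b\<in>UNIV. \<Sum>k\<le>m. \<Sum>i\<le>m - k. ?B k i a b)"
      by (intro sum.cong refl sum.swap)
    also have "\<dots> = (\<Sum>a\<in>UNIV. \<Sum>b\<in>UNIV. fps_nth (G a b $ c * (X $ a * Y $ b)) m)"
      by (simp only: fps_mult_nth_atMost sum_distrib_left) (simp add: mult_ac)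
    finally show ?thesis by (simp add: fps_sum_nth mult.commute[of "G a b $ c" for a b])
  qed
  then show ?thesis by (simp add: vec_eq_iff fps_eq_iff)
qed

definition curv ::
    "('m::finite formal_vfield \<Rightarrow> 'm formal_vfield \<Rightarrow> 'm formal_vfield) \<Rightarrow>
     'm formal_vfield \<Rightarrow> 'm formal_vfield \<Rightarrow> 'm formal_vfield \<Rightarrow> 'm formal_vfield" where
  "curv N X Y Z = N X (N Y Z) - N Y (N X Z) - N (br X Y) Z"

lemma curvature_eq: "curvature D = curv (formal_op D)"
  by (simp add: curvature_def curv_def fun_eq_iff)

lemma vec_expand: "V = (\<Sum>a\<in>UNIV. V $ a *s axis a (1 :: 'a::comm_ring_1))"
  by (simp add: basis_expansion)

lemma (in invariant_symplectic) om_const_nth: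
  "fps_nth (om V (const_vfield Z)) k = \<omega> (vcoeff V k) Z"
  by (simp add: om_expand omega_expand const_vfield_def fps_sum_nth)

text \<open>The axioms of a symplectic connection over formal functions. Gauge transformations act
  on such an operator as a whole; a coefficient sequence is extracted only at the end.\<close>

locale formal_connection = invariant_symplectic \<omega>
  for \<omega> :: "'m::finite vfield \<Rightarrow> 'm vfield \<Rightarrow> 'm cinf" +
  fixes N :: "'m formal_vfield \<Rightarrow> 'm formal_vfield \<Rightarrow> 'm formal_vfield"
  assumes add_left: "N (X + X') Y = N X Y + N X' Y"
    and scale_left: "N (F *s X) Y = F *s N X Y"
    and add_right: "N X (Y + Y') = N X Y + N X Y'"
    and scale_right: "N X (F *s Y) = der X F *s Y + F *s N X Y"
    and torsion: "N X Y - N Y X = br X Y"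
    and compatible: "der X (om Y Z) = om (N X Y) Z + om Y (N X Z)"
begin

lemma diff_left: "N (X - X') Y = N X Y - N X' Y"
  using add_left[of "X - X'" X' Y] by simp

lemma zero_left [simp]: "N 0 Y = 0"
  using add_left[of 0 0 Y] by simp

lemma zero_right [simp]: "N X 0 = 0"
  using add_right[of X 0 0] by simp

lemma sum_left: "N (sum X A) Y = (\<Sum>i\<in>A. N (X i) Y)"
  by (induction A rule: infinite_finite_induct) (auto simp: add_left)

lemma sum_right: "N X (sum Y A) = (\<Sum>i\<in>A. N X (Y i))"
  by (induction A rule: infinite_finite_induct) (auto simp: add_right)

lemma expand: "N X Y = flat_conn X Y + (\<Sum>a\<in>UNIV. \<Sum>b\<in>UNIV. (X $ a * Y $ b) *s N (frame a) (frame b))"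
proof -
  have "N X Y = (\<Sum>b\<in>UNIV. der X (Y $ b) *s frame b) + (\<Sum>b\<in>UNIV. Y $ b *s N X (frame b))"
    by (subst vec_expand[of Y]) (simp add: sum_right scale_right sum.distrib)
  also have "(\<Sum>b\<in>UNIV. der X (Y $ b) *s frame b) = flat_conn X Y"
    using vec_expand[of "flat_conn X Y"] by (simp add: flat_conn_def)
  also have "(\<Sum>b\<in>UNIV. Y $ b *s N X (frame b)) = (\<Sum>b\<in>UNIV. \<Sum>a\<in>UNIV. (X $ a * Y $ b) *s N (frame a) (frame b))"
  proof (intro sum.cong refl)
    fix b
    have "N X (frame b) = (\<Sum>a\<in>UNIV. X $ a *s N (frame a) (frame b))"
      by (subst vec_expand[of X]) (simp add: sum_left scale_left)
    then show "Y $ b *s N X (frame b) = (\<Sum>a\<in>UNIV. (X $ a * Y $ b) *s N (frame a) (frame b))"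
      by (simp add: vec_eq_iff sum_distrib_left mult_ac)
  qed
  also have "\<dots> = (\<Sum>a\<in>UNIV. \<Sum>b\<in>UNIV. (X $ a * Y $ b) *s N (frame a) (frame b))"
    by (rule sum.swap)
  finally show ?thesis .
qed

lemma frame_sym: "N (frame a) (frame b) = N (frame b) (frame a)"
  using torsion[of "frame a" "frame b"] by simp

lemma frame_om_sym: "om (N (frame a) (frame b)) (frame c) = om (N (frame a) (frame c)) (frame b)"
  using compatible[of "frame a" "frame b" "frame c"] om_skew[of "frame b"] by (simp add: om_frame)

text \<open>Compatibility moves the outer covariant derivative to the other slot of \<omega>: the
  linear part becomes a curl of the lowered symbols, the quadratic part a pairing of two
  symbols.\<close>

lemma curv_frame:
  "om (curv N (frame a) (frame b) (frame c)) (frame d)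
    = fdiff a (om (N (frame b) (frame c)) (frame d)) - fdiff b (om (N (frame a) (frame c)) (frame d))
    - om (N (frame b) (frame c)) (N (frame a) (frame d)) + om (N (frame a) (frame c)) (N (frame b) (frame d))"
  using compatible[of "frame a" "N (frame b) (frame c)" "frame d"]
    compatible[of "frame b" "N (frame a) (frame c)" "frame d"]
  by (simp add: curv_def)

lemma curv_add_left: "curv N (X + X') Y Z = curv N X Y Z + curv N X' Y Z"
  by (simp add: curv_def add_left add_right algebra_simps)

lemma curv_scale_left: "curv N (F *s X) Y Z = F *s curv N X Y Z"
  by (simp add: curv_def add_left scale_left scale_right diff_left algebra_simps vec_eq_iff)

text \<open>\<omega> is parallel, so the curvature takes values in the symplectic Lie
  algebra.\<close>

lemma curv_om_sym: "om (curv N X Y Z) T = om (curv N X Y T) Z"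
proof -
  have "om (curv N X Y Z) T + om Z (curv N X Y T) = 0"
  proof -
    have "der X (der Y (om Z T)) - der Y (der X (om Z T)) - der (br X Y) (om Z T) = 0"
      by (simp add: der_br)
    then show ?thesis unfolding compatible der_simps by (simp add: compatible curv_def algebra_simps)
  qed
  then show ?thesis using om_skew[of Z "curv N X Y T"] by simp
qed

definition coeffs :: "nat \<Rightarrow> 'm vfield \<Rightarrow> 'm vfield \<Rightarrow> 'm vfield" where
  "coeffs k X Y = vcoeff (N (const_vfield X) (const_vfield Y)) k"

lemma flat_conn_const: "flat_conn (const_vfield X) (const_vfield Y) = const_vfield (\<chi> c. lie_deriv X (Y $ c))"
  by (simp add: flat_conn_def const_vfield_def der_const[unfolded const_vfield_def])

lemma formal_op_coeffs: "formal_op coeffs = N"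
proof (intro ext)
  fix X Y
  have "coeffs k X Y = (if k = 0 then (\<chi> c. lie_deriv X (Y $ c)) else 0)
      + (\<Sum>a\<in>UNIV. \<Sum>b\<in>UNIV. (X $ a * Y $ b) *s vcoeff (N (frame a) (frame b)) k)" for k X Y
    by (simp add: coeffs_def expand[of "const_vfield X"] flat_conn_const)
       (simp add: const_vfield_def)
  then show "formal_op coeffs X Y = N X Y"
    by (subst formal_op_expand) (auto simp flip: expand)
qed

text \<open>Only order zero carries derivative terms. At higher orders vanishing torsion and
  compatibility become the two symmetries of \<open>totally_symmetric\<close>.\<close>

lemma formal_symplectic_curve_coeffs: "formal_symplectic_curve \<omega> coeffs"
proof -
  have add: "coeffs k (X + X') Y = coeffs k X Y + coeffs k X' Y"
    "coeffs k X (Y + Y') = coeffs k X Y + coeffs k X Y'"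
    "coeffs k (f *s X) Y = f *s coeffs k X Y" for k X X' Y Y' f
    by (simp_all add: coeffs_def add_left add_right scale_left)
  have scale: "coeffs k X (f *s Y) = (if k = 0 then lie_deriv X f *s Y else 0) + f *s coeffs k X Y" for k X Y f
    by (simp add: coeffs_def scale_right der_const)
  have tor: "coeffs k X Y - coeffs k Y X = (if k = 0 then lie_bracket X Y else 0)" for k X Y
    using arg_cong[OF torsion[of "const_vfield X" "const_vfield Y"], of "\<lambda>V. vcoeff V k"]
    by (simp add: coeffs_def br_const)
  have comp: "(if k = 0 then lie_deriv X (\<omega> Y Z) else 0) = \<omega> (coeffs k X Y) Z - \<omega> (coeffs k X Z) Y" for k X Y Z
    using arg_cong[OF compatible[of "const_vfield X" "const_vfield Y" "const_vfield Z"], of "\<lambda>V. fps_nth V k"]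
      om_skew[of "const_vfield Y" "N (const_vfield X) (const_vfield Z)"]
    by (simp add: om_const der_const om_const_nth coeffs_def)
  have comp0: "lie_deriv X (\<omega> Y Z) = \<omega> (coeffs 0 X Y) Z + \<omega> Y (coeffs 0 X Z)" for X Y Z
    using comp[of 0 X Y Z] omega_skew[of Y "coeffs 0 X Z"] by simp
  have "symplectic_connection \<omega> (coeffs 0)"
    unfolding symplectic_connection_def linear_connection_def module_hom_iff
    using tor[of 0] comp0 by (auto simp: module_vec add scale)
  moreover have "tensor21 (coeffs k) \<and> totally_symmetric (\<lambda>X Y Z. \<omega> (coeffs k X Y) Z)" if "k \<ge> 1" for k
    using that tor[of k] comp[of k]
    by (auto simp: tensor21_def module_hom_iff module_vec add scale totally_symmetric_def)
  ultimately show ?thesis by (simp add: formal_symplectic_curve_def)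
qed

end

context invariant_symplectic
begin

text \<open>Symmetry of the symbols gives the torsion condition, symmetry of the lowered symbols in
  the last two slots gives compatibility; both spread from the frame by bilinearity of
  \<open>Q\<close>.\<close>

lemma formal_connection_of_frame:
  assumes N: "\<And>X Y. N X Y = flat_conn X Y + (\<Sum>a\<in>UNIV. \<Sum>b\<in>UNIV. (X $ a * Y $ b) *s G a b)"
    and sym: "\<And>a b. G a b = G b a"
    and om_sym: "\<And>a b c. om (G a b) (frame c) = om (G a c) (frame b)"
  shows "formal_connection \<omega> N"
proof
  fix X X' Y Y' Z :: "'m formal_vfield" and F
  define Q where "Q X Y = (\<Sum>a\<in>UNIV. \<Sum>b\<in>UNIV. (X $ a * Y $ b) *s G a b)" for X Y
  have N: "N X Y = flat_conn X Y + Q X Y" for X Y by (simp add: N Q_def)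
  have Q: "Q (X + X') Y = Q X Y + Q X' Y" "Q X (Y + Y') = Q X Y + Q X Y'"
    "Q (F *s X) Y = F *s Q X Y" "Q X (F *s Y) = F *s Q X Y" for X X' Y Y' F
    by (simp_all add: Q_def vec_eq_iff algebra_simps sum.distrib sum_distrib_left)
  have Q_sym: "Q X Y = Q Y X" for X Y
    unfolding Q_def by (subst sum.swap) (simp add: sym mult.commute)
  have om_Q: "om (Q X Y) Z = (\<Sum>a\<in>UNIV. \<Sum>b\<in>UNIV. \<Sum>c\<in>UNIV. X $ a * (Y $ b * Z $ c) * om (G a b) (frame c))" for X Y Z
  proof -
    have "om (Q X Y) Z = - (\<Sum>a\<in>UNIV. \<Sum>b\<in>UNIV. X $ a * Y $ b * om Z (G a b))"
      by (subst om_skew) (simp add: Q_def)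
    also have "\<dots> = (\<Sum>a\<in>UNIV. \<Sum>b\<in>UNIV. X $ a * Y $ b * om (G a b) Z)"
      by (subst om_skew) (simp add: sum_negf)
    also have "om (G a b) Z = (\<Sum>c\<in>UNIV. Z $ c * om (G a b) (frame c))" for a b
      by (subst vec_expand[of Z]) simp
    then have "(\<Sum>a\<in>UNIV. \<Sum>b\<in>UNIV. X $ a * Y $ b * om (G a b) Z) =
      (\<Sum>a\<in>UNIV. \<Sum>b\<in>UNIV. \<Sum>c\<in>UNIV. X $ a * (Y $ b * Z $ c) * om (G a b) (frame c))"
      by (simp add: sum_distrib_left mult_ac)
    finally show ?thesis .
  qed
  have "om (Q X Y) Z = om (Q X Z) Y"
    unfolding om_Q
  proof (rule sum.cong[OF refl])
    fix a
    show "(\<Sum>b\<in>UNIV. \<Sum>c\<in>UNIV. X $ a * (Y $ b * Z $ c) * om (G a b) (frame c))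
        = (\<Sum>b\<in>UNIV. \<Sum>c\<in>UNIV. X $ a * (Z $ b * Y $ c) * om (G a b) (frame c))"
      by (subst sum.swap) (simp add: om_sym[of a] mult.commute)
  qed
  then have "om (Q X Y) Z + om Y (Q X Z) = 0" using om_skew[of Y "Q X Z"] by simp
  then show "der X (om Y Z) = om (N X Y) Z + om Y (N X Z)"
    by (simp add: N der_om algebra_simps)
  show "N X Y - N Y X = br X Y" by (simp add: N br_flat_conn Q_sym[of X Y])
qed (simp_all add: N vec_eq_iff algebra_simps sum.distrib sum_distrib_left)

lemma formal_connection_formal_op:
  assumes D: "formal_symplectic_curve \<omega> D" and std: "standard_flat_connection (D 0)"
  shows "formal_connection \<omega> (formal_op D)"
    and "vcoeff (formal_op D (frame a) (frame b)) 0 = 0"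
proof -
  define G where "G a b = (\<chi> c. Abs_fps (\<lambda>k. D k (axis a 1) (axis b 1) $ c))" for a b
  have vG [simp]: "vcoeff (G a b) k = D k (axis a 1) (axis b 1)" for a b k
    by (simp add: G_def vec_eq_iff)
  have lin: "linear_connection (D 0)" and D0: "D 0 (axis a 1) (axis b 1) = 0" for a b
    using std by (simp_all add: standard_flat_connection_def)
  have tens: "tensor21 (D k)" "totally_symmetric (\<lambda>X Y Z. \<omega> (D k X Y) Z)" if "k \<noteq> 0" for k
    using D that by (auto simp: formal_symplectic_curve_def)
  have left: "module_hom (*s) (*s) (\<lambda>X. D k X Y)" for k Y
    using lin tens[of k] by (cases "k = 0") (auto simp: linear_connection_def tensor21_def)
  have right: "D k X (Y + Z) = D k X Y + D k X Z"
    "D k X (f *s Y) = (if k = 0 then lie_deriv X f *s Y else 0) + f *s D k X Y" for k X Y Z f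
    using lin tens[of k] by (cases "k = 0"; auto simp: linear_connection_def tensor21_def module_hom_iff)+
  have right_zero: "D k X 0 = 0" for k X using right(1)[of k X 0 0] by simp
  have right_sum: "D k X (sum Y A) = (\<Sum>i\<in>A. D k X (Y i))" for k X and Y :: "'m \<Rightarrow> 'm vfield" and A
    by (induction A rule: infinite_finite_induct) (auto simp: right right_zero)
  have "D k X Y = (if k = 0 then (\<chi> c. lie_deriv X (Y $ c)) else 0)
      + (\<Sum>a\<in>UNIV. \<Sum>b\<in>UNIV. (X $ a * Y $ b) *s vcoeff (G a b) k)" for k X Y
  proof -
    have 1: "D k X Y = (\<Sum>a\<in>UNIV. X $ a *s D k (axis a 1) Y)" for X Y
    proof -
      have "D k X Y = D k (\<Sum>a\<in>UNIV. X $ a *s axis a 1) Y" by (simp only: basis_expansion)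
      then show ?thesis by (simp only: module_hom.sum[OF left] module_hom.scale[OF left])
    qed
    have "D k X Y = (\<Sum>b\<in>UNIV. (if k = 0 then lie_deriv X (Y $ b) *s axis b 1 else 0)) + (\<Sum>b\<in>UNIV. Y $ b *s D k X (axis b 1))"
      by (subst vec_expand[of Y]) (simp add: right_sum right sum.distrib)
    also have "(\<Sum>b\<in>UNIV. (if k = 0 then lie_deriv X (Y $ b) *s axis b 1 else 0)) = (if k = 0 then (\<chi> c. lie_deriv X (Y $ c)) else 0)"
      using vec_expand[of "\<chi> c. lie_deriv X (Y $ c)"] by simp
    also have "(\<Sum>b\<in>UNIV. Y $ b *s D k X (axis b 1)) = (\<Sum>b\<in>UNIV. \<Sum>a\<in>UNIV. (X $ a * Y $ b) *s vcoeff (G a b) k)"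
      by (simp add: 1[of X] vec_eq_iff sum_distrib_left mult_ac)
    also have "\<dots> = (\<Sum>a\<in>UNIV. \<Sum>b\<in>UNIV. (X $ a * Y $ b) *s vcoeff (G a b) k)"
      by (rule sum.swap)
    finally show ?thesis .
  qed
  then have op: "formal_op D X Y = flat_conn X Y + (\<Sum>a\<in>UNIV. \<Sum>b\<in>UNIV. (X $ a * Y $ b) *s G a b)" for X Y
    by (rule formal_op_expand)
  have omG: "fps_nth (om (G a b) (frame c)) k = \<omega> (D k (axis a 1) (axis b 1)) (axis c 1)" for a b c k
    using om_const_nth[of "G a b" "axis c 1" k] by simp
  have om_zero: "\<omega> 0 Z = 0" for Z by (simp add: omega_expand)
  have om_sym: "om (G a b) (frame c) = om (G a c) (frame b)" "om (G a b) (frame c) = om (G b a) (frame c)" for a b c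
  proof -
    have "fps_nth (om (G a b) (frame c)) k = fps_nth (om (G a c) (frame b)) k
      \<and> fps_nth (om (G a b) (frame c)) k = fps_nth (om (G b a) (frame c)) k" for k
      using tens(2)[of k] unfolding omG totally_symmetric_def by (cases "k = 0") (auto simp: D0 om_zero)
    then show "om (G a b) (frame c) = om (G a c) (frame b)" "om (G a b) (frame c) = om (G b a) (frame c)"
      unfolding fps_eq_iff by blast+
  qed
  have "G a b = G b a" for a b
  proof (rule om_eqI)
    fix Y
    show "om (G a b) Y = om (G b a) Y"
      by (subst (1 2) vec_expand[of Y]) (simp add: om_sym(2)[of a b])
  qed
  then show "formal_connection \<omega> (formal_op D)"
    by (intro formal_connection_of_frame[of _ G] op om_sym)
  have "formal_op D (frame a) (frame b) = G a b"
    by (simp add: op vec_eq_iff mult.assoc flip: sum_distrib_left)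
  then show "vcoeff (formal_op D (frame a) (frame b)) 0 = 0"
    by (simp add: D0)
qed

section \<open>The Ricci type condition without denominators\<close>

definition sym_bilinear :: "('m formal_vfield \<Rightarrow> 'm formal_vfield \<Rightarrow> 'm cinf fps) \<Rightarrow> bool" where
  "sym_bilinear r \<longleftrightarrow> (\<forall>X Y. r X Y = r Y X) \<and> (\<forall>X X' Y. r (X + X') Y = r X Y + r X' Y) \<and>
     (\<forall>F X Y. r (F *s X) Y = F * r X Y)"

definition ricci_tensor ::
    "('m formal_vfield \<Rightarrow> 'm formal_vfield \<Rightarrow> 'm cinf fps) \<Rightarrow>
     'm formal_vfield \<Rightarrow> 'm formal_vfield \<Rightarrow> 'm formal_vfield \<Rightarrow> 'm formal_vfield \<Rightarrow> 'm cinf fps" where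
  "ricci_tensor r X Y Z T = 2 * om X Y * r Z T + om X Z * r Y T + om X T * r Y Z - om Y Z * r X T - om Y T * r X Z"

text \<open>Since \<open>r\<close> need not be known to be a trace here, this form of the Ricci type condition is
  visibly invariant under symplectomorphisms.\<close>

definition ricci_typed where
  "ricci_typed N r \<longleftrightarrow> sym_bilinear r \<and>
    (\<forall>X Y Z T. of_nat (CARD('m) + 2) * om (curv N X Y Z) T = - ricci_tensor r X Y Z T)"

lemma om_dual_frame: "om (sharp (\<lambda>b. if b = a then 1 else 0)) (frame c) = (if c = a then 1 else 0)"
  by (simp add: om_sharp axis_def if_distrib[of "(*) _"] cong: if_cong)

text \<open>The point is the symmetry of \<open>ricci D\<close>. The lowered curvature is symmetric
  in \<open>Z, T\<close>, and in \<open>ricci_tensor r X Y Z T\<close> only the term with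
  \<open>om X Y\<close> could fail to be; a pair with \<open>om X Y = 1\<close> isolates it.\<close>

lemma ricci_typed_if_ricci_type:
  assumes N: "formal_connection \<omega> (formal_op D)" and "ricci_type \<omega> D"
  shows "\<exists>r. ricci_typed (formal_op D) r"
proof -
  interpret formal_connection \<omega> "formal_op D" by (rule N)
  define r where "r = ricci D"
  have r: "r X Y = (\<Sum>i\<in>UNIV. curv (formal_op D) X (frame i) Y $ i)" for X Y
    by (simp add: r_def ricci_def trace_def matrix_def curvature_eq)
  have eq: "of_nat (CARD('m) + 2) * om (curv (formal_op D) X Y Z) T = - ricci_tensor r X Y Z T" for X Y Z T
  proof -
    have om: "om (curv (formal_op D) X Y Z) T = fps_const (of_real (- 1 / (real CARD('m) + 2))) * ricci_tensor r X Y Z T"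
      using assms(2) by (simp add: ricci_type_def weyl_part_def ricci_part_def ricci_tensor_def curvature_eq r_def)
    have k: "of_nat (CARD('m) + 2) * fps_const (of_real (- 1 / (real CARD('m) + 2))) = (- 1 :: 'm cinf fps)"
    proof -
      have "of_nat (CARD('m) + 2) * fps_const (of_real (- 1 / (real CARD('m) + 2)))
        = fps_const (of_real (real (CARD('m) + 2) * (- 1 / (real CARD('m) + 2))) :: 'm cinf)"
        by (simp only: of_real_mult of_real_of_nat_eq fps_const_mult[symmetric] fps_of_nat)
      also have "real (CARD('m) + 2) * (- 1 / (real CARD('m) + 2)) = - 1" by (simp add: field_simps)
      finally show ?thesis by (simp add: fps_const_neg[symmetric] del: fps_const_neg)
    qed
    show ?thesis unfolding om by (simp only: mult.assoc[symmetric] k) simp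
  qed
  have "r Z T = r T Z" for Z T
  proof -
    obtain a :: 'm where True by simp
    let ?X = "sharp (\<lambda>b. if b = a then 1 else 0)" and ?Y = "frame a"
    have "ricci_tensor r ?X ?Y Z T = ricci_tensor r ?X ?Y T Z"
      using eq[of ?X ?Y Z T] eq[of ?X ?Y T Z] curv_om_sym[of ?X ?Y Z T] by (metis neg_equal_iff_equal)
    then have "2 * r Z T = 2 * r T Z" by (simp add: ricci_tensor_def om_dual_frame algebra_simps)
    then have "of_nat 2 * (r Z T - r T Z) = 0" by (simp add: algebra_simps)
    then have "r Z T - r T Z = 0" using fps_of_nat_mult_eq_0 by (metis zero_less_numeral)
    then show ?thesis by simp
  qed
  moreover have "r (X + X') Y = r X Y + r X' Y" "r (F *s X) Y = F * r X Y" for F X X' Y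
    by (simp_all add: r curv_add_left curv_scale_left sum.distrib sum_distrib_left)
  ultimately have "sym_bilinear r" unfolding sym_bilinear_def by blast
  with eq show ?thesis unfolding ricci_typed_def by blast
qed

lemma ricci_typed_flat:
  assumes "ricci_typed N (\<lambda>X Y. 0)"
  shows "curv N X Y Z = 0"
proof (rule om_nondegenerate)
  fix T
  have "of_nat (CARD('m) + 2) * om (curv N X Y Z) T = 0"
    using assms by (simp add: ricci_typed_def ricci_tensor_def)
  then show "om (curv N X Y Z) T = 0" by (rule fps_of_nat_mult_eq_0[rotated]) simp
qed

end

section \<open>Transport of connections and curvature\<close>

context formal_symplecto
begin

definition push where "push N X Y = \<Psi>V (N (inv \<Psi>V X) (inv \<Psi>V Y))"

lemma V_inv: "inv \<Psi>V (\<Psi>V X) = X" "\<Psi>V (inv \<Psi>V X) = X"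
  using bijV by (simp_all add: bij_is_inj bij_is_surj surj_f_inv_f)

lemma formal_connection_push:
  assumes "formal_connection \<omega> N"
  shows "formal_connection \<omega> (push N)"
proof -
  interpret N: formal_connection \<omega> N by (rule assms)
  interpret I: formal_automorphism "inv \<Psi>" "inv \<Psi>V" by (rule inverse)
  have inv: "\<Psi> (inv \<Psi> F) = F" for F using bij by (simp add: bij_is_surj surj_f_inv_f)
  show ?thesis
  proof
    fix X Y Z :: "'m formal_vfield"
    have "der X (om Y Z) = \<Psi> (der (inv \<Psi>V X) (om (inv \<Psi>V Y) (inv \<Psi>V Z)))"
      by (simp add: der om V_inv)
    then show "der X (om Y Z) = om (push N X Y) Z + om Y (push N X Z)"
      by (simp add: N.compatible add om V_inv push_def)
    show "push N X Y - push N Y X = br X Y"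
      by (simp add: push_def V_diff[symmetric] N.torsion V_br V_inv)
  qed (simp_all add: push_def I.V_add I.V_scale N.add_left N.add_right N.scale_left N.scale_right V_add V_scale V_inv inv der)
qed

lemma curv_push: "curv (push N) (\<Psi>V X) (\<Psi>V Y) (\<Psi>V Z) = \<Psi>V (curv N X Y Z)"
  by (simp add: curv_def push_def V_inv V_diff flip: V_br)

lemma of_nat: "\<Psi> (of_nat n) = of_nat n"
  using const[of "real n"] by (simp add: fps_of_nat)

lemma ricci_typed_push:
  assumes "ricci_typed N r"
  shows "ricci_typed (push N) (\<lambda>X Y. \<Psi> (r (inv \<Psi>V X) (inv \<Psi>V Y)))"
proof -
  interpret I: formal_automorphism "inv \<Psi>" "inv \<Psi>V" by (rule inverse)
  have inv: "\<Psi> (inv \<Psi> F) = F" for F using bij by (simp add: bij_is_surj surj_f_inv_f)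
  let ?r = "\<lambda>X Y. \<Psi> (r (inv \<Psi>V X) (inv \<Psi>V Y))"
  have r: "sym_bilinear r"
    and eq: "\<And>X Y Z T. of_nat (CARD('m) + 2) * om (curv N X Y Z) T = - ricci_tensor r X Y Z T"
    using assms by (auto simp: ricci_typed_def)
  have "of_nat (CARD('m) + 2) * om (curv (push N) X Y Z) T = - ricci_tensor ?r X Y Z T" for X Y Z T
  proof -
    have minus: "\<Psi> (- F) = - \<Psi> F" for F using diff[of 0 F] by (simp add: zero)
    let ?X = "inv \<Psi>V X" and ?Y = "inv \<Psi>V Y" and ?Z = "inv \<Psi>V Z" and ?T = "inv \<Psi>V T"
    have "of_nat (CARD('m) + 2) * om (curv (push N) X Y Z) T = \<Psi> (of_nat (CARD('m) + 2) * om (curv N ?X ?Y ?Z) ?T)"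
      using curv_push[of N ?X ?Y ?Z] by (simp only: mult of_nat om V_inv)
    also have "\<dots> = - ricci_tensor ?r X Y Z T"
      using of_nat[of 2] unfolding eq minus ricci_tensor_def by (simp only: add diff mult om V_inv of_nat_numeral)
    finally show ?thesis .
  qed
  moreover have "sym_bilinear ?r"
    unfolding sym_bilinear_def
  proof (intro conjI allI)
    show "?r X Y = ?r Y X" for X Y using r unfolding sym_bilinear_def by metis
    show "?r (X + X') Y = ?r X Y + ?r X' Y" for X X' Y
      using r unfolding sym_bilinear_def by (metis I.V_add add)
    show "?r (F *s X) Y = F * ?r X Y" for F X Y
      using r unfolding sym_bilinear_def by (metis I.V_scale mult inv)
  qed
  ultimately show ?thesis by (simp add: ricci_typed_def)
qed

end

section \<open>Consequences of the Bianchi identity\<close>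

text \<open>Contracting \<open>a, b\<close> with \<open>v\<close> expresses
  \<open>CARD('m) * T e c d - T c e d - T d e c\<close> by the trace \<open>s\<close> of
  \<open>T\<close>. In the cyclic sum the right side cancels by skewness of \<open>w\<close>, so
  \<open>CARD('m) - 2\<close> kills the cyclic sum of \<open>T\<close>; here dimension two is
  excluded. The ring is abstract because \<open>T\<close> will be the gradient of \<open>r\<close>
  over functions, and the algebraic derivative \<open>dr\<close> over formal functions.\<close>

lemma bianchi_contraction:
  fixes w v :: "'m::finite \<Rightarrow> 'm \<Rightarrow> 'a::comm_ring_1" and T :: "'m \<Rightarrow> 'm \<Rightarrow> 'm \<Rightarrow> 'a"
  assumes tf: "\<And>k (x::'a). k > 0 \<Longrightarrow> of_nat k * x = 0 \<Longrightarrow> x = 0"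
    and w: "\<And>a b. w a b = - w b a" and v: "\<And>a b. v a b = - v b a"
    and vw: "\<And>a c. (\<Sum>b\<in>UNIV. v a b * w b c) = (if a = c then 1 else 0)"
    and card: "CARD('m) > 2"
    and sym: "\<And>e c d. T e c d = T e d c"
    and bianchi: "\<And>e a b c d.
      2 * w a b * T e c d + w a c * T e b d + w a d * T e b c - w b c * T e a d - w b d * T e a c
      + (2 * w b e * T a c d + w b c * T a e d + w b d * T a e c - w e c * T a b d - w e d * T a b c)
      + (2 * w e a * T b c d + w e c * T b a d + w e d * T b a c - w a c * T b e d - w a d * T b e c) = 0"
  shows "\<exists>s. \<forall>e c d. of_nat (CARD('m) + 1) * T e c d = w e c * s d + w e d * s c"
proof -
  define C where "C f = (\<Sum>a\<in>UNIV. \<Sum>b\<in>UNIV. v b a * f a b)" for f :: "'m \<Rightarrow> 'm \<Rightarrow> 'a"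
  have C_add: "C (\<lambda>a b. f a b + g a b) = C f + C g" for f g
    by (simp add: C_def distrib_left sum.distrib)
  have C_diff: "C (\<lambda>a b. f a b - g a b) = C f - C g" for f g
    by (simp add: C_def right_diff_distrib sum_subtractf)
  have C_scale: "C (\<lambda>a b. k * f a b) = k * C f" for f k
    by (simp add: C_def sum_distrib_left mult_ac)
  have C_swap: "C (\<lambda>a b. f b a) = - C f" for f
    unfolding C_def by (subst sum.swap, subst v) (simp add: sum_negf)
  have C1: "C (\<lambda>a b. w a c * g b) = g c" for g c
  proof -
    have "C (\<lambda>a b. w a c * g b) = (\<Sum>b\<in>UNIV. \<Sum>a\<in>UNIV. g b * (v b a * w a c))"
      unfolding C_def by (subst sum.swap) (simp add: mult_ac)
    also have "\<dots> = (\<Sum>b\<in>UNIV. g b * (if b = c then 1 else 0))"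
      by (simp add: vw flip: sum_distrib_left)
    finally show ?thesis by (simp add: if_distrib[of "(*) _"] cong: if_cong)
  qed
  have C2: "C (\<lambda>a b. w b c * g a) = - g c" for g c
    using C_swap[of "\<lambda>a b. w a c * g b"] C1[of c g] by simp
  have C3: "C (\<lambda>a b. w c a * g b) = - g c" for g c
    using C1[of c "\<lambda>b. - g b"] w[of c] by simp
  have C0: "C (\<lambda>a b. w a b) = of_nat CARD('m)"
  proof -
    have "C (\<lambda>a b. w a b) = (\<Sum>b\<in>UNIV. \<Sum>a\<in>UNIV. v b a * w a b)"
      unfolding C_def by (rule sum.swap)
    then show ?thesis by (simp add: vw)
  qed
  define s where "s d = C (\<lambda>a b. T a b d)" for d
  have s': "C (\<lambda>a b. T b a d) = - s d" for d
    unfolding s_def by (rule C_swap)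
  have E: "of_nat CARD('m) * T e c d - T c e d - T d e c = w e c * s d + w e d * s c" (is "?L = ?R") for e c d
  proof -
    have "0 = C (\<lambda>a b. 2 * w a b * T e c d + w a c * T e b d + w a d * T e b c - w b c * T e a d - w b d * T e a c
      + (2 * w b e * T a c d + w b c * T a e d + w b d * T a e c - w e c * T a b d - w e d * T a b c)
      + (2 * w e a * T b c d + w e c * T b a d + w e d * T b a c - w a c * T b e d - w a d * T b e c))"
      unfolding bianchi by (simp add: C_def)
    also have "\<dots> = 2 * T e c d * of_nat CARD('m) + T e c d + T e d c + T e c d + T e d c
      + (- (2 * T e c d) - T c e d - T d e c - w e c * s d - w e d * s c)
      + (- (2 * T e c d) - w e c * s d - w e d * s c - T c e d - T d e c)"
    proof -
      have 1: "C (\<lambda>a b. 2 * w a b * T e c d) = 2 * T e c d * of_nat CARD('m)"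
        using C_scale[of "2 * T e c d" w] C0 by (simp add: mult_ac)
      have 2: "C (\<lambda>a b. 2 * w b e * T a c d) = - (2 * T e c d)"
        using C2[of e "\<lambda>a. 2 * T a c d"] by (simp add: mult_ac)
      have 3: "C (\<lambda>a b. 2 * w e a * T b c d) = - (2 * T e c d)"
        using C3[of e "\<lambda>a. 2 * T a c d"] by (simp add: mult_ac)
      show ?thesis
        unfolding C_add C_diff 1 2 3 C1[of _ "\<lambda>b. T _ b _"] C2[of _ "\<lambda>b. T _ b _"]
          C1[of _ "\<lambda>b. T b _ _"] C2[of _ "\<lambda>b. T b _ _"] C_scale s' s_def[symmetric]
        by simp
    qed
    also have "\<dots> = of_nat 2 * (?L - ?R)" by (simp add: sym[of e d c] algebra_simps)
    finally have "of_nat 2 * (?L - ?R) = 0" by simp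
    then have "?L - ?R = 0" by (rule tf[rotated]) simp
    then show ?thesis by simp
  qed
  have "of_nat (CARD('m) + 1) * T e c d = w e c * s d + w e d * s c" for e c d
  proof -
    let ?Z = "T e c d + T c e d + T d e c"
    have "of_nat CARD('m) * ?Z - 2 * ?Z = (of_nat CARD('m) * T e c d - T c e d - T d e c)
        + (of_nat CARD('m) * T c e d - T e c d - T d c e) + (of_nat CARD('m) * T d e c - T e d c - T c d e)"
      using sym[of d c e] sym[of c d e] sym[of e d c] by (simp add: algebra_simps)
    also have "\<dots> = 0"
      unfolding E using w[of c e] w[of d e] w[of d c] by simp
    finally have "of_nat CARD('m) * ?Z - 2 * ?Z = 0" .
    moreover have "(of_nat CARD('m) :: 'a) = of_nat (CARD('m) - 2) + 2"
      using card by (metis add.commute le_add_diff_inverse less_imp_le of_nat_add of_nat_numeral)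
    ultimately have "of_nat (CARD('m) - 2) * ?Z = 0" by (simp add: algebra_simps)
    then have Z: "?Z = 0" by (rule tf[rotated]) (simp add: card)
    have "of_nat (CARD('m) + 1) * T e c d = (of_nat CARD('m) * T e c d - T c e d - T d e c) + ?Z"
      by (simp add: algebra_simps)
    then show ?thesis unfolding E Z by simp
  qed
  then show ?thesis by blast
qed

context invariant_symplectic
begin

lemma v_skew: "v a b = - v b a"
proof -
  have "- v b a = (\<Sum>c\<in>UNIV. (if a = c then 1 else 0) * - v b c)"
    by (simp add: if_distrib[of "\<lambda>x. x * _"] sum_negf cong: if_cong)
  also have "\<dots> = (\<Sum>c\<in>UNIV. \<Sum>d\<in>UNIV. v a d * w d c * - v b c)"
    by (simp only: v_w[symmetric] sum_distrib_right)
  also have "\<dots> = (\<Sum>d\<in>UNIV. \<Sum>c\<in>UNIV. v a d * (v b c * w c d))"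
  proof (subst sum.swap, intro sum.cong refl)
    fix c d
    show "v a d * w d c * - v b c = v a d * (v b c * w c d)" using w_skew[of d c] by simp
  qed
  also have "\<dots> = (\<Sum>d\<in>UNIV. v a d * (if b = d then 1 else 0))"
    by (simp only: v_w[symmetric] sum_distrib_left)
  finally show ?thesis by (simp add: if_distrib[of "(*) _"] cong: if_cong)
qed

lemma of_real_v_w: "(\<Sum>b\<in>UNIV. of_real (v a b) * of_real (w b c)) = (if a = c then 1 else (0 :: 'm cinf))"
proof -
  have "(\<Sum>b\<in>UNIV. of_real (v a b) * of_real (w b c)) = (of_real (\<Sum>b\<in>UNIV. v a b * w b c) :: 'm cinf)"
    by simp
  then show ?thesis by (simp add: v_w del: of_real_sum of_real_mult)
qed

lemma const_v_w:
  "(\<Sum>b\<in>UNIV. fps_const (of_real (v a b)) * fps_const (of_real (w b c))) = (if a = c then 1 else (0 :: 'm cinf fps))"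
proof -
  have "(\<Sum>b\<in>UNIV. fps_const (of_real (v a b)) * fps_const (of_real (w b c)) :: 'm cinf fps)
      = fps_const (of_real (\<Sum>b\<in>UNIV. v a b * w b c))"
    by (simp add: fps_eq_iff fps_sum_nth)
  then show ?thesis by (simp add: v_w)
qed

end

lemma Reals_of_nat_mult_cancel:
  fixes f :: "'m::finite cinf"
  assumes R: "of_nat k * f \<in> \<real>" and k: "k > 0"
  shows "f \<in> \<real>"
proof -
  obtain c where c: "of_nat k * f = of_real c" using R by (rule Reals_cases)
  have "of_nat k * (of_real (c / real k) :: 'm cinf) = of_real (real k * (c / real k))"
    by (simp only: of_real_mult of_real_of_nat_eq)
  also have "real k * (c / real k) = c" using k by simp
  finally have "of_nat k * (f - of_real (c / real k)) = 0" by (simp only: c right_diff_distrib diff_self)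
  from cinf_of_nat_mult_eq_0[OF k this] have "f = of_real (c / real k)" by simp
  then show ?thesis by (simp only: Reals_of_real)
qed

text \<open>On a torus the identity forces \<open>r\<close> to be constant: \<open>\<partial>\<^sub>e r\<^sub>c\<^sub>d\<close> is determined by a vector
  \<open>s\<close>, then \<open>\<partial>\<^sub>f s\<^sub>d = \<omega>\<^sub>f\<^sub>d \<tau>\<close> with \<open>\<tau>\<close> constant, and periodic functions with constant derivatives
  are constant.\<close>

lemma (in invariant_symplectic) bianchi_torus_constant:
  fixes r :: "'m \<Rightarrow> 'm \<Rightarrow> 'm cinf" and A :: "'m \<Rightarrow> 'm \<Rightarrow> 'm \<Rightarrow> 'm cinf"
  assumes card: "CARD('m) > 2" and sym: "\<And>c d. r c d = r d c"
    and eq: "\<And>a b c d. pdiff a (A b c d) - pdiff b (A a c d)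
      - (2 * of_real (w a b) * r c d + of_real (w a c) * r b d + of_real (w a d) * r b c
        - of_real (w b c) * r a d - of_real (w b d) * r a c) \<in> \<real>"
  shows "r c d \<in> \<real>"
proof -
  define W V :: "'m \<Rightarrow> 'm \<Rightarrow> 'm cinf" where "W a b = of_real (w a b)" and "V a b = of_real (v a b)" for a b
  have W: "W a b = - W b a" and V: "V a b = - V b a" for a b
    using w_skew[of a b] v_skew[of a b] by (simp_all add: W_def V_def)
  have dW [simp]: "pdiff e (W a b) = 0" for e a b by (simp add: W_def)
  have VW: "(\<Sum>b\<in>UNIV. V a b * W b c) = (if a = c then 1 else 0)" for a c
    unfolding W_def V_def by (rule of_real_v_w)
  define E where "E a b c d = 2 * W a b * r c d + W a c * r b d + W a d * r b c - W b c * r a d - W b d * r a c" for a b c d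
  have dE: "pdiff e (E a b c d) = pdiff e (pdiff a (A b c d)) - pdiff e (pdiff b (A a c d))" for e a b c d
  proof -
    have "pdiff a (A b c d) - pdiff b (A a c d) - E a b c d \<in> \<real>" using eq by (simp add: E_def W_def)
    then obtain k where "pdiff a (A b c d) - pdiff b (A a c d) - E a b c d = of_real k" by (auto simp: Reals_def)
    then have "pdiff e (pdiff a (A b c d) - pdiff b (A a c d) - E a b c d) = 0" by simp
    then show ?thesis by simp
  qed
  \<comment> \<open>Second derivatives of \<open>A\<close> cancel in the cyclic sum, which leaves a
    condition on \<open>r\<close> alone.\<close>
  have "pdiff e (E a b c d) + pdiff a (E b e c d) + pdiff b (E e a c d) = 0" for e a b c d
    unfolding dE by (simp add: pdiff_commute[of e] pdiff_commute[of a b])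
  then have bianchi: "2 * W a b * pdiff e (r c d) + W a c * pdiff e (r b d) + W a d * pdiff e (r b c) - W b c * pdiff e (r a d) - W b d * pdiff e (r a c)
      + (2 * W b e * pdiff a (r c d) + W b c * pdiff a (r e d) + W b d * pdiff a (r e c) - W e c * pdiff a (r b d) - W e d * pdiff a (r b c))
      + (2 * W e a * pdiff b (r c d) + W e c * pdiff b (r a d) + W e d * pdiff b (r a c) - W a c * pdiff b (r e d) - W a d * pdiff b (r e c)) = 0" for e a b c d
    by (simp add: E_def)
  have "pdiff e (r c d) = pdiff e (r d c)" for e c d by (simp only: sym)
  from bianchi_contraction[OF cinf_of_nat_mult_eq_0 W V VW card this bianchi]
  have "\<exists>s. \<forall>e c d. of_nat (CARD('m) + 1) * pdiff e (r c d) = W e c * s d + W e d * s c" .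
  then obtain s where s: "\<And>e c d. of_nat (CARD('m) + 1) * pdiff e (r c d) = W e c * s d + W e d * s c" by blast
  \<comment> \<open>Integrability: the mixed second derivatives of \<open>r\<close> agree.\<close>
  have ds: "W e c * pdiff f (s d) + W e d * pdiff f (s c) = W f c * pdiff e (s d) + W f d * pdiff e (s c)" for e f c d
    using arg_cong[OF s[of e c d], of "pdiff f"] arg_cong[OF s[of f c d], of "pdiff e"]
    by (simp add: pdiff_commute[of f e])
  define \<tau> where "\<tau> = (\<Sum>c\<in>UNIV. \<Sum>e\<in>UNIV. V c e * pdiff e (s c))"
  have VW': "(\<Sum>e\<in>UNIV. V c e * W e d) = (if c = d then 1 else 0)" for c d by (rule VW)
  \<comment> \<open>Contracting \<open>ds\<close> over \<open>c, e\<close> with \<open>V\<close>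
    gives \<open>CARD('m) + 1\<close> copies of the derivative on the left, one of which cancels
    against the right side.\<close>
  have ds2: "of_nat CARD('m) * pdiff f (s d) = W f d * \<tau>" for f d
  proof -
    have "(\<Sum>c\<in>UNIV. \<Sum>e\<in>UNIV. V c e * (W e c * pdiff f (s d) + W e d * pdiff f (s c)))
        = (\<Sum>c\<in>UNIV. \<Sum>e\<in>UNIV. V c e * (W f c * pdiff e (s d) + W f d * pdiff e (s c)))"
      by (simp only: ds)
    moreover have "(\<Sum>c\<in>UNIV. \<Sum>e\<in>UNIV. V c e * (W e c * pdiff f (s d) + W e d * pdiff f (s c)))
        = (\<Sum>c\<in>UNIV. (\<Sum>e\<in>UNIV. V c e * W e c) * pdiff f (s d)) + (\<Sum>c\<in>UNIV. (\<Sum>e\<in>UNIV. V c e * W e d) * pdiff f (s c))"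
      by (simp add: algebra_simps sum.distrib sum_distrib_left)
    moreover have "\<dots> = of_nat CARD('m) * pdiff f (s d) + pdiff f (s d)"
      by (simp add: VW' if_distrib[of "\<lambda>x. x * _"] cong: if_cong)
    moreover have "(\<Sum>c\<in>UNIV. \<Sum>e\<in>UNIV. V c e * (W f c * pdiff e (s d) + W f d * pdiff e (s c)))
        = (\<Sum>e\<in>UNIV. (\<Sum>c\<in>UNIV. V e c * W c f) * pdiff e (s d)) + W f d * \<tau>"
    proof -
      have "(\<Sum>c\<in>UNIV. \<Sum>e\<in>UNIV. V c e * (W f c * pdiff e (s d))) = (\<Sum>e\<in>UNIV. (\<Sum>c\<in>UNIV. V e c * W c f) * pdiff e (s d))"
        by (subst sum.swap, subst V, subst W) (simp add: sum_distrib_right mult.assoc)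
      then show ?thesis by (simp add: distrib_left sum.distrib \<tau>_def sum_distrib_left mult_ac)
    qed
    moreover have "\<dots> = pdiff f (s d) + W f d * \<tau>"
      by (simp add: VW' if_distrib[of "\<lambda>x. x * _"] cong: if_cong)
    ultimately show ?thesis by simp
  qed
  have "pdiff g \<tau> = 0" for g
  proof -
    \<comment> \<open>The same integrability argument, now for the second derivatives of
      \<open>s\<close>.\<close>
    have d: "W f d * pdiff g \<tau> = W g d * pdiff f \<tau>" for f d
      using arg_cong[OF ds2[of f d], of "pdiff g"] arg_cong[OF ds2[of g d], of "pdiff f"]
      by (simp add: pdiff_commute[of f g])
    have "(\<Sum>d\<in>UNIV. (\<Sum>f\<in>UNIV. V d f * W f d)) * pdiff g \<tau> = (\<Sum>d\<in>UNIV. \<Sum>f\<in>UNIV. V d f * (W f d * pdiff g \<tau>))"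
      by (simp add: sum_distrib_right mult.assoc)
    also have "\<dots> = (\<Sum>d\<in>UNIV. \<Sum>f\<in>UNIV. V d f * (W g d * pdiff f \<tau>))" by (simp only: d)
    also have "\<dots> = (\<Sum>f\<in>UNIV. (\<Sum>d\<in>UNIV. V f d * W d g) * pdiff f \<tau>)"
      by (subst sum.swap, subst V, subst W) (simp add: sum_distrib_right mult.assoc)
    also have "\<dots> = pdiff g \<tau>" by (simp add: VW' if_distrib[of "\<lambda>x. x * _"] cong: if_cong)
    finally have "of_nat CARD('m) * pdiff g \<tau> = pdiff g \<tau>" by (simp add: VW')
    moreover have N: "of_nat CARD('m) = (of_nat (CARD('m) - 1) + 1 :: 'm cinf)"
      using card by (metis Suc_diff_1 less_trans of_nat_Suc pos2 add.commute)
    have "of_nat (CARD('m) - 1) * pdiff g \<tau> = of_nat CARD('m) * pdiff g \<tau> - pdiff g \<tau>"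
      unfolding N by (simp add: algebra_simps)
    ultimately have "of_nat (CARD('m) - 1) * pdiff g \<tau> = 0" by simp
    then show ?thesis by (rule cinf_of_nat_mult_eq_0[rotated]) (use card in linarith)
  qed
  then have "\<tau> \<in> \<real>" by (rule pdiff_all_zero_Reals)
  have "pdiff f (s d) = 0" for f d
  proof (rule pdiff_in_Reals_zero, rule Reals_of_nat_mult_cancel)
    show "of_nat CARD('m) * pdiff f (s d) \<in> \<real>" unfolding ds2 W_def using \<open>\<tau> \<in> \<real>\<close> by simp
  qed simp
  then have sR: "s d \<in> \<real>" for d by (rule pdiff_all_zero_Reals)
  have "pdiff e (r c d) = 0" for e c d
  proof (rule pdiff_in_Reals_zero, rule Reals_of_nat_mult_cancel)
    show "of_nat (CARD('m) + 1) * pdiff e (r c d) \<in> \<real>" unfolding s W_def using sR by simp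
  qed simp
  then show ?thesis by (rule pdiff_all_zero_Reals)
qed

section \<open>Invariant connections of Ricci type are flat\<close>

definition vlinear :: "('m::finite formal_vfield \<Rightarrow> 'm cinf fps) \<Rightarrow> bool" where
  "vlinear f \<longleftrightarrow> (\<forall>X Y. f (X + Y) = f X + f Y) \<and> (\<forall>F X. f (F *s X) = F * f X)"

lemma vlinear_sum:
  assumes "vlinear f"
  shows "f (sum X A) = (\<Sum>i\<in>A. f (X i))"
proof -
  have "f 0 = 0" using assms unfolding vlinear_def by (metis add_cancel_right_right)
  then show ?thesis
    using assms by (induction A rule: infinite_finite_induct) (auto simp: vlinear_def)
qed

lemma vlinear_expand:
  assumes "vlinear f"
  shows "f X = (\<Sum>a\<in>UNIV. X $ a * f (frame a))"
proof -
  have "f X = f (\<Sum>a\<in>UNIV. X $ a *s frame a)" by (simp only: basis_expansion)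
  then show ?thesis using assms by (simp add: vlinear_sum) (simp add: vlinear_def)
qed

lemma vlinear_eqI:
  assumes "vlinear f" "vlinear g" "\<And>a. f (frame a) = g (frame a)"
  shows "f X = g X"
  by (subst vlinear_expand[OF assms(1)], subst vlinear_expand[OF assms(2)]) (simp only: assms(3))

text \<open>The product \<open>m X Y\<close> stands for \<open>\<nabla>\<^sub>X Y - \<nabla>\<^sup>0\<^sub>X Y\<close>.\<close>

locale ricci_product = invariant_symplectic \<omega> for \<omega> :: "'m::finite vfield \<Rightarrow> 'm vfield \<Rightarrow> 'm cinf" +
  fixes m :: "'m formal_vfield \<Rightarrow> 'm formal_vfield \<Rightarrow> 'm formal_vfield"
    and r :: "'m formal_vfield \<Rightarrow> 'm formal_vfield \<Rightarrow> 'm cinf fps"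
  assumes card: "CARD('m) > 2"
    and m_add: "m (X + X') Y = m X Y + m X' Y" and m_scale: "m (F *s X) Y = F *s m X Y"
    and m_comm: "m X Y = m Y X"
    and m_om: "om (m X Y) Z = om (m X Z) Y"
    and r: "sym_bilinear r"
    and ricci: "of_nat (CARD('m) + 2) * (om (m X Z) (m Y T) - om (m Y Z) (m X T)) = - ricci_tensor r X Y Z T"
begin

lemma m_add': "m X (Y + Y') = m X Y + m X Y'" and m_scale': "m X (F *s Y) = F *s m X Y"
  using m_add m_scale m_comm by metis+

lemma r_comm: "r X Y = r Y X"
  and r_add: "r (X + X') Y = r X Y + r X' Y" and r_scale: "r (F *s X) Y = F * r X Y"
  using r unfolding sym_bilinear_def by blast+

lemma r_add': "r X (Y + Y') = r X Y + r X Y'" and r_scale': "r X (F *s Y) = F * r X Y"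
  using r_add r_scale r_comm by metis+

lemma m_skew: "om (m X Y) Z = - om Y (m X Z)"
  using m_om[of X Y Z] om_skew[of Y "m X Z"] by simp

text \<open>Minus the algebraic part of the covariant derivative of \<open>r\<close> along
  \<open>e\<close>.\<close>

definition dr where "dr e c d = r (m e c) d + r c (m e d)"

text \<open>The quadratic part of the lowered curvature, which is all of it on the frame when the
  symbols are constant.\<close>

definition Q where "Q X Y Z T = om (m X Z) (m Y T) - om (m Y Z) (m X T)"

lemma dr_comm: "dr e c d = dr e d c"
  by (simp add: dr_def add.commute r_comm)

lemma ricci_Q: "ricci_tensor r X Y Z T = - (of_nat (CARD('m) + 2) * Q X Y Z T)"
  by (simp only: Q_def ricci minus_minus)

text \<open>By \<open>m_skew\<close> the endomorphism \<open>m e\<close> is infinitesimally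
  symplectic: acting as a derivation it annihilates \<omega> and only differentiates
  \<open>r\<close>.\<close>

lemma ricci_tensor_dr:
  "ricci_tensor (dr e) a b c d = ricci_tensor r (m e a) b c d + ricci_tensor r a (m e b) c d
    + ricci_tensor r a b (m e c) d + ricci_tensor r a b c (m e d)"
  by (simp add: ricci_tensor_def dr_def m_skew algebra_simps)

text \<open>The second Bianchi identity in algebraic form. Insertions into the first two slots of
  \<open>Q\<close> cancel cyclically, as \<open>m\<close> is commutative and \<open>Q\<close> skew;
  those into the last two slots give \<open>[m e, [m a, m b]]\<close>, and their cyclic sum vanishes
  by Jacobi.\<close>

lemma bianchi_dr: "ricci_tensor (dr e) a b c d + ricci_tensor (dr a) b e c d + ricci_tensor (dr b) e a c d = 0"
proof -
  have skew: "Q X Y Z T = - Q Y X Z T" for X Y Z T by (simp add: Q_def)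
  have 1: "Q (m e a) b c d + Q a (m e b) c d + (Q (m a b) e c d + Q b (m a e) c d) + (Q (m b e) a c d + Q e (m b a) c d) = 0"
    using skew[of "m e a" b c d] skew[of "m a b" e c d] skew[of "m b e" a c d]
    by (simp add: m_comm[of a e] m_comm[of b a] m_comm[of e b])
  have 2: "Q a b (m e c) d + Q a b c (m e d) = om c (m e (m a (m b d))) - om c (m e (m b (m a d)))
     - om c (m a (m b (m e d))) + om c (m b (m a (m e d)))" for a b e
    by (simp add: Q_def m_skew)
  have "Q a b (m e c) d + Q a b c (m e d) + (Q b e (m a c) d + Q b e c (m a d)) + (Q e a (m b c) d + Q e a c (m b d)) = 0"
    unfolding 2 by simp
  then have "of_nat (CARD('m) + 2) * ((Q (m e a) b c d + Q a (m e b) c d + (Q (m a b) e c d + Q b (m a e) c d) + (Q (m b e) a c d + Q e (m b a) c d))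
     + (Q a b (m e c) d + Q a b c (m e d) + (Q b e (m a c) d + Q b e c (m a d)) + (Q e a (m b c) d + Q e a c (m b d)))) = 0"
    unfolding 1 by simp
  moreover have "ricci_tensor (dr e) a b c d + ricci_tensor (dr a) b e c d + ricci_tensor (dr b) e a c d
    = - (k * ((Q (m e a) b c d + Q a (m e b) c d + (Q (m a b) e c d + Q b (m a e) c d) + (Q (m b e) a c d + Q e (m b a) c d))
     + (Q a b (m e c) d + Q a b c (m e d) + (Q b e (m a c) d + Q b e c (m a d)) + (Q e a (m b c) d + Q e a c (m b d)))))"
    if "k = of_nat (CARD('m) + 2)" for k
    unfolding ricci_tensor_dr ricci_Q that[symmetric] by (simp add: algebra_simps)
  ultimately show ?thesis by simp
qed

section \<open>From the algebraic Bianchi identity to the vanishing of \<open>r\<close>\<close>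

lemma dr_eq: "\<exists>s. vlinear s \<and> (\<forall>e c d. of_nat (CARD('m) + 1) * dr e c d = om e c * s d + om e d * s c)"
proof -
  let ?W = "\<lambda>a b. fps_const (of_real (w a b)) :: 'm cinf fps" and ?V = "\<lambda>a b. fps_const (of_real (v a b)) :: 'm cinf fps"
  have W: "?W a b = - ?W b a" and V: "?V a b = - ?V b a" for a b
    using w_skew[of a b] v_skew[of a b] by simp_all
  note bianchi = bianchi_dr[of "frame e" "frame a" "frame b" "frame c" "frame d" for e a b c d, unfolded ricci_tensor_def om_frame]
  have "\<exists>s. \<forall>e c d. of_nat (CARD('m) + 1) * dr (frame e) (frame c) (frame d) = ?W e c * s d + ?W e d * s c"
    by (rule bianchi_contraction[where v = ?V and T = "\<lambda>e c d. dr (frame e) (frame c) (frame d)",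
          OF fps_of_nat_mult_eq_0 W V const_v_w card dr_comm bianchi])
  then obtain s0 where s0: "\<And>e c d. of_nat (CARD('m) + 1) * dr (frame e) (frame c) (frame d) = ?W e c * s0 d + ?W e d * s0 c"
    by blast
  define s where "s X = (\<Sum>d\<in>UNIV. X $ d * s0 d)" for X :: "'m formal_vfield"
  have s: "s (X + Y) = s X + s Y" "s (F *s X) = F * s X" for X Y F
    by (simp_all add: s_def algebra_simps sum.distrib sum_distrib_left)
  have s_frame: "s (frame d) = s0 d" for d by (simp add: s_def)
  let ?M = "of_nat (CARD('m) + 1) :: 'm cinf fps"
  note lin = vlinear_def dr_def m_add m_scale m_add' m_scale' r_add r_scale r_add' r_scale' s algebra_simps
  have 1: "?M * dr (frame e) (frame c) Z = om (frame e) (frame c) * s Z + om (frame e) Z * s (frame c)" for e c Z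
    by (rule vlinear_eqI[of "\<lambda>Z. ?M * dr (frame e) (frame c) Z"])
       (use s0[of e c] in \<open>auto simp: lin om_frame s_frame simp del: of_nat_add\<close>)
  have 2: "?M * dr (frame e) Y Z = om (frame e) Y * s Z + om (frame e) Z * s Y" for e Y Z
    by (rule vlinear_eqI[of "\<lambda>Y. ?M * dr (frame e) Y Z"])
       (use 1[of e] in \<open>auto simp: lin simp del: of_nat_add\<close>)
  have 3: "?M * dr X Y Z = om X Y * s Z + om X Z * s Y" for X Y Z
    by (rule vlinear_eqI[of "\<lambda>X. ?M * dr X Y Z"])
       (use 2 in \<open>auto simp: lin simp del: of_nat_add\<close>)
  have "vlinear s" using s by (simp add: vlinear_def)
  with 3 show ?thesis by blast
qed

text \<open>The Ricci endomorphism, with the sign that yields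
  \<open>om X (\<rho> Y) = r X Y\<close>.\<close>

definition \<rho> where "\<rho> Y = - sharp (\<lambda>b. r (frame b) Y)"

lemma om_rho: "om X (\<rho> Y) = r X Y"
proof -
  have "vlinear (\<lambda>X. r X Y)" by (simp add: vlinear_def r_add r_scale)
  then have "r X Y = (\<Sum>b\<in>UNIV. r (frame b) Y * X $ b)" by (subst vlinear_expand) (auto simp: mult.commute)
  then show ?thesis using om_skew[of X "\<rho> Y"] by (simp add: \<rho>_def om_sharp)
qed

lemma cancel_nat: "of_nat (Suc k) * F = (0 :: 'm cinf fps) \<Longrightarrow> F = 0"
  using fps_of_nat_mult_eq_0[of "Suc k" F] by (simp del: of_nat_Suc)

lemma r_rho: "r c (\<rho> c) = 0"
  using om_rho[of "\<rho> c" c] r_comm[of c "\<rho> c"] by simp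

text \<open>The Ricci identity for \<open>r\<close> with three equal arguments.\<close>

lemma om_s_square:
  assumes s: "\<And>e c d. of_nat (CARD('m) + 1) * dr e c d = om e c * s d + om e d * s c"
  shows "om e c * s (m c c) = 0"
proof -
  \<comment> \<open>With these arguments the two terms of \<open>ricci_tensor\<close> that are not
    zero individually are both \<open>r e c * r c c\<close>, with opposite signs.\<close>
  have "of_nat (CARD('m) + 2) * Q e c c (\<rho> c) = - ricci_tensor r e c c (\<rho> c)"
    by (simp add: ricci_Q)
  also have "\<dots> = 0" by (simp add: ricci_tensor_def om_rho r_rho r_comm mult.commute)
  finally have "Q e c c (\<rho> c) = 0" using cancel_nat[of "CARD('m) + 1"] by simp
  then have 0: "r (m e (m c c)) c - r (m c (m e c)) c = 0"
    using om_rho m_skew[of c "m e c" "\<rho> c"] m_skew[of e "m c c" "\<rho> c"]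
    by (simp add: Q_def)
  have "om c (m e c) = om e (m c c)"
    using om_skew[of c "m e c"] om_skew[of e "m c c"] m_om[of c e c] m_comm[of e c] by simp
  \<comment> \<open>The two multiples of \<open>s c\<close> cancel by the previous equation.\<close>
  then have "om e c * s (m c c) = of_nat (CARD('m) + 1) * (dr e (m c c) c - dr c (m e c) c)"
    unfolding right_diff_distrib s by simp
  also have "dr e (m c c) c - dr c (m e c) c = 0"
    using 0 r_comm[of "m c c" "m e c"] by (simp add: dr_def)
  finally show ?thesis by simp
qed

text \<open>First \<open>s\<close> is shown to vanish on products; hence its dual vector
  \<open>U\<close> multiplies everything to zero, and the equation for \<open>dr\<close> at
  \<open>U\<close> says that \<open>2 * (s X * s X) = 0\<close>. Then \<open>dr = 0\<close>, so
  \<open>r\<close> vanishes on products, and the same pattern with \<open>\<rho> d\<close> in place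
  of \<open>U\<close> ends in a square of \<open>r Y Y\<close>.\<close>

lemma r_zero: "r X Y = 0"
proof -
  obtain s where lin: "vlinear s"
    and s: "\<And>e c d. of_nat (CARD('m) + 1) * dr e c d = om e c * s d + om e d * s c"
    using dr_eq by blast
  have s_add: "s (X + Y) = s X + s Y" for X Y using lin by (simp add: vlinear_def)
  have dual: "om (sharp (\<lambda>b. if b = a then 1 else 0)) c = c $ a" for a c
    by (simp add: om_sharp if_distrib[of "\<lambda>x. x * _"] cong: if_cong)
  \<comment> \<open>A component equal to 1 provides a vector dual to \<open>c\<close>, so the factor
    \<open>om e c\<close> becomes 1.\<close>
  have sq: "c $ a = 1 \<Longrightarrow> s (m c c) = 0" for a c
    using om_s_square[OF s, of "sharp (\<lambda>b. if b = a then 1 else 0)" c] by (simp add: dual)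
  have frames: "s (m (frame a) (frame b)) = 0" for a b
  proof (cases "a = b")
    case True
    then show ?thesis using sq[of "frame a" a] by simp
  next
    case False
    then have "s (m (frame a + frame b) (frame a + frame b)) = 0" by (intro sq[of _ a]) (simp add: axis_def)
    moreover have "s (m (frame a) (frame a)) = 0" "s (m (frame b) (frame b)) = 0"
      using sq[of "frame a" a] sq[of "frame b" b] by simp_all
    ultimately have "of_nat (Suc 1) * s (m (frame a) (frame b)) = 0"
      unfolding m_add m_add' s_add m_comm[of "frame b" "frame a"] by simp
    then show ?thesis by (rule cancel_nat)
  qed
  have lin_m: "vlinear (\<lambda>Y. s (m X Y))" "vlinear (\<lambda>X. s (m X Y))" for X Y
    using lin by (auto simp: vlinear_def m_add m_add' m_scale m_scale')
  have s_m: "s (m X Y) = 0" for X Y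
  proof -
    have zero: "vlinear (\<lambda>X. 0)" by (simp add: vlinear_def)
    have "s (m (frame a) Y) = 0" for a
      using vlinear_eqI[OF lin_m(1) zero] frames by blast
    then show ?thesis using vlinear_eqI[OF lin_m(2) zero] by blast
  qed
  define U where "U = sharp (\<lambda>d. s (frame d))"
  have U: "om U X = s X" for X
    unfolding U_def om_sharp by (subst vlinear_expand[OF lin]) (simp add: mult.commute)
  have mU: "m U X = 0" for X
  proof (rule om_nondegenerate)
    show "om (m U X) Y = 0" for Y
      using m_comm[of U X] m_skew[of X U Y] by (simp add: U s_m)
  qed
  have r0: "r 0 X = 0" "r X 0 = 0" for X using r_add[of 0 0 X] r_add'[of X 0 0] by auto
  have "s X = 0" for X
  proof (rule fps_square_zero)
    have "of_nat (Suc 1) * (s X * s X) = of_nat (CARD('m) + 1) * dr U X X"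
      unfolding s by (simp add: U)
    also have "\<dots> = 0" by (simp add: dr_def mU r0)
    finally show "s X * s X = 0" by (rule cancel_nat)
  qed
  then have "dr e c d = 0" for e c d using s[of e c d] cancel_nat[of "CARD('m)"] by simp
  then have B: "r (m e c) d = - r (m e d) c" for e c d
    using r_comm[of c "m e d"] by (simp add: dr_def add_eq_0_iff2)
  \<comment> \<open>The expression is symmetric in \<open>e, c\<close> and skew in
    \<open>c, d\<close>; alternating the two symmetries returns it with the opposite sign.\<close>
  have rm: "r (m e c) d = 0" for e c d
  proof -
    have "r (m e c) d = - r (m e c) d"
      using B[of e c d] B[of d e c] B[of c d e] m_comm[of e d] m_comm[of d c] m_comm[of c e] by simp
    then have "of_nat (Suc 1) * r (m e c) d = 0" by simp
    then show ?thesis by (rule cancel_nat)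
  qed
  have m_rho: "m (\<rho> d) X = 0" for d X
  proof (rule om_nondegenerate)
    show "om (m (\<rho> d) X) Y = 0" for Y
      using m_comm[of "\<rho> d" X] m_skew[of X "\<rho> d" Y] om_skew[of "\<rho> d" "m X Y"] by (simp add: om_rho rm)
  qed
  have rr: "r Y Y = 0" for Y
  proof (rule fps_square_zero)
    \<comment> \<open>The coefficient is 2 + 1 + 1 from \<open>ricci_tensor\<close>; its other two
      terms contain \<open>om Y Y\<close>.\<close>
    have "of_nat (Suc 3) * (r Y Y * r Y Y) = - ricci_tensor r (\<rho> Y) Y Y Y"
      using om_skew[of "\<rho> Y" Y] by (simp add: ricci_tensor_def om_rho algebra_simps)
    also have "\<dots> = 0" by (simp add: ricci_Q Q_def m_rho)
    finally show "r Y Y * r Y Y = 0" by (rule cancel_nat)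
  qed
  have "of_nat (Suc 1) * r X Y = 0"
    using rr[of "X + Y"] rr[of X] rr[of Y] r_comm[of Y X] by (simp add: r_add r_add')
  then show ?thesis by (rule cancel_nat)
qed

end

section \<open>Gauge transformations\<close>

lemma (in formal_connection) nth_0:
  assumes "\<And>a b. vcoeff (N (frame a) (frame b)) 0 = 0"
  shows "fps_nth (N X Y $ c) 0 = (\<Sum>a\<in>UNIV. fps_nth (X $ a) 0 * pdiff a (fps_nth (Y $ c) 0))"
proof -
  have "fps_nth (N (frame a) (frame b) $ c) 0 = 0" for a b
    using arg_cong[OF assms[of a b], of "\<lambda>V. V $ c"] by simp
  then show ?thesis by (subst expand) (simp add: fps_sum_nth flat_conn_def der_nth)
qed

context invariant_symplectic
begin

lemma omega_axis: "\<omega> X (axis c 1) = (\<Sum>a\<in>UNIV. X $ a * of_real (w a c))"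
proof -
  have "\<omega> X (axis c 1) = (\<Sum>a\<in>UNIV. X $ a * (\<Sum>b\<in>UNIV. axis c 1 $ b * of_real (w a b)))"
    by (simp only: omega_expand mult.assoc sum_distrib_left)
  then show ?thesis by simp
qed

lemma om_frame_nth: "fps_nth (om V (frame c)) k = \<omega> (vcoeff V k) (axis c 1)"
  using om_const_nth[of V "axis c 1" k] by simp

lemma omega_Reals: "(\<And>a. X $ a \<in> \<real>) \<Longrightarrow> (\<And>a. Y $ a \<in> \<real>) \<Longrightarrow> \<omega> X Y \<in> \<real>"
  by (simp add: omega_expand sum_in_Reals)

lemma Reals_if_omega_Reals:
  assumes "\<And>c. \<omega> X (axis c 1) \<in> \<real>"
  shows "X $ a \<in> \<real>"
proof -
  have "(\<Sum>c\<in>UNIV. \<omega> X (axis c 1) * of_real (v c a)) = (\<Sum>c\<in>UNIV. \<Sum>b\<in>UNIV. X $ b * of_real (w b c * v c a))"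
    by (simp add: omega_axis sum_distrib_right mult.assoc)
  also have "\<dots> = (\<Sum>b\<in>UNIV. X $ b * of_real (\<Sum>c\<in>UNIV. w b c * v c a))"
    by (subst sum.swap) (simp add: sum_distrib_left)
  also have "\<dots> = X $ a" by (simp add: w_v if_distrib[of of_real] if_distrib[of "(*) _"] cong: if_cong)
  finally have "X $ a = (\<Sum>c\<in>UNIV. \<omega> X (axis c 1) * of_real (v c a))" by simp
  then show ?thesis using assms by (simp add: sum_in_Reals)
qed

text \<open>As \<open>X\<close> and \<open>Y\<close> vanish at \<open>t = 0\<close>, order
  \<open>Suc m\<close> of the pairing meets only orders 1 to \<open>m\<close>. This makes quadratic
  curvature terms constant one order further than the symbols.\<close>

lemma om_nth_Reals:
  assumes X: "\<And>k a. k \<le> m \<Longrightarrow> fps_nth (X $ a) k \<in> \<real>" and Y: "\<And>k a. k \<le> m \<Longrightarrow> fps_nth (Y $ a) k \<in> \<real>"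
    and "vcoeff X 0 = 0" "vcoeff Y 0 = 0"
  shows "fps_nth (om X Y) (Suc m) \<in> \<real>"
proof -
  have zero: "\<omega> 0 Z = 0" "\<omega> Z 0 = 0" for Z by (simp_all add: omega_expand)
  have "\<omega> (vcoeff X i) (vcoeff Y (Suc m - i)) \<in> \<real>" if "i \<le> Suc m" for i
  proof (cases "i = 0 \<or> i = Suc m")
    case True
    then show ?thesis using assms(3,4) zero by auto
  next
    case False
    then show ?thesis using that by (intro omega_Reals) (auto intro: X Y)
  qed
  then show ?thesis unfolding formal_form_def by (auto intro!: sum_in_Reals simp del: sum.atMost_Suc)
qed

definition gauged where
  "gauged N H X Y = vflow (hamf H) (N (inv (vflow (hamf H)) X) (inv (vflow (hamf H)) Y))"

lemma gauged_eq_push: "gauged N H = formal_symplecto.push (vflow (hamf H)) N"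
proof -
  interpret S: formal_symplecto \<omega> "flow (hamf H)" "vflow (hamf H)" by (rule formal_symplecto_flow)
  show ?thesis by (intro ext) (simp add: gauged_def S.push_def)
qed

lemma formal_connection_gauged:
  assumes "formal_connection \<omega> N"
  shows "formal_connection \<omega> (gauged N H)"
  unfolding gauged_eq_push
  by (rule formal_symplecto.formal_connection_push[OF formal_symplecto_flow assms])

lemma ricci_typed_gauged: "ricci_typed N r \<Longrightarrow> \<exists>r. ricci_typed (gauged N H) r"
  unfolding gauged_eq_push
  using formal_symplecto.ricci_typed_push[OF formal_symplecto_flow] by blast

lemma vflow_gauged: "vflow (hamf H) (N X Y) = gauged N H (vflow (hamf H) X) (vflow (hamf H) Y)"
proof -
  interpret S: formal_symplecto \<omega> "flow (hamf H)" "vflow (hamf H)" by (rule formal_symplecto_flow)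
  show ?thesis by (simp add: gauged_def S.V_inv)
qed

end

locale flat_start = formal_connection +
  assumes start: "vcoeff (N (frame a) (frame b)) 0 = 0"
begin

lemma gauged_start: "vcoeff (gauged N H (frame a) (frame b)) 0 = 0"
proof -
  interpret S: formal_symplecto \<omega> "flow (hamf H)" "vflow (hamf H)" by (rule formal_symplecto_flow)
  have "fps_nth (inv (vflow (hamf H)) (frame b) $ c) 0 = fps_nth (frame b $ c) 0" for b c
    using vflow_nth_0[of "hamf H" "inv (vflow (hamf H)) (frame b)" c] by (simp add: S.V_inv)
  then show ?thesis
    by (simp add: vec_eq_iff gauged_def nth_0[OF start]) (simp add: axis_def)
qed

lemma flat_start_gauged: "flat_start \<omega> (gauged N H)"
proof -
  interpret G: formal_connection \<omega> "gauged N H"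
    by (rule formal_connection_gauged) (rule formal_connection_axioms)
  show ?thesis by standard (rule gauged_start)
qed

text \<open>At leading order the change is the Lie derivative of the flat connection along a
  Hamiltonian field, which lowered with \<omega> is the third derivative of the Hamiltonian. Only
  values at \<open>t = 0\<close> matter, where the flow is the identity and the symbols vanish;
  \<open>Suc m\<close> is the factor of \<open>vflow_perturb\<close>.\<close>

lemma gauged_perturb:
  fixes H G :: "'a cinf fps" and m :: nat
  defines "H' \<equiv> H + fps_X ^ m * G"
  shows "k \<le> m \<Longrightarrow> vcoeff (gauged N H' (frame a) (frame b)) k = vcoeff (gauged N H (frame a) (frame b)) k"
    and "of_nat (Suc m) * (fps_nth (om (gauged N H' (frame a) (frame b)) (frame c)) (Suc m)
        - fps_nth (om (gauged N H (frame a) (frame b)) (frame c)) (Suc m))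
      = pdiff a (pdiff b (pdiff c (fps_nth G 0)))"
proof -
  let ?X = "hamf H" and ?X' = "hamf H'" and ?t = "fps_X ^ Suc m :: 'a cinf fps"
  have X': "?X' = ?X + fps_X ^ m *s hamf G" by (simp add: H'_def)
  interpret S: formal_symplecto \<omega> "flow ?X" "vflow ?X" by (rule formal_symplecto_flow)
  interpret M: flat_start \<omega> "gauged N H'" by (rule flat_start_gauged)
  define g where "g c = fps_nth (hamf G $ c) 0" for c
  have pert: "\<exists>A. vflow ?X' V = vflow ?X V + ?t *s A \<and> of_nat (Suc m) *s vcoeff A 0 = vcoeff (br (hamf G) V) 0" for V
  proof (intro exI conjI)
    let ?A = "\<chi> c. fps_shift (Suc m) ((vflow ?X' V - vflow ?X V) $ c)"
    have "fps_nth (vflow ?X' V $ c) k = fps_nth (vflow ?X V $ c) k" if "k \<le> m" for k c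
      using vflow_perturb(1)[OF that, of ?X "hamf G" V] by (simp add: X' vec_eq_iff)
    then show "vflow ?X' V = vflow ?X V + ?t *s ?A"
      by (auto simp: vec_eq_iff fps_eq_iff fps_X_power_mult_nth simp del: power_Suc)
    have "vcoeff ?A 0 = vcoeff (vflow ?X' V) (Suc m) - vcoeff (vflow ?X V) (Suc m)"
      by (simp add: vec_eq_iff)
    then show "of_nat (Suc m) *s vcoeff ?A 0 = vcoeff (br (hamf G) V) 0"
      using vflow_perturb(2)[of m ?X "hamf G" V] by (simp only: X')
  qed
  \<comment> \<open>The old flow sends \<open>Y a\<close> to \<open>frame a\<close>. Expanding the
    new flow on \<open>N (Y a) (Y b)\<close> in two ways then relates both transformed connections
    in one equation.\<close>
  define Y where "Y a = inv (vflow ?X) (frame a)" for a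
  have Y: "vflow ?X (Y a) = frame a" for a by (simp add: Y_def S.V_inv)
  have Y0: "fps_nth (Y a $ c) 0 = axis a 1 $ c" for a c
  proof -
    have "fps_nth (Y a $ c) 0 = fps_nth (frame a $ c) 0"
      using vflow_nth_0[of ?X "Y a" c] by (simp only: Y)
    then show ?thesis by (simp add: axis_def)
  qed
  obtain A where A: "vflow ?X' (Y a) = frame a + ?t *s A" using pert[of "Y a"] Y by auto
  obtain B where B: "vflow ?X' (Y b) = frame b + ?t *s B"
    and B0: "of_nat (Suc m) *s vcoeff B 0 = vcoeff (br (hamf G) (Y b)) 0"
    using pert[of "Y b"] Y by auto
  have B0: "of_nat (Suc m) * fps_nth (B $ c) 0 = - pdiff b (g c)" for c
    using arg_cong[OF B0, of "\<lambda>V. V $ c"]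
    by (simp add: formal_lie_bracket_def der_nth Y0 g_def del: of_nat_Suc) (simp add: axis_def)
  define W where "W = N (Y a) (Y b)"
  have W: "vflow ?X W = gauged N H (frame a) (frame b)" by (simp add: W_def vflow_gauged Y)
  have W0: "fps_nth (W $ c) 0 = 0" for c
    using vflow_nth_0[of ?X W c] arg_cong[OF gauged_start[of H a b], of "\<lambda>V. V $ c"] by (simp add: W)
  obtain C where C: "vflow ?X' W = vflow ?X W + ?t *s C"
    and C0: "of_nat (Suc m) *s vcoeff C 0 = vcoeff (br (hamf G) W) 0"
    using pert[of W] by auto
  \<comment> \<open>\<open>W\<close> vanishes at \<open>t = 0\<close>, and so does its bracket with
    \<open>hamf G\<close>.\<close>
  have C0: "fps_nth (C $ c) 0 = 0" for c
  proof -
    have "of_nat (Suc m) * fps_nth (C $ c) 0 = 0"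
      using arg_cong[OF C0, of "\<lambda>V. V $ c"]
      by (simp add: formal_lie_bracket_def der_nth W0 del: of_nat_Suc)
    then show ?thesis by (rule cinf_of_nat_mult_eq_0[rotated]) simp
  qed
  let ?M = "gauged N H'"
  have der_t: "der V ?t = 0" for V by (rule der_X_power)
  have "vflow ?X' W = ?M (frame a + ?t *s A) (frame b + ?t *s B)"
    by (simp only: W_def vflow_gauged A B)
  also have "\<dots> = ?M (frame a) (frame b) + ?t *s (?M A (frame b) + ?M (frame a) B + ?t *s ?M A B)"
    by (simp only: M.add_left M.add_right M.scale_left M.scale_right der_t) (simp add: vec_eq_iff algebra_simps)
  finally have main: "gauged N H (frame a) (frame b) + ?t *s C
      = ?M (frame a) (frame b) + ?t *s (?M A (frame b) + ?M (frame a) B + ?t *s ?M A B)"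
    by (simp only: C W)
  show low: "vcoeff (?M (frame a) (frame b)) k = vcoeff (gauged N H (frame a) (frame b)) k" if "k \<le> m"
    using arg_cong[OF main, of "\<lambda>V. vcoeff V k"] that
    by (simp add: vec_eq_iff mult.assoc fps_X_power_mult_nth del: power_Suc)
  \<comment> \<open>Only \<open>?M (frame a) B\<close> contributes a correction at this order: at
    \<open>t = 0\<close> the symbols vanish and \<open>frame b\<close> has derivative zero.\<close>
  have "fps_nth (gauged N H (frame a) (frame b) $ d) (Suc m)
      = fps_nth (?M (frame a) (frame b) $ d) (Suc m) + pdiff a (fps_nth (B $ d) 0)" for d
  proof -
    have "fps_nth (?M A (frame b) $ d) 0 = 0"
      unfolding M.nth_0[OF M.start] by (simp add: axis_def if_distrib[of "\<lambda>x. fps_nth x 0"] if_distrib[of "pdiff _"] cong: if_cong)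
    moreover have "fps_nth (?M (frame a) B $ d) 0 = pdiff a (fps_nth (B $ d) 0)"
    proof -
      have "fps_nth (frame a $ e) 0 = axis a 1 $ e" for e by (simp add: axis_def)
      then show ?thesis unfolding M.nth_0[OF M.start] by simp
    qed
    ultimately show ?thesis
      using arg_cong[OF main, of "\<lambda>V. fps_nth (V $ d) (Suc m)"]
      by (simp add: mult.assoc fps_X_power_mult_nth C0 del: power_Suc)
  qed
  then have diff: "fps_nth (?M (frame a) (frame b) $ d) (Suc m) - fps_nth (gauged N H (frame a) (frame b) $ d) (Suc m)
     = - pdiff a (fps_nth (B $ d) 0)" for d by simp
  have "of_nat (Suc m) * (fps_nth (om (?M (frame a) (frame b)) (frame c)) (Suc m)
        - fps_nth (om (gauged N H (frame a) (frame b)) (frame c)) (Suc m))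
      = (\<Sum>d\<in>UNIV. of_nat (Suc m) * (fps_nth (?M (frame a) (frame b) $ d) (Suc m) - fps_nth (gauged N H (frame a) (frame b) $ d) (Suc m)) * of_real (w d c))"
    by (simp only: om_frame_nth omega_axis vcoeff_nth sum_subtractf[symmetric] sum_distrib_left
        left_diff_distrib[symmetric] mult.assoc)
  also have "\<dots> = (\<Sum>d\<in>UNIV. pdiff a (pdiff b (g d)) * of_real (w d c))"
  proof (intro sum.cong refl)
    fix d
    have "of_nat (Suc m) * - pdiff a (fps_nth (B $ d) 0) = - pdiff a (of_nat (Suc m) * fps_nth (B $ d) 0)"
      by (simp del: of_nat_Suc)
    then show "of_nat (Suc m) * (fps_nth (?M (frame a) (frame b) $ d) (Suc m) - fps_nth (gauged N H (frame a) (frame b) $ d) (Suc m)) * of_real (w d c)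
      = pdiff a (pdiff b (g d)) * of_real (w d c)"
      unfolding diff B0 by simp
  qed
  also have "\<dots> = pdiff a (pdiff b (\<Sum>d\<in>UNIV. g d * of_real (w d c)))" by simp
  also have "(\<Sum>d\<in>UNIV. g d * of_real (w d c)) = pdiff c (fps_nth G 0)"
    using om_frame_nth[of "hamf G" c 0] by (simp add: om_hamf omega_axis g_def)
  finally show "of_nat (Suc m) * (fps_nth (om (?M (frame a) (frame b)) (frame c)) (Suc m)
        - fps_nth (om (gauged N H (frame a) (frame b)) (frame c)) (Suc m))
      = pdiff a (pdiff b (pdiff c (fps_nth G 0)))" .
qed

section \<open>Construction of the Hamiltonian order by order\<close>

definition invariant_upto :: "nat \<Rightarrow> 'a cinf fps \<Rightarrow> bool" where
  "invariant_upto m H \<longleftrightarrow> (\<forall>k\<le>m. \<forall>a b c. fps_nth (gauged N H (frame a) (frame b) $ c) k \<in> \<real>)"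

lemma invariant_upto_0: "invariant_upto 0 H"
  using arg_cong[OF gauged_start, of "\<lambda>V. V $ _"] by (simp add: invariant_upto_def)

lemma invariant_upto_cong:
  assumes "invariant_upto m H"
  shows "invariant_upto m (H + fps_X ^ m * G)"
proof -
  have "fps_nth (gauged N (H + fps_X ^ m * G) (frame a) (frame b) $ c) k = fps_nth (gauged N H (frame a) (frame b) $ c) k"
    if "k \<le> m" for k a b c
    using gauged_perturb(1)[OF that, of H G a b] by (simp add: vec_eq_iff)
  then show ?thesis using assms by (simp add: invariant_upto_def)
qed

lemma invariant_upto_Suc:
  assumes card: "CARD('a) > 2" and ricci: "ricci_typed N r0" and inv: "invariant_upto m H"
  shows "\<exists>g. invariant_upto (Suc m) (H + fps_X ^ m * fps_const g)"
proof -
  let ?M = "gauged N H"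
  interpret M: flat_start \<omega> ?M by (rule flat_start_gauged)
  obtain r where "ricci_typed ?M r" using ricci_typed_gauged[OF ricci] by blast
  then have r_sym: "r X Y = r Y X"
    and eq: "of_nat (CARD('a) + 2) * om (curv ?M X Y Z) T = - ricci_tensor r X Y Z T" for X Y Z T
    unfolding ricci_typed_def sym_bilinear_def by blast+
  define A where "A a b c = fps_nth (om (?M (frame a) (frame b)) (frame c)) (Suc m)" for a b c
  define R where "R a b = fps_nth (r (frame a) (frame b)) (Suc m)" for a b
  define q where "q a b c d = fps_nth (om (?M (frame a) (frame c)) (?M (frame b) (frame d)) - om (?M (frame b) (frame c)) (?M (frame a) (frame d))) (Suc m)" for a b c d
  have q: "q a b c d \<in> \<real>" for a b c d
  proof -
    have "fps_nth (om (?M (frame a) (frame b)) (?M (frame c) (frame d))) (Suc m) \<in> \<real>" for a b c d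
      using inv M.start by (intro om_nth_Reals) (auto simp: invariant_upto_def)
    then show ?thesis by (simp add: q_def)
  qed
  let ?K = "of_nat (CARD('a) + 2) :: 'a cinf"
  let ?E = "\<lambda>a b c d. 2 * of_real (w a b) * R c d + of_real (w a c) * R b d + of_real (w a d) * R b c
        - of_real (w b c) * R a d - of_real (w b d) * R a c"
  have E: "?K * (pdiff a (A b c d) - pdiff b (A a c d) + q a b c d) = - ?E a b c d" for a b c d
  proof -
    have nat: "fps_nth (of_nat k * F) n = of_nat k * fps_nth F n" for k F n
      by (simp flip: fps_of_nat)
    have two: "fps_nth (2 * fps_const f * F) n = 2 * f * fps_nth F n" for f F n
      using nat[of 2 "fps_const f * F" n] by (simp add: mult.assoc)
    have "?K * (pdiff a (A b c d) - pdiff b (A a c d) + q a b c d)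
      = fps_nth (of_nat (CARD('a) + 2) * om (curv ?M (frame a) (frame b) (frame c)) (frame d)) (Suc m)"
      unfolding M.curv_frame nat by (simp add: A_def q_def algebra_simps)
    also have "\<dots> = - ?E a b c d"
      unfolding eq by (simp add: ricci_tensor_def om_frame two R_def)
    finally show ?thesis .
  qed
  \<comment> \<open>Scaling \<open>A\<close> by \<open>- ?K\<close> matches the sign and
    normalisation in \<open>bianchi_torus_constant\<close>.\<close>
  have R: "R c d \<in> \<real>" for c d
  proof (rule bianchi_torus_constant[OF card, where A = "\<lambda>a b c. - (?K * A a b c)"])
    show "R c d = R d c" for c d by (simp add: R_def r_sym)
    fix a b c d
    have "pdiff a (- (?K * A b c d)) - pdiff b (- (?K * A a c d)) - ?E a b c d = ?K * q a b c d"
      using E[of a b c d] by (simp add: algebra_simps)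
    also have "\<dots> \<in> \<real>" using q by simp
    finally show "pdiff a (- (?K * A b c d)) - pdiff b (- (?K * A a c d)) - ?E a b c d \<in> \<real>" .
  qed
  have closed: "pdiff a (A b c d) - pdiff b (A a c d) \<in> \<real>" for a b c d
  proof -
    have "?K * (pdiff a (A b c d) - pdiff b (A a c d) + q a b c d) \<in> \<real>" unfolding E using R by simp
    then have "pdiff a (A b c d) - pdiff b (A a c d) + q a b c d \<in> \<real>"
      by (rule Reals_of_nat_mult_cancel) simp
    from Reals_diff[OF this q[of a b c d]] show ?thesis by simp
  qed
  have "A a b c = A b a c" "A a b c = A a c b" for a b c
    unfolding A_def by (simp only: M.frame_sym[of a b], simp only: M.frame_om_sym[of a b c])
  from torus_symmetric_potential[OF this closed] obtain k h
    where h: "\<And>a b c. A a b c = of_real (k a b c) + pdiff a (pdiff b (pdiff c h))" by blast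
  \<comment> \<open>The factor undoes the division by \<open>Suc m\<close> in
    \<open>gauged_perturb\<close>; the sign makes the third derivatives of \<open>h\<close>
    cancel.\<close>
  define g where "g = - (real (Suc m) *\<^sub>R h)"
  let ?H = "H + fps_X ^ m * fps_const g"
  have "fps_nth (om (gauged N ?H (frame a) (frame b)) (frame c)) (Suc m) = of_real (k a b c)" (is "?l = _") for a b c
  proof -
    have "of_nat (Suc m) * (?l - A a b c) = - (real (Suc m) *\<^sub>R pdiff a (pdiff b (pdiff c h)))"
      using gauged_perturb(2)[of m H "fps_const g" a b c] by (simp add: A_def g_def)
    also have "\<dots> = of_nat (Suc m) * - pdiff a (pdiff b (pdiff c h))"
      by (simp add: scaleR_conv_of_real)
    finally have "of_nat (Suc m) * ((?l - A a b c) - - pdiff a (pdiff b (pdiff c h))) = 0"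
      by (simp only: right_diff_distrib diff_self)
    then have "(?l - A a b c) - - pdiff a (pdiff b (pdiff c h)) = 0"
      by (rule cinf_of_nat_mult_eq_0[rotated]) simp
    then show ?thesis by (simp add: h algebra_simps)
  qed
  then have "fps_nth (gauged N ?H (frame a) (frame b) $ c) (Suc m) \<in> \<real>" for a b c
    using Reals_if_omega_Reals[of "vcoeff (gauged N ?H (frame a) (frame b)) (Suc m)" c]
    by (simp flip: om_frame_nth)
  moreover have "invariant_upto m ?H" by (rule invariant_upto_cong[OF inv])
  ultimately have "invariant_upto (Suc m) ?H" by (simp add: invariant_upto_def le_Suc_eq)
  then show ?thesis by blast
qed

text \<open>Each coefficient of the Hamiltonian is changed only once, so the limit exists; it agrees
  with \<open>f m\<close> below order \<open>m\<close>, and \<open>invariant_upto m\<close> depends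
  on nothing else.\<close>

lemma exists_invariant_gauge:
  assumes card: "CARD('a) > 2" and ricci: "ricci_typed N r0"
  shows "\<exists>H. \<forall>a b c k. fps_nth (gauged N H (frame a) (frame b) $ c) k \<in> \<real>"
proof -
  obtain f where f: "\<And>m. invariant_upto m (f m)" and step: "\<And>m. \<exists>g. f (Suc m) = f m + fps_X ^ m * fps_const g"
    using dependent_nat_choice[of invariant_upto "\<lambda>m H H'. \<exists>g. H' = H + fps_X ^ m * fps_const g"]
      invariant_upto_0 invariant_upto_Suc[OF card ricci] by metis
  have stable: "fps_nth (f (m + j)) k = fps_nth (f m) k" if "k < m" for m j k
  proof (induction j)
    case (Suc j)
    obtain g where "f (Suc (m + j)) = f (m + j) + fps_X ^ (m + j) * fps_const g" using step by blast
    then show ?case using Suc that by (simp add: fps_X_power_mult_nth)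
  qed simp
  \<comment> \<open>Coefficient \<open>k\<close> changes only in the passage from \<open>f k\<close>
    to \<open>f (Suc k)\<close>.\<close>
  define H where "H = Abs_fps (\<lambda>k. fps_nth (f (Suc k)) k)"
  have "invariant_upto m H" for m
  proof -
    have "fps_nth H k = fps_nth (f m) k" if "k < m" for k
      using stable[of k "Suc k" "m - Suc k"] that by (simp add: H_def)
    then have "H = f m + fps_X ^ m * fps_shift m (H - f m)"
      by (auto simp: fps_eq_iff fps_X_power_mult_nth)
    then show ?thesis using invariant_upto_cong[OF f[of m]] by metis
  qed
  then show ?thesis unfolding invariant_upto_def by blast
qed

end

text \<open>Constant symbols remove the derivatives from \<open>curv_frame\<close>, so on the frame
  the condition is an identity for the tensor \<open>m\<close>; linearity in each slot extends it to
  all fields, as \<open>ricci_product\<close> demands.\<close>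

lemma (in formal_connection) invariant_ricci_flat:
  assumes card: "CARD('m) > 2" and ricci: "ricci_typed N r"
    and const: "\<And>a b c k. fps_nth (N (frame a) (frame b) $ c) k \<in> \<real>"
  shows "curv N X Y Z = 0"
proof -
  define m where "m X Y = N X Y - flat_conn X Y" for X Y
  have r: "sym_bilinear r"
    and eq: "\<And>X Y Z T. of_nat (CARD('m) + 2) * om (curv N X Y Z) T = - ricci_tensor r X Y Z T"
    using conjunct1[OF ricci[unfolded ricci_typed_def]]
      conjunct2[OF ricci[unfolded ricci_typed_def], rule_format] by blast+
  have r_comm: "r X Y = r Y X" for X Y using r unfolding sym_bilinear_def by blast
  have r_lin: "r (X + X') Y = r X Y + r X' Y" "r (F *s X) Y = F * r X Y" for X X' Y F
    using r unfolding sym_bilinear_def by blast+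
  have r_lin': "r Y (X + X') = r Y X + r Y X'" "r Y (F *s X) = F * r Y X" for X X' Y F
    using r_lin r_comm by metis+
  have m_add: "m (X + X') Y = m X Y + m X' Y" and m_scale: "m (F *s X) Y = F *s m X Y" for X X' Y F
    by (simp_all add: m_def add_left scale_left vec_eq_iff algebra_simps)
  have m_comm: "m X Y = m Y X" for X Y
    using torsion[of X Y] by (simp add: m_def br_flat_conn algebra_simps)
  have m_lin': "m Y (X + X') = m Y X + m Y X'" "m Y (F *s X) = F *s m Y X" for X X' Y F
    using m_add m_scale m_comm by metis+
  have m_om: "om (m X Y) Z = om (m X Z) Y" for X Y Z
  proof -
    have "om (m X Y) Z + om Y (m X Z) = 0"
      using compatible[of X Y Z] by (simp add: der_om m_def algebra_simps)
    then show ?thesis using om_skew[of Y "m X Z"] by simp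
  qed
  have m_frame: "m (frame a) (frame b) = N (frame a) (frame b)" for a b by (simp add: m_def)
  let ?L = "\<lambda>X Y Z T. of_nat (CARD('m) + 2) * (om (m X Z) (m Y T) - om (m Y Z) (m X T))"
  let ?R = "\<lambda>X Y Z T. - ricci_tensor r X Y Z T"
  have fd: "fdiff e (om (N (frame a) (frame b)) (frame c)) = 0" for e a b c
  proof (rule fps_ext)
    fix k
    have "\<omega> (vcoeff (N (frame a) (frame b)) k) (axis c 1) \<in> \<real>"
      using const by (intro omega_Reals) (auto simp: axis_def)
    then obtain x where "\<omega> (vcoeff (N (frame a) (frame b)) k) (axis c 1) = of_real x" by (rule Reals_cases)
    then show "fps_nth (fdiff e (om (N (frame a) (frame b)) (frame c))) k = fps_nth 0 k"
      by (simp add: om_frame_nth)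
  qed
  note lin = vlinear_def ricci_tensor_def m_add m_scale m_lin' r_lin r_lin' algebra_simps
  have 0: "?L (frame a) (frame b) (frame c) (frame d) = ?R (frame a) (frame b) (frame c) (frame d)" for a b c d
    using eq[of "frame a" "frame b" "frame c" "frame d"] unfolding curv_frame m_frame fd by simp
  have 1: "?L (frame a) (frame b) (frame c) T = ?R (frame a) (frame b) (frame c) T" for a b c T
    by (rule vlinear_eqI[of "?L (frame a) (frame b) (frame c)"], simp_all only: 0) (simp_all add: lin del: of_nat_add)
  have 2: "?L (frame a) (frame b) Z T = ?R (frame a) (frame b) Z T" for a b Z T
    by (rule vlinear_eqI[of "\<lambda>Z. ?L (frame a) (frame b) Z T"], simp_all only: 1) (simp_all add: lin del: of_nat_add)
  have 3: "?L (frame a) Y Z T = ?R (frame a) Y Z T" for a Y Z T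
    by (rule vlinear_eqI[of "\<lambda>Y. ?L (frame a) Y Z T"], simp_all only: 2) (simp_all add: lin del: of_nat_add)
  have 4: "?L X Y Z T = ?R X Y Z T" for X Y Z T
    by (rule vlinear_eqI[of "\<lambda>X. ?L X Y Z T"], simp_all only: 3) (simp_all add: lin del: of_nat_add)
  interpret P: ricci_product \<omega> m r
    by standard (rule card m_add m_scale m_comm m_om r 4)+
  have "r = (\<lambda>X Y. 0)" by (intro ext) (rule P.r_zero)
  then show ?thesis using ricci by (intro ricci_typed_flat) simp
qed

theorem theorem1:
  fixes n :: nat
    and \<omega> :: "'m::finite vfield \<Rightarrow> 'm vfield \<Rightarrow> 'm cinf"
    and D :: "nat \<Rightarrow> 'm vfield \<Rightarrow> 'm vfield \<Rightarrow> 'm vfield"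
  assumes "CARD('m) = 2 * n" and "2 * n \<ge> 4"
    and "symplectic_form \<omega>" and "invariant_form \<omega>"
    and "formal_symplectic_curve \<omega> D"
    and "standard_flat_connection (D 0)"
    and "ricci_type \<omega> D"
  shows "flat D \<and>
    (\<exists>\<psi> D'. formal_symplectomorphism \<omega> \<psi> \<and>
      formal_op D' = push_connection (formal_ext \<psi>) (formal_op D) \<and>
      formal_symplectic_curve \<omega> D' \<and> flat D' \<and> invariant_curve D')"
proof -
  interpret invariant_symplectic \<omega> by standard (rule assms)+
  have card: "CARD('m) > 2" using assms by simp
  let ?N = "formal_op D"
  note conn = formal_connection_formal_op[OF assms(5,6)]
  interpret N: flat_start \<omega> ?N
    using conn by (simp add: flat_start_def flat_start_axioms_def)
  obtain r where r: "ricci_typed ?N r" using ricci_typed_if_ricci_type[OF conn(1) assms(7)] by blast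
  obtain H where H: "\<And>a b c k. fps_nth (gauged ?N H (frame a) (frame b) $ c) k \<in> \<real>"
    using N.exists_invariant_gauge[OF card r] by blast
  let ?\<Psi> = "flow (hamf H)" and ?V = "vflow (hamf H)" and ?M = "gauged ?N H"
  interpret S: formal_symplecto \<omega> ?\<Psi> ?V by (rule formal_symplecto_flow)
  interpret M: formal_connection \<omega> ?M by (rule formal_connection_gauged[OF conn(1)])
  obtain r' where "ricci_typed ?M r'" using ricci_typed_gauged[OF r] by blast
  then have M_flat: "curv ?M X Y Z = 0" for X Y Z
    using M.invariant_ricci_flat[OF card] H by blast
  \<comment> \<open>Curvature is carried along by the bijection \<open>?V\<close>, so flatness
    passes back from the invariant connection to the given one.\<close>
  have "?V (curv ?N X Y Z) = ?V 0" for X Y Z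
    using S.curv_push[of ?N X Y Z] M_flat by (simp add: gauged_eq_push S.V_zero)
  then have "curv ?N X Y Z = 0" for X Y Z
    using S.bijV by (metis bij_pointE)
  then have "flat D" by (simp add: flat_def curvature_eq)
  let ?\<psi> = "\<lambda>f. ?\<Psi> (fps_const f)" and ?D' = "M.coeffs"
  have "formal_op ?D' = push_connection (formal_ext ?\<psi>) ?N"
    by (intro ext) (simp only: formal_ext_flow S.push_connection M.formal_op_coeffs gauged_def)
  moreover have "flat ?D'" using M_flat by (simp add: flat_def curvature_eq M.formal_op_coeffs)
  moreover have "invariant_curve ?D'"
    using H by (simp add: invariant_curve_def M.coeffs_def)
  ultimately show ?thesis
    using \<open>flat D\<close> formal_symplectomorphism_flow[of H] M.formal_symplectic_curve_coeffs by blast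
qed

end
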